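(* Let $n\ge 2$, let $1<s\le\infty$, let $\Omega\in L^s(S^{n-1})$ be homogeneous of degree zero on $\mathbb R^n$, and let $b\in BMO(\mathbb R^n)$. Let $0<\alpha<n$, $1\le s'<p<n/\alpha$, $1/q=1/p-\alpha/n$, $0<\kappa<p/q$, and let $w$ be a weight on $\mathbb R^n$ with $w^{s'}\in A(p/s',q/s')$. Then the commutator $$[b,M_{\Omega,\alpha}](f)(x)=\sup_{r>0}\frac{1}{r^{n-\alpha}}\int_{|y-x|\le r}|b(x)-b(y)|\,|\Omega(x-y)f(y)|\,dy$$ is bounded from $L^{p,\kappa}(w^p,w^q)$ to $L^{q,\kappa q/p}(w^q)$; that is, there is a constant $C>0$ such that $\|[b,M_{\Omega,\alpha}](f)\|_{L^{q,\kappa q/p}(w^q)}\le C\|f\|_{L^{p,\kappa}(w^p,w^q)}$ for all $f\in L^{p,\kappa}(w^p,w^q)$.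
   Context: Notation: $S^{n-1}$ is the unit sphere of $\mathbb R^n$ with normalized Lebesgue measure $d\sigma$; $\Omega$ homogeneous of degree zero means $\Omega(\lambda x)=\Omega(x)$ for all $\lambda>0$, $x\neq 0$, and $\Omega\in L^s(S^{n-1})$ refers to its restriction to $S^{n-1}$. Here $s'=s/(s-1)$ if $1<s<\infty$ and $s'=1$ if $s=\infty$. A weight is a nonnegative locally integrable function on $\mathbb R^n$. For a weight $v$ and a ball $B$, $v(B)=\int_B v(x)\,dx$, and $|B|$ is the Lebesgue measure of $B$. A locally integrable function $b$ is in $BMO(\mathbb R^n)$ if $\|b\|_*=\sup_B\frac1{|B|}\int_B|b(x)-b_B|\,dx<\infty$, where $b_B=\frac1{|B|}\int_B b(y)\,dy$ and the supremum is over all balls $B$ in $\mathbb R^n$. Class $A(p,q)$: for $1<p<q<\infty$, a weight $w$ belongs to $A(p,q)$ if there is $C>0$ such that for every ball $B\subseteq\mathbb R^n$, $$\left(\frac1{|B|}\int_B w(x)^q\,dx\right)^{1/q}\left(\frac1{|B|}\int_B w(x)^{-p'}\,dx\right)^{1/p'}\le C,$$ where $p'=p/(p-1)$. Weighted Morrey spaces: for $1\le p<\infty$, $0<\kappa<1$ and a weight $w$, $L^{p,\kappa}(w)$ is the set of $f\in L^p_{loc}(w)$ with $$\|f\|_{L^{p,\kappa}(w)}=\sup_B\left(\frac1{w(B)^\kappa}\int_B|f(x)|^p w(x)\,dx\right)^{1/p}<\infty.$$ For two weights $u,v$, $L^{p,\kappa}(u,v)$ is the set of $f\in L^p_{loc}(u)$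 with $$\|f\|_{L^{p,\kappa}(u,v)}=\sup_B\left(\frac1{v(B)^\kappa}\int_B|f(x)|^p u(x)\,dx\right)^{1/p}<\infty.$$ Both suprema are over all balls $B\subseteq\mathbb R^n$. *)

theory Defs
  imports "HOL-Analysis.Analysis" "HOL-Probability.Essential_Supremum"
begin

text \<open>
  Functions are scalar-valued with scalars in a complete normed field \<open>'k\<close> (the reals or the
  complex numbers). Norms, averages of nonnegative functions and maximal functions take values in
  \<^typ>\<open>ennreal\<close>, where \<open>0 * \<infinity> = 0\<close>, \<open>1 / 0 = \<infinity>\<close> and \<open>1 / \<infinity> = 0\<close>.
\<close>

text \<open>
  Powers with nonzero real exponent on \<open>[0, \<infinity>]\<close>. Unlike for \<^term>\<open>(powr) :: real \<Rightarrow> real \<Rightarrow> real\<close>, a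
  negative power of \<open>0\<close> is \<open>\<infinity>\<close>; this matters for negative powers of weights.
\<close>
definition epowr :: "ennreal \<Rightarrow> real \<Rightarrow> ennreal" where
  "epowr x a =
     (if x = \<infinity> then (if a > 0 then \<infinity> else 0)
      else if x = 0 \<and> a < 0 then \<infinity>
      else ennreal (enn2real x powr a))"

definition conj_exponent :: "ereal \<Rightarrow> real" where
  "conj_exponent s = (if s = \<infinity> then 1 else real_of_ereal s / (real_of_ereal s - 1))"

definition balls :: "'a::euclidean_space set set" where
  "balls = {ball c r | c r. r > 0}"

definition loc_integrable ::
  "('a::euclidean_space \<Rightarrow> 'b::{banach, second_countable_topology}) \<Rightarrow> bool" where
  "loc_integrable f \<longleftrightarrow> (\<forall>K. compact K \<longrightarrow> set_integrable lebesgue K f)"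

definition weight :: "('a::euclidean_space \<Rightarrow> real) \<Rightarrow> bool" where
  "weight w \<longleftrightarrow> (\<forall>x. 0 \<le> w x) \<and> loc_integrable w"

text \<open>
  The normalized Lebesgue measure on the unit sphere, obtained from polar coordinates: it is the
  image of the uniform distribution on the punctured unit ball under \<open>x \<mapsto> x / |x|\<close> (which is
  \<^const>\<open>sgn\<close>), completed so that Lebesgue measurable functions are admitted.
\<close>
definition sphere_measure :: "'a::euclidean_space measure" where
  "sphere_measure =
     completion (distr (uniform_measure (restrict_space lborel (ball 0 1 - {0})) (ball 0 1 - {0}))
                       (restrict_space borel (sphere 0 1)) sgn)"

definition Lp_sphere :: "ereal \<Rightarrow> ('a::euclidean_space \<Rightarrow> 'k::real_normed_field) set" where
  "Lp_sphere s = {\<Omega>. \<Omega> \<in> borel_measurable sphere_measure \<and>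
     (if s = \<infinity> then esssup sphere_measure (\<lambda>x. ereal (norm (\<Omega> x))) < \<infinity>
      else (\<integral>\<^sup>+x. ennreal (norm (\<Omega> x) powr real_of_ereal s) \<partial>sphere_measure) < \<infinity>)}"

definition homogeneous_degree_zero :: "('a::euclidean_space \<Rightarrow> 'k) \<Rightarrow> bool" where
  "homogeneous_degree_zero \<Omega> \<longleftrightarrow> (\<forall>l>0. \<forall>x. x \<noteq> 0 \<longrightarrow> \<Omega> (l *\<^sub>R x) = \<Omega> x)"

definition ball_average ::
  "('a::euclidean_space \<Rightarrow> 'k::{real_normed_field, banach, second_countable_topology}) \<Rightarrow> 'a set \<Rightarrow> 'k"
  where "ball_average b B = (LINT y:B|lebesgue. b y) /\<^sub>R measure lebesgue B"

definition BMO_norm ::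
  "('a::euclidean_space \<Rightarrow> 'k::{real_normed_field, banach, second_countable_topology}) \<Rightarrow> ennreal"
  where "BMO_norm b =
    (SUP B\<in>balls. (\<integral>\<^sup>+x\<in>B. ennreal (norm (b x - ball_average b B)) \<partial>lebesgue) / emeasure lebesgue B)"

definition BMO ::
  "('a::euclidean_space \<Rightarrow> 'k::{real_normed_field, banach, second_countable_topology}) set"
  where "BMO = {b. loc_integrable b \<and> BMO_norm b < \<infinity>}"

definition A_class :: "real \<Rightarrow> real \<Rightarrow> ('a::euclidean_space \<Rightarrow> real) set" where
  "A_class p q = {w. weight w \<and> (\<exists>C>0. \<forall>B\<in>balls.
     epowr ((\<integral>\<^sup>+x\<in>B. epowr (ennreal (w x)) q \<partial>lebesgue) / emeasure lebesgue B) (1 / q) *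
     epowr ((\<integral>\<^sup>+x\<in>B. epowr (ennreal (w x)) (- conj_exponent (ereal p)) \<partial>lebesgue)
              / emeasure lebesgue B) (1 / conj_exponent (ereal p))
     \<le> ennreal C)}"

definition weight_measure :: "('a::euclidean_space \<Rightarrow> real) \<Rightarrow> 'a set \<Rightarrow> ennreal" where
  "weight_measure v B = (\<integral>\<^sup>+x\<in>B. ennreal (v x) \<partial>lebesgue)"

text \<open>
  Since maximal functions take values in \<open>[0, \<infinity>]\<close>, the Morrey norms and spaces are first defined for
  such functions \<open>F\<close>, and then for scalar functions \<open>f\<close> through \<open>F = |f|\<close>.
\<close>
definition emorrey_norm ::
  "real \<Rightarrow> real \<Rightarrow> ('a::euclidean_space \<Rightarrow> real) \<Rightarrow> ('a \<Rightarrow> real) \<Rightarrow> ('a \<Rightarrow> ennreal) \<Rightarrow> ennreal" where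
  "emorrey_norm p \<kappa> u v F =
     (SUP B\<in>balls. epowr (1 / epowr (weight_measure v B) \<kappa> *
        (\<integral>\<^sup>+x\<in>B. epowr (F x) p * ennreal (u x) \<partial>lebesgue)) (1 / p))"

definition emorrey_space ::
  "real \<Rightarrow> real \<Rightarrow> ('a::euclidean_space \<Rightarrow> real) \<Rightarrow> ('a \<Rightarrow> real) \<Rightarrow> ('a \<Rightarrow> ennreal) set" where
  "emorrey_space p \<kappa> u v = {F. F \<in> borel_measurable lebesgue \<and>
     (\<forall>K. compact K \<longrightarrow> (\<integral>\<^sup>+x\<in>K. epowr (F x) p * ennreal (u x) \<partial>lebesgue) < \<infinity>) \<and>
     emorrey_norm p \<kappa> u v F < \<infinity>}"

definition morrey_norm ::
  "real \<Rightarrow> real \<Rightarrow> ('a::euclidean_space \<Rightarrow> real) \<Rightarrow> ('a \<Rightarrow> real) \<Rightarrow> ('a \<Rightarrow> 'k::real_normed_field) \<Rightarrow> ennreal"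
  where "morrey_norm p \<kappa> u v f = emorrey_norm p \<kappa> u v (\<lambda>x. ennreal (norm (f x)))"

definition morrey_space ::
  "real \<Rightarrow> real \<Rightarrow> ('a::euclidean_space \<Rightarrow> real) \<Rightarrow> ('a \<Rightarrow> real) \<Rightarrow> ('a \<Rightarrow> 'k::real_normed_field) set"
  where "morrey_space p \<kappa> u v =
    {f. f \<in> borel_measurable lebesgue \<and> (\<lambda>x. ennreal (norm (f x))) \<in> emorrey_space p \<kappa> u v}"

definition commutator_maximal ::
  "('a::euclidean_space \<Rightarrow> 'k::real_normed_field) \<Rightarrow> ('a \<Rightarrow> 'k) \<Rightarrow> real \<Rightarrow> ('a \<Rightarrow> 'k) \<Rightarrow> 'a \<Rightarrow> ennreal"
  where "commutator_maximal b \<Omega> \<alpha> f x =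
    (SUP r\<in>{0<..}. ennreal (1 / r powr (real DIM('a) - \<alpha>)) *
       (\<integral>\<^sup>+y\<in>cball x r. ennreal (norm (b x - b y) * norm (\<Omega> (x - y) * f y)) \<partial>lebesgue))"

end

theory Submission
  imports Defs "HOL-Computational_Algebra.Fundamental_Theorem_Algebra"
begin

text \<open>
  By Hoelder's inequality, the \<open>t\<close>-th power of the commutator, where \<open>t = s'\<close>, is at most a constant times
  the fractional maximal operator of order \<open>\<alpha> t\<close> with the factor \<open>\<bar>b(x) - b(y)\<bar>\<^sup>t\<close>, applied to \<open>\<bar>f\<bar>\<^sup>t\<close>. Since
  \<open>\<bar>z\<bar>\<^sup>t \<le> C (exp (\<gamma> z) + exp (- \<gamma> z))\<close>, the function \<open>b\<close> (split into real coordinates) can be removed by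
  conjugation: what remains are the operators \<open>exp (s b) M (exp (- s b) \<bar>f\<bar>\<^sup>t)\<close> for small real \<open>s\<close>, with \<open>M\<close> the
  fractional maximal function. For these the John--Nirenberg inequality, relative to the weight and
  to its dual weight, plays two roles. Near a ball it shows that \<open>exp (s b) w\<close> is again in the
  Muckenhoupt class, so that the weighted \<open>L\<^sup>p\<close>-\<open>L\<^sup>q\<close> bound for \<open>M\<close> applies. Far from the ball it makes the
  factors \<open>exp (s b)\<close> grow so slowly along dyadic dilates that the reverse doubling of \<open>w\<^sup>q\<close>, which enters through
  \<open>\<kappa> < p/q\<close>, absorbs them.
\<close>

section \<open>Powers on the extended half-line\<close>

text \<open>The absolute value stands inside the integral, so a pointwise exponential majorant of
  the difference carries over to the operator, and the power \<open>t\<close> costs only a constant.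
  The conjugated operators are controlled by a cancellation: on a ball, the perturbed weights carry
  exponentials of the constant subtracted from the function there, and in the Muckenhoupt product
  these exponentials have opposite signs. What remains are exponential moments of the oscillation
  against \<open>v\<close> and \<open>u\<close> themselves; this is why the stopping-time argument
  measures its exceptional sets with the weight from the start. All exponents are expressed through
  two numbers, \<open>e = 1 - \<alpha> t / n\<close> and \<open>a\<close> with
  \<open>a e = t / q\<close>. For \<open>Q = q / t\<close> and \<open>P = p / t\<close> this means
  \<open>1 / Q = a e\<close> and \<open>1 / P = a e + 1 - e\<close>, and the weight and its dual
  play symmetric roles. Two side issues shape the end: the scalar field is given abstractly, so its
  real coordinates have to be constructed, and the weight may vanish almost everywhere, where the
  convention \<open>0 * \<infinity> = 0\<close> decides.\<close>

lemma epowr_ennreal: "0 \<le> x \<Longrightarrow> 0 < a \<Longrightarrow> epowr (ennreal x) a = ennreal (x powr a)"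
  by (auto simp: epowr_def)

lemma epowr_top [simp]: "0 < a \<Longrightarrow> epowr top a = top"
  by (simp add: epowr_def)

lemma epowr_0 [simp]: "0 < a \<Longrightarrow> epowr 0 a = 0"
  by (simp add: epowr_def)

lemma epowr_eq_top_iff [simp]: "0 < a \<Longrightarrow> epowr x a = top \<longleftrightarrow> x = top"
  by (auto simp: epowr_def)

lemma epowr_less_top_iff [simp]: "0 < a \<Longrightarrow> epowr x a < top \<longleftrightarrow> x < top"
  by (auto simp: less_top[symmetric])

lemma epowr_eq_0_iff [simp]: "0 < a \<Longrightarrow> epowr x a = 0 \<longleftrightarrow> x = 0"
  by (cases x) (auto simp: epowr_def)

lemma epowr_1 [simp]: "epowr x 1 = x"
  by (cases x) (auto simp: epowr_def)

lemma epowr_mono: "x \<le> y \<Longrightarrow> 0 < a \<Longrightarrow> epowr x a \<le> epowr y a"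
  by (cases x; cases y) (auto simp: epowr_ennreal top_unique intro!: ennreal_leI powr_mono2)

lemma epowr_mult: "0 < a \<Longrightarrow> epowr (x * y) a = epowr x a * epowr y a"
proof (cases x; cases y)
  assume a: "0 < a"
  { fix r s assume "0 \<le> r" "x = ennreal r" "0 \<le> s" "y = ennreal s"
    then show ?thesis using a
      by (simp add: epowr_ennreal ennreal_mult[symmetric] powr_mult) }
  { fix s assume "x = top" "0 \<le> s" "y = ennreal s"
    then show ?thesis using a
      by (cases "s = 0") (auto simp: epowr_ennreal ennreal_mult_eq_top_iff ennreal_top_mult) }
  { fix s assume "y = top" "0 \<le> s" "x = ennreal s"
    then show ?thesis using a
      by (cases "s = 0") (auto simp: epowr_ennreal ennreal_mult_eq_top_iff ennreal_mult_top) }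
qed (simp_all add: ennreal_mult_eq_top_iff)

lemma epowr_epowr: "0 < a \<Longrightarrow> 0 < b \<Longrightarrow> epowr (epowr x a) b = epowr x (a * b)"
  by (cases x) (auto simp: epowr_ennreal powr_powr)

lemma epowr_add: "0 < a \<Longrightarrow> 0 < b \<Longrightarrow> epowr x (a + b) = epowr x a * epowr x b"
  by (cases x) (auto simp: epowr_ennreal powr_add ennreal_mult ennreal_mult_eq_top_iff)

lemma epowr_inverse_cancel: "0 < a \<Longrightarrow> epowr (epowr x a) (1 / a) = x"
  by (simp add: epowr_epowr)

lemma epowr_inverse_cancel': "0 < a \<Longrightarrow> epowr (epowr x (1 / a)) a = x"
  by (simp add: epowr_epowr)

lemma epowr_le_iff: "0 < a \<Longrightarrow> epowr x a \<le> epowr y a \<longleftrightarrow> x \<le> y"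
  using epowr_mono[of "epowr x a" "epowr y a" "1 / a"]
  by (auto simp: epowr_inverse_cancel intro: epowr_mono)

lemma epowr_le_swap: "0 < a \<Longrightarrow> epowr x a \<le> y \<longleftrightarrow> x \<le> epowr y (1 / a)"
  using epowr_le_iff[of a x "epowr y (1 / a)"] by (simp add: epowr_inverse_cancel')

lemma borel_measurable_epowr [measurable]:
  assumes [measurable]: "f \<in> borel_measurable M" shows "(\<lambda>x. epowr (f x) a) \<in> borel_measurable M"
  unfolding epowr_def by measurable

lemma epowr_sum_le:
  assumes p: "0 < p"
  shows "epowr (x + y) p \<le> ennreal (2 powr p) * (epowr x p + epowr y p)"
proof -
  have "x + y \<le> 2 * max x y" by (simp add: mult_2 add_mono)
  then have "epowr (x + y) p \<le> epowr (2 * max x y) p" using p by (rule epowr_mono)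
  also have "\<dots> = ennreal (2 powr p) * epowr (max x y) p"
    using epowr_ennreal[of 2 p] p by (simp add: epowr_mult)
  also have "\<dots> \<le> ennreal (2 powr p) * (epowr x p + epowr y p)"
    by (intro mult_left_mono) (auto simp: max_def)
  finally show ?thesis .
qed

section \<open>Young and Hoelder inequalities, the layer cake formula and real interpolation\<close>

lemma young_real:
  fixes x y a :: real
  assumes "0 \<le> x" "0 \<le> y" "0 < a" "a < 1"
  shows "x powr a * y powr (1 - a) \<le> a * x + (1 - a) * y"
proof (cases "x = 0 \<or> y = 0")
  case True then show ?thesis using assms by auto
next
  case False
  then have pos: "0 < x" "0 < y" using assms by auto
  have "exp (a * ln x + (1 - a) * ln y) \<le> a * exp (ln x) + (1 - a) * exp (ln y)"
    using convex_onD[OF exp_convex, of "1 - a" "ln x" "ln y"] assms by simp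
  then show ?thesis using pos by (simp add: powr_def exp_add)
qed

lemma young_ennreal:
  assumes "0 < a" "a < 1"
  shows "epowr x a * epowr y (1 - a) \<le> ennreal a * x + ennreal (1 - a) * y"
proof (cases x; cases y)
  fix r s assume "0 \<le> r" "x = ennreal r" "0 \<le> s" "y = ennreal s"
  then show ?thesis using assms young_real[of r s a]
    by (simp add: epowr_ennreal ennreal_mult[symmetric] ennreal_plus[symmetric] ennreal_leI del: ennreal_plus)
qed (use assms in \<open>auto simp: ennreal_mult_top\<close>)

text \<open>Exponents \<open>1 / a\<close> and \<open>1 / (1 - a)\<close>, with the powers moved
  onto the integrand. If one integral is 0 and the other infinite, the integrand vanishes almost
  everywhere, in agreement with \<open>0 * \<infinity> = 0\<close>; the main case is Young's
  inequality after normalising both integrals to 1.\<close>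

lemma Hoelder_nn_integral:
  assumes a: "0 < a" "a < 1"
    and [measurable]: "f \<in> borel_measurable M" "g \<in> borel_measurable M"
  shows "(\<integral>\<^sup>+x. epowr (f x) a * epowr (g x) (1 - a) \<partial>M)
    \<le> epowr (\<integral>\<^sup>+x. f x \<partial>M) a * epowr (\<integral>\<^sup>+x. g x \<partial>M) (1 - a)"
proof -
  let ?F = "\<integral>\<^sup>+x. f x \<partial>M" and ?G = "\<integral>\<^sup>+x. g x \<partial>M"
  consider "?F = 0 \<or> ?G = 0" | "?F \<noteq> 0" "?G \<noteq> 0" "?F = top \<or> ?G = top"
    | "?F \<noteq> 0" "?G \<noteq> 0" "?F \<noteq> top" "?G \<noteq> top" by blast
  then show ?thesis
  proof cases
    case 1
    then have "AE x in M. f x = 0 \<or> g x = 0"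
      by (auto simp: nn_integral_0_iff_AE)
    then have "AE x in M. epowr (f x) a * epowr (g x) (1 - a) = 0"
      by (rule AE_mp) (use a in auto)
    then have "(\<integral>\<^sup>+x. epowr (f x) a * epowr (g x) (1 - a) \<partial>M) = 0"
      by (subst nn_integral_0_iff_AE) auto
    then show ?thesis by simp
  next
    case 2 then show ?thesis using a by (auto simp: ennreal_mult_eq_top_iff)
  next
    case 3
    define F G where "F = enn2real ?F" and "G = enn2real ?G"
    have FG: "?F = ennreal F" "?G = ennreal G" "0 < F" "0 < G"
      using 3 by (auto simp: F_def G_def less_top enn2real_positive_iff zero_less_iff_neq_zero)
    let ?H = "\<lambda>x. epowr (ennreal (1/F) * f x) a * epowr (ennreal (1/G) * g x) (1 - a)"
    have "(\<integral>\<^sup>+x. ?H x \<partial>M) \<le> (\<integral>\<^sup>+x. ennreal a * (ennreal (1/F) * f x) + ennreal (1-a) * (ennreal (1/G) * g x) \<partial>M)"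
      by (intro nn_integral_mono young_ennreal a)
    also have "\<dots> = ennreal a * (ennreal (1/F) * ?F) + ennreal (1-a) * (ennreal (1/G) * ?G)"
      by (simp add: nn_integral_add nn_integral_cmult)
    also have "\<dots> = 1"
      using FG a by (simp add: ennreal_mult[symmetric] ennreal_plus[symmetric] del: ennreal_plus)
    finally have H: "(\<integral>\<^sup>+x. ?H x \<partial>M) \<le> 1" .
    have eq: "epowr (f x) a * epowr (g x) (1 - a) = ennreal (F powr a * G powr (1 - a)) * ?H x" for x
    proof -
      have *: "ennreal (c powr b) * epowr (ennreal (1/c) * z) b = epowr z b" if "0 < c" "0 < b" for c b z
      proof -
        have "ennreal (c powr b) * epowr (ennreal (1/c) * z) b = epowr (ennreal c * (ennreal (1/c) * z)) b"
          using that by (simp add: epowr_mult epowr_ennreal)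
        also have "ennreal c * (ennreal (1/c) * z) = z"
          using that by (simp add: mult.assoc[symmetric] ennreal_mult[symmetric])
        finally show ?thesis .
      qed
      show ?thesis
        using *[of F a "f x"] *[of G "1-a" "g x"] FG a
        by (simp add: ennreal_mult mult_ac) (metis mult.assoc mult.commute)
    qed
    have "(\<integral>\<^sup>+x. epowr (f x) a * epowr (g x) (1 - a) \<partial>M) = ennreal (F powr a * G powr (1 - a)) * (\<integral>\<^sup>+x. ?H x \<partial>M)"
      unfolding eq by (rule nn_integral_cmult) measurable
    also have "\<dots> \<le> ennreal (F powr a * G powr (1 - a)) * 1"
      by (intro mult_left_mono H) simp
    also have "\<dots> = epowr ?F a * epowr ?G (1 - a)"
      using FG a by (simp add: epowr_ennreal ennreal_mult)
    finally show ?thesis .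
  qed
qed

lemma nn_integral_powr_interval:
  assumes "0 < a" "0 \<le> c"
  shows "(\<integral>\<^sup>+t. ennreal (t powr (a - 1)) * indicator {0<..<c} t \<partial>lborel) = ennreal (c powr a / a)"
proof -
  have "((\<lambda>t. t powr (a - 1)) has_integral (c powr (a - 1 + 1) / (a - 1 + 1))) {0..c}"
    using has_integral_powr_from_0[of "a - 1" c] assms by simp
  then have "((\<lambda>t. if t \<in> {0..c} then t powr (a - 1) else 0) has_integral (c powr a / a)) UNIV"
    by (subst has_integral_restrict_UNIV) simp
  then have "(\<integral>\<^sup>+t. ennreal (if t \<in> {0..c} then t powr (a - 1) else 0) \<partial>lborel) = ennreal (c powr a / a)"
    by (intro nn_integral_has_integral_lborel) (auto simp: assms)
  moreover have "(\<integral>\<^sup>+t. ennreal (t powr (a - 1)) * indicator {0<..<c} t \<partial>lborel)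
     = (\<integral>\<^sup>+t. ennreal (if t \<in> {0..c} then t powr (a - 1) else 0) \<partial>lborel)"
  proof (rule nn_integral_cong_AE)
    show "AE t in lborel. ennreal (t powr (a - 1)) * indicator {0<..<c} t = ennreal (if t \<in> {0..c} then t powr (a - 1) else 0)"
      using AE_lborel_singleton[of 0] AE_lborel_singleton[of c]
      by eventually_elim (auto simp: indicator_def)
  qed
  ultimately show ?thesis by simp
qed

lemma layer_cake:
  assumes a: "0 < a"
  shows "(\<integral>\<^sup>+t. ennreal (t powr (a - 1)) * indicator {t. 0 < t \<and> ennreal t < x} t \<partial>lborel) = epowr x a / ennreal a"
proof (cases x)
  case (real r)
  have "{t. 0 < t \<and> ennreal t < x} = {0<..<r}"
    using real by (auto simp: ennreal_less_iff)
  then show ?thesis using nn_integral_powr_interval[of a r] a real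
    by (simp add: epowr_ennreal divide_ennreal)
next
  case top
  have "(\<integral>\<^sup>+t. ennreal (t powr (a - 1)) * indicator {t. 0 < t \<and> ennreal t < x} t \<partial>lborel) \<ge> ennreal (real n / a)" for n
  proof -
    \<comment> \<open>The upper end \<open>real n powr (1/a)\<close> is the one at which the
      truncated integral equals \<open>n / a\<close>.\<close>
    have "ennreal (real n / a) \<le> (\<integral>\<^sup>+t. ennreal (t powr (a - 1)) * indicator {0<..<real n powr (1/a)} t \<partial>lborel)"
      using nn_integral_powr_interval[of a "real n powr (1/a)"] a by (cases "n = 0") (auto simp: powr_powr)
    also have "\<dots> \<le> (\<integral>\<^sup>+t. ennreal (t powr (a - 1)) * indicator {t. 0 < t \<and> ennreal t < x} t \<partial>lborel)"
      by (rule nn_integral_mono) (auto simp: indicator_def top)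
    finally show ?thesis .
  qed
  then have "(\<integral>\<^sup>+t. ennreal (t powr (a - 1)) * indicator {t. 0 < t \<and> ennreal t < x} t \<partial>lborel) = top" (is "?I = _")
  proof -
    assume *: "\<And>n. ennreal (real n / a) \<le> ?I"
    show "?I = top"
    proof (rule ccontr)
      assume "?I \<noteq> top"
      then obtain r where r: "?I = ennreal r" "0 \<le> r" by (cases ?I) auto
      obtain n where "r * a < real n" using reals_Archimedean2 by blast
      then have "r < real n / a" using a by (simp add: field_simps)
      with *[of n] r a show False by (simp add: ennreal_le_iff)
    qed
  qed
  then show ?thesis using top a by (simp add: ennreal_top_divide)
qed

text \<open>The hypothesis is the weak \<open>(1,1)\<close> bound for the part of \<open>h\<close> above half the level.\<close>

lemma marcinkiewicz:
  assumes M: "sigma_finite_measure M" and q: "1 < q" and C: "0 \<le> C"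
    and [measurable]: "F \<in> borel_measurable M" "h \<in> borel_measurable M"
    and weak: "\<And>t. 0 < t \<Longrightarrow> ennreal t * emeasure M {x \<in> space M. ennreal t < F x}
       \<le> ennreal C * (\<integral>\<^sup>+x. h x * indicator {x. ennreal t < 2 * h x} x \<partial>M)"
  shows "(\<integral>\<^sup>+x. epowr (F x) q \<partial>M) \<le> ennreal (q * C * 2 powr (q - 1) / (q - 1)) * (\<integral>\<^sup>+x. epowr (h x) q \<partial>M)"
proof -
  interpret sigma_finite_measure M by fact
  interpret P: pair_sigma_finite M lborel ..
  have [measurable]: "{p \<in> space (M \<Otimes>\<^sub>M lborel). 0 < snd p \<and> ennreal (snd p) < F (fst p)} \<in> sets (M \<Otimes>\<^sub>M lborel)"
    by measurable
  have q0: "0 < q" using q by simp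
  have 1: "epowr (F x) q = ennreal q * (\<integral>\<^sup>+t. ennreal (t powr (q - 1)) * (if 0 < t \<and> ennreal t < F x then 1 else 0) \<partial>lborel)" for x
  proof -
    have "(\<integral>\<^sup>+t. ennreal (t powr (q - 1)) * (if 0 < t \<and> ennreal t < F x then 1 else 0) \<partial>lborel) = epowr (F x) q / ennreal q"
      unfolding layer_cake[OF q0, symmetric] by (intro nn_integral_cong) (auto simp: indicator_def)
    then show ?thesis using q by (simp add: ennreal_mult_divide_eq mult.commute[of "ennreal q"] ennreal_divide_times)
  qed
  have 2: "(\<integral>\<^sup>+t. ennreal (t powr (q - 2)) * (if 0 < t \<and> ennreal t < 2 * h x then 1 else 0) \<partial>lborel)
    = epowr (2 * h x) (q - 1) / ennreal (q - 1)" for x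
    unfolding layer_cake[of "q - 1" "2 * h x", symmetric, simplified, OF q] 
    by (intro nn_integral_cong) (auto simp: indicator_def)
  have "(\<integral>\<^sup>+x. epowr (F x) q \<partial>M)
     = ennreal q * (\<integral>\<^sup>+x. \<integral>\<^sup>+t. ennreal (t powr (q - 1)) * (if 0 < t \<and> ennreal t < F x then 1 else 0) \<partial>lborel \<partial>M)"
    unfolding 1 by (rule nn_integral_cmult) measurable
  also have "(\<integral>\<^sup>+x. \<integral>\<^sup>+t. ennreal (t powr (q - 1)) * (if 0 < t \<and> ennreal t < F x then 1 else 0) \<partial>lborel \<partial>M)
     = (\<integral>\<^sup>+t. \<integral>\<^sup>+x. ennreal (t powr (q - 1)) * (if 0 < t \<and> ennreal t < F x then 1 else 0) \<partial>M \<partial>lborel)"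
    by (rule P.Fubini'[symmetric]) measurable
  also have "\<dots> \<le> (\<integral>\<^sup>+t. \<integral>\<^sup>+x. ennreal C * (h x * (ennreal (t powr (q - 2)) * (if 0 < t \<and> ennreal t < 2 * h x then 1 else 0))) \<partial>M \<partial>lborel)"
  proof (rule nn_integral_mono)
    fix t :: real
    show "(\<integral>\<^sup>+x. ennreal (t powr (q - 1)) * (if 0 < t \<and> ennreal t < F x then 1 else 0) \<partial>M)
      \<le> (\<integral>\<^sup>+x. ennreal C * (h x * (ennreal (t powr (q - 2)) * (if 0 < t \<and> ennreal t < 2 * h x then 1 else 0))) \<partial>M)"
    proof (cases "0 < t")
      case True
      have "(\<integral>\<^sup>+x. ennreal (t powr (q - 1)) * (if 0 < t \<and> ennreal t < F x then 1 else 0) \<partial>M)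
        = (\<integral>\<^sup>+x. ennreal (t powr (q - 1)) * indicator {x \<in> space M. ennreal t < F x} x \<partial>M)"
        by (intro nn_integral_cong) (auto simp: True)
      also have "\<dots> = ennreal (t powr (q - 1)) * emeasure M {x \<in> space M. ennreal t < F x}"
        by (rule nn_integral_cmult_indicator) measurable
      \<comment> \<open>One power of \<open>t\<close> is split off to be spent on the weak-type
        hypothesis.\<close>
      also have "\<dots> = ennreal (t powr (q - 2)) * ennreal t * emeasure M {x \<in> space M. ennreal t < F x}"
        using True powr_add[of t "q-2" 1] by (simp add: ennreal_mult[symmetric])
      also have "\<dots> \<le> ennreal (t powr (q - 2)) * (ennreal C * (\<integral>\<^sup>+x. h x * indicator {x. ennreal t < 2 * h x} x \<partial>M))"
        unfolding mult.assoc by (intro mult_left_mono weak True) simp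
      also have "\<dots> = (\<integral>\<^sup>+x. ennreal C * (h x * (ennreal (t powr (q - 2)) * (if 0 < t \<and> ennreal t < 2 * h x then 1 else 0))) \<partial>M)"
      proof -
        have "(\<integral>\<^sup>+x. ennreal C * (h x * (ennreal (t powr (q - 2)) * (if 0 < t \<and> ennreal t < 2 * h x then 1 else 0))) \<partial>M)
          = (\<integral>\<^sup>+x. (ennreal (t powr (q - 2)) * ennreal C) * (h x * indicator {x. ennreal t < 2 * h x} x) \<partial>M)"
          by (intro nn_integral_cong) (auto simp: True mult_ac)
        also have "\<dots> = (ennreal (t powr (q - 2)) * ennreal C) * (\<integral>\<^sup>+x. (h x * indicator {x. ennreal t < 2 * h x} x) \<partial>M)"
          by (rule nn_integral_cmult) measurable
        finally show ?thesis by (simp add: mult.assoc)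
      qed
      finally show ?thesis .
    qed simp
  qed
  also have "\<dots> = (\<integral>\<^sup>+x. \<integral>\<^sup>+t. ennreal C * (h x * (ennreal (t powr (q - 2)) * (if 0 < t \<and> ennreal t < 2 * h x then 1 else 0))) \<partial>lborel \<partial>M)"
    by (rule P.Fubini') measurable
  also have "\<dots> = (\<integral>\<^sup>+x. ennreal C * (h x * (epowr (2 * h x) (q - 1) / ennreal (q - 1))) \<partial>M)"
  proof (rule nn_integral_cong)
    fix x
    let ?G = "\<lambda>t. ennreal (t powr (q - 2)) * (if 0 < t \<and> ennreal t < 2 * h x then 1 else 0)"
    have "(\<integral>\<^sup>+t. ennreal C * (h x * ?G t) \<partial>lborel) = ennreal C * (\<integral>\<^sup>+t. h x * ?G t \<partial>lborel)"
      by (rule nn_integral_cmult) measurable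
    also have "(\<integral>\<^sup>+t. h x * ?G t \<partial>lborel) = h x * (\<integral>\<^sup>+t. ?G t \<partial>lborel)"
      by (rule nn_integral_cmult) measurable
    finally show "(\<integral>\<^sup>+t. ennreal C * (h x * ?G t) \<partial>lborel) = ennreal C * (h x * (epowr (2 * h x) (q - 1) / ennreal (q - 1)))"
      unfolding 2 .
  qed
  also have "\<dots> = (\<integral>\<^sup>+x. ennreal (C * 2 powr (q - 1) / (q - 1)) * epowr (h x) q \<partial>M)"
  proof (rule nn_integral_cong)
    fix x
    have "ennreal C * (h x * (epowr (2 * h x) (q - 1) / ennreal (q - 1)))
      = ennreal C * inverse (ennreal (q - 1)) * epowr 2 (q - 1) * (epowr (h x) 1 * epowr (h x) (q - 1))"
      using q by (simp add: epowr_mult divide_ennreal_def mult_ac)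
    also have "epowr (h x) 1 * epowr (h x) (q - 1) = epowr (h x) q"
      using q epowr_add[of 1 "q - 1" "h x"] by (simp del: epowr_1)
    also have "ennreal C * inverse (ennreal (q - 1)) * epowr 2 (q - 1) = ennreal (C * 2 powr (q - 1) / (q - 1))"
      using q C epowr_ennreal[of 2 "q - 1"]
      by (simp add: inverse_ennreal ennreal_mult[symmetric] divide_inverse mult_ac)
    finally show "ennreal C * (h x * (epowr (2 * h x) (q - 1) / ennreal (q - 1))) = ennreal (C * 2 powr (q - 1) / (q - 1)) * epowr (h x) q" .
  qed
  also have "\<dots> = ennreal (C * 2 powr (q - 1) / (q - 1)) * (\<integral>\<^sup>+x. epowr (h x) q \<partial>M)"
    by (rule nn_integral_cmult) measurable
  finally have "(\<integral>\<^sup>+x. epowr (F x) q \<partial>M)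
    \<le> ennreal q * (ennreal (C * 2 powr (q - 1) / (q - 1)) * (\<integral>\<^sup>+x. epowr (h x) q \<partial>M))"
    by (simp add: mult_left_mono)
  also have "\<dots> = ennreal (q * C * 2 powr (q - 1) / (q - 1)) * (\<integral>\<^sup>+x. epowr (h x) q \<partial>M)"
    using q C by (simp add: mult.assoc[symmetric] ennreal_mult[symmetric])
  finally show ?thesis .
qed

section \<open>The maximal function of a doubling measure\<close>

text \<open>The dilation factor 5 is that of the Vitali covering lemma, so that a covering costs
  exactly one factor \<open>D\<close>.\<close>

locale doubling_measure =
  fixes \<mu> :: "'a::euclidean_space measure" and D :: real
  assumes sets_eq [simp, measurable_cong]: "sets \<mu> = sets borel"
    and D_nonneg: "0 \<le> D"
    and ball_pos: "\<And>c r. 0 < r \<Longrightarrow> 0 < emeasure \<mu> (ball c r)"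
    and ball_finite: "\<And>c r. emeasure \<mu> (ball c r) < top"
    and ball_doubling: "\<And>c r. 0 < r \<Longrightarrow> emeasure \<mu> (ball c (5 * r)) \<le> ennreal D * emeasure \<mu> (ball c r)"

text \<open>The uncentred version: the balls only have to contain \<open>x\<close>. Its level sets
  are unions of open balls, which makes it Borel measurable for every \<open>h\<close>, and it
  dominates averages over a ball at all points of the ball at once.\<close>

definition maximal :: "'a::euclidean_space measure \<Rightarrow> ('a \<Rightarrow> ennreal) \<Rightarrow> 'a \<Rightarrow> ennreal" where
  "maximal \<mu> h x = (SUP (c, r)\<in>{(c, r). x \<in> ball c r}. (\<integral>\<^sup>+y\<in>ball c r. h y \<partial>\<mu>) / emeasure \<mu> (ball c r))"

lemma maximal_upper:
  "x \<in> ball c r \<Longrightarrow> (\<integral>\<^sup>+y\<in>ball c r. h y \<partial>\<mu>) / emeasure \<mu> (ball c r) \<le> maximal \<mu> h x"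
  unfolding maximal_def by (rule SUP_upper2[of "(c, r)"]) simp_all

lemma ennreal_less_divide_iff:
  fixes x y z :: ennreal
  assumes "0 < z" "z < top"
  shows "x < y / z \<longleftrightarrow> x * z < y"
proof -
  obtain c where c: "z = ennreal c" "0 < c" using assms by (cases z) auto
  show ?thesis
  proof (cases x)
    case (real r)
    show ?thesis
    proof (cases y)
      case (real s)
      then show ?thesis using c \<open>x = ennreal r\<close> \<open>0 \<le> r\<close>
        by (simp add: divide_ennreal ennreal_mult[symmetric] ennreal_less_iff field_simps)
    next
      case top
      then show ?thesis using c \<open>x = ennreal r\<close> \<open>0 \<le> r\<close>
        by (simp add: ennreal_top_divide ennreal_mult[symmetric])
    qed
  next
    case top
    then show ?thesis using c by (simp add: ennreal_top_mult)
  qed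
qed

text \<open>Countable subadditivity, with the sum written as an integral over a counting measure so
  that the index set, finite or infinite, need not be enumerated.\<close>

lemma emeasure_UN_le:
  assumes C: "countable C" and A: "\<And>i. i \<in> C \<Longrightarrow> A i \<in> sets M"
  shows "emeasure M (\<Union>i\<in>C. A i) \<le> (\<integral>\<^sup>+i. emeasure M (A i) \<partial>count_space C)"
proof -
  have "emeasure M (\<Union>i\<in>C. A i) = (\<integral>\<^sup>+x. indicator (\<Union>i\<in>C. A i) x \<partial>M)"
    using assms by (intro nn_integral_indicator[symmetric] sets.countable_UN') auto
  also have "\<dots> \<le> (\<integral>\<^sup>+x. \<integral>\<^sup>+i. indicator (A i) x \<partial>count_space C \<partial>M)"
  proof (rule nn_integral_mono)
    fix x
    show "indicator (\<Union>i\<in>C. A i) x \<le> (\<integral>\<^sup>+i. indicator (A i) x \<partial>count_space C)"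
    proof (cases "x \<in> (\<Union>i\<in>C. A i)")
      case True
      then obtain j where j: "j \<in> C" "x \<in> A j" by auto
      then show ?thesis
        using nn_integral_ge_point[of j C "\<lambda>i. indicator (A i) x"] by (auto simp: indicator_def)
    qed simp
  qed
  also have "\<dots> = (\<integral>\<^sup>+i. \<integral>\<^sup>+x. indicator (A i) x \<partial>M \<partial>count_space C)"
    using assms by (intro nn_integral_count_space_nn_integral) auto
  also have "\<dots> = (\<integral>\<^sup>+i. emeasure M (A i) \<partial>count_space C)"
    using A by (intro nn_integral_cong) simp
  finally show ?thesis .
qed

context doubling_measure
begin

lemma space_eq [simp]: "space \<mu> = UNIV"
  using sets_eq_imp_space_eq[OF sets_eq] by simp

lemma sigma_finite: "sigma_finite_measure \<mu>"
proof
  have "(\<Union>n::nat. ball 0 (real n)) = (UNIV :: 'a set)"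
    by (auto simp: dist_norm) (metis reals_Archimedean2)
  then show "\<exists>A. countable A \<and> A \<subseteq> sets \<mu> \<and> \<Union> A = space \<mu> \<and> (\<forall>a\<in>A. emeasure \<mu> a \<noteq> \<infinity>)"
    using ball_finite by (intro exI[of _ "range (\<lambda>n::nat. ball 0 (real n))"]) (auto simp: less_top)
qed

text \<open>Serves twice: it shows that level sets are open, and it presents them in the form to
  which a covering argument applies.\<close>

lemma maximal_level:
  "{x. t < maximal \<mu> h x} = (\<Union>(c, r)\<in>{(c, r). 0 < r \<and> t * emeasure \<mu> (ball c r) < (\<integral>\<^sup>+y\<in>ball c r. h y \<partial>\<mu>)}. ball c r)"
proof -
  have *: "t < (\<integral>\<^sup>+y\<in>ball c r. h y \<partial>\<mu>) / emeasure \<mu> (ball c r) \<longleftrightarrow>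
      t * emeasure \<mu> (ball c r) < (\<integral>\<^sup>+y\<in>ball c r. h y \<partial>\<mu>)" if "0 < r" for c r
    using ball_pos[OF that] ball_finite by (rule ennreal_less_divide_iff)
  have "t < maximal \<mu> h x \<longleftrightarrow> (\<exists>c r. 0 < r \<and> t * emeasure \<mu> (ball c r) < (\<integral>\<^sup>+y\<in>ball c r. h y \<partial>\<mu>) \<and> x \<in> ball c r)" for x
  proof
    assume "t < maximal \<mu> h x"
    then obtain c r where cr: "x \<in> ball c r" "t < (\<integral>\<^sup>+y\<in>ball c r. h y \<partial>\<mu>) / emeasure \<mu> (ball c r)"
      unfolding maximal_def less_SUP_iff by (metis (mono_tags, lifting) case_prodE mem_Collect_eq split_conv)
    have "0 < r" using cr(1) by (simp add: le_less_trans[OF zero_le_dist])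
    with * cr show "\<exists>c r. 0 < r \<and> t * emeasure \<mu> (ball c r) < (\<integral>\<^sup>+y\<in>ball c r. h y \<partial>\<mu>) \<and> x \<in> ball c r"
      by blast
  next
    assume "\<exists>c r. 0 < r \<and> t * emeasure \<mu> (ball c r) < (\<integral>\<^sup>+y\<in>ball c r. h y \<partial>\<mu>) \<and> x \<in> ball c r"
    then obtain c r where "0 < r" "t * emeasure \<mu> (ball c r) < (\<integral>\<^sup>+y\<in>ball c r. h y \<partial>\<mu>)" "x \<in> ball c r" by blast
    with * have "t < (\<integral>\<^sup>+y\<in>ball c r. h y \<partial>\<mu>) / emeasure \<mu> (ball c r)" by blast
    also have "\<dots> \<le> maximal \<mu> h x" by (rule maximal_upper) fact
    finally show "t < maximal \<mu> h x" .
  qed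
  then show ?thesis by blast
qed

lemma maximal_measurable [measurable]: "maximal \<mu> h \<in> borel_measurable borel"
proof (rule borel_measurableI_greater)
  fix t
  have "open {x. t < maximal \<mu> h x}" unfolding maximal_level by auto
  then show "{x \<in> space borel. t < maximal \<mu> h x} \<in> sets borel" by simp
qed

lemma maximal_weak:
  assumes [measurable]: "h \<in> borel_measurable borel"
  shows "t * emeasure \<mu> {x. t < maximal \<mu> h x} \<le> ennreal D * (\<integral>\<^sup>+x. h x \<partial>\<mu>)"
proof -
  \<comment> \<open>The Vitali lemma requires bounded radii, so the level set is exhausted by the
    sets \<open>U N\<close> with radii at most \<open>N\<close>; the bound is uniform in
    \<open>N\<close> and passes to the limit.\<close>
  define K where "K N = {(c, r). 0 < r \<and> r \<le> real N \<and> t * emeasure \<mu> (ball c r) < (\<integral>\<^sup>+y\<in>ball c r. h y \<partial>\<mu>)}" for N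
  define U where "U N = (\<Union>(c, r)\<in>K N. ball c r)" for N
  have open_U: "open (U N)" for N unfolding U_def by auto
  then have U_sets: "U N \<in> sets \<mu>" for N by simp
  have inc: "incseq U"
  proof (rule incseq_SucI)
    fix N
    have "K N \<subseteq> K (Suc N)" unfolding K_def by auto
    then show "U N \<subseteq> U (Suc N)" unfolding U_def by blast
  qed
  have UN: "{x. t < maximal \<mu> h x} = (\<Union>N. U N)"
  proof -
    have "{(c, r). 0 < r \<and> t * emeasure \<mu> (ball c r) < (\<integral>\<^sup>+y\<in>ball c r. h y \<partial>\<mu>)} = (\<Union>N. K N)"
      unfolding K_def using real_arch_simple by auto
    then show ?thesis unfolding maximal_level U_def by (simp only: UN_UN_flatten)
  qed
  have bound: "t * emeasure \<mu> (U N) \<le> ennreal D * (\<integral>\<^sup>+x. h x \<partial>\<mu>)" for N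
  proof -
    obtain C where C: "countable C" "C \<subseteq> K N"
      and dj: "pairwise (\<lambda>i j. disjnt (ball (fst i) (snd i)) (ball (fst j) (snd j))) C"
      and cover: "U N \<subseteq> (\<Union>j\<in>C. ball (fst j) (5 * snd j))"
    proof (rule Vitali_covering_lemma_balls[of "U N" fst snd "K N" "real N"])
      show "U N \<subseteq> (\<Union>i\<in>K N. ball (fst i) (snd i))" unfolding U_def by (simp add: case_prod_beta)
      show "0 < snd i \<and> snd i \<le> real N" if "i \<in> K N" for i using that by (auto simp: K_def)
    qed
    have dj': "disjoint_family_on (\<lambda>i. ball (fst i) (snd i)) C"
      using dj by (auto simp: disjoint_family_on_def pairwise_def disjnt_def)
    from cover have "emeasure \<mu> (U N) \<le> emeasure \<mu> (\<Union>j\<in>C. ball (fst j) (5 * snd j))"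
      using C by (intro emeasure_mono sets.countable_UN') auto
    also have "\<dots> \<le> (\<integral>\<^sup>+j. emeasure \<mu> (ball (fst j) (5 * snd j)) \<partial>count_space C)"
      using C by (intro emeasure_UN_le) auto
    also have "\<dots> \<le> (\<integral>\<^sup>+j. ennreal D * emeasure \<mu> (ball (fst j) (snd j)) \<partial>count_space C)"
      using C by (intro nn_integral_mono ball_doubling) (auto simp: K_def)
    finally have "t * emeasure \<mu> (U N) \<le> t * (\<integral>\<^sup>+j. ennreal D * emeasure \<mu> (ball (fst j) (snd j)) \<partial>count_space C)"
      by (rule mult_left_mono) simp
    also have "\<dots> = ennreal D * (\<integral>\<^sup>+j. t * emeasure \<mu> (ball (fst j) (snd j)) \<partial>count_space C)"
      by (simp add: nn_integral_cmult mult_ac)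
    also have "(\<integral>\<^sup>+j. t * emeasure \<mu> (ball (fst j) (snd j)) \<partial>count_space C)
       \<le> (\<integral>\<^sup>+j. (\<integral>\<^sup>+y\<in>ball (fst j) (snd j). h y \<partial>\<mu>) \<partial>count_space C)"
      using C by (intro nn_integral_mono) (auto simp: K_def)
    also have "\<dots> = (\<integral>\<^sup>+j. emeasure (density \<mu> h) (ball (fst j) (snd j)) \<partial>count_space C)"
      by (intro nn_integral_cong) (simp add: emeasure_density)
    also have "\<dots> = emeasure (density \<mu> h) (\<Union>j\<in>C. ball (fst j) (snd j))"
      using C dj' by (intro emeasure_UN_countable[symmetric]) auto
    also have "\<dots> \<le> emeasure (density \<mu> h) (space (density \<mu> h))"
      by (rule emeasure_space)
    also have "\<dots> = (\<integral>\<^sup>+x. h x \<partial>\<mu>)"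
      by (simp add: emeasure_density)
    finally show ?thesis by (simp add: mult_left_mono)
  qed
  have "emeasure \<mu> {x. t < maximal \<mu> h x} = (SUP N. emeasure \<mu> (U N))"
    unfolding UN using U_sets inc by (intro SUP_emeasure_incseq[symmetric]) auto
  then have "t * emeasure \<mu> {x. t < maximal \<mu> h x} = (SUP N. t * emeasure \<mu> (U N))"
    by (simp add: SUP_mult_left_ennreal)
  also have "\<dots> \<le> ennreal D * (\<integral>\<^sup>+x. h x \<partial>\<mu>)" by (rule SUP_least) (rule bound)
  finally show ?thesis .
qed

lemma maximal_strong:
  assumes q: "1 < q" and h [measurable]: "h \<in> borel_measurable borel"
  shows "(\<integral>\<^sup>+x. epowr (maximal \<mu> h x) q \<partial>\<mu>)
    \<le> ennreal (q * (2 * D) * 2 powr (q - 1) / (q - 1)) * (\<integral>\<^sup>+x. epowr (h x) q \<partial>\<mu>)"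
proof (rule marcinkiewicz)
  fix t :: real assume t: "0 < t"
  \<comment> \<open>The part of \<open>h\<close> above half the level; what is left out is at most
    \<open>t / 2\<close>.\<close>
  define h1 where "h1 x = h x * indicator {x. ennreal t < 2 * h x} x" for x
  have [measurable]: "h1 \<in> borel_measurable borel" unfolding h1_def by measurable
  have t2: "ennreal t = 2 * ennreal (t / 2)"
    using t ennreal_mult[of 2 "t / 2"] by simp
  have h_le: "h x \<le> ennreal (t / 2) + h1 x" for x
  proof (cases "ennreal t < 2 * h x")
    case False
    then have "2 * h x \<le> 2 * ennreal (t / 2)" by (simp add: not_less t2[symmetric])
    then have "h x \<le> ennreal (t / 2)" by (subst (asm) ennreal_mult_le_mult_iff) auto
    then show ?thesis by (simp add: add_increasing2)
  qed (simp add: h1_def)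
  \<comment> \<open>The part left out adds at most \<open>t / 2\<close> to any average, so an
    average above \<open>t\<close> leaves more than \<open>t / 2\<close> for
    \<open>h1\<close>.\<close>
  have "{x. ennreal t < maximal \<mu> h x} \<subseteq> {x. ennreal (t / 2) < maximal \<mu> h1 x}"
    unfolding maximal_level
  proof (rule UN_mono, safe)
    fix c r assume r: "0 < r" and less: "ennreal t * emeasure \<mu> (ball c r) < (\<integral>\<^sup>+y\<in>ball c r. h y \<partial>\<mu>)"
    obtain m where m: "emeasure \<mu> (ball c r) = ennreal m" "0 \<le> m"
      using ball_finite[of c r] by (cases "emeasure \<mu> (ball c r)") auto
    note less
    also have "(\<integral>\<^sup>+y\<in>ball c r. h y \<partial>\<mu>) \<le> (\<integral>\<^sup>+y. ennreal (t / 2) * indicator (ball c r) y + h1 y * indicator (ball c r) y \<partial>\<mu>)"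
      by (intro nn_integral_mono) (use h_le in \<open>auto simp: indicator_def\<close>)
    also have "\<dots> = ennreal (t / 2) * emeasure \<mu> (ball c r) + (\<integral>\<^sup>+y\<in>ball c r. h1 y \<partial>\<mu>)"
    proof (subst nn_integral_add)
      have [measurable]: "ball c r \<in> sets borel" by simp
      show "(\<lambda>y. ennreal (t / 2) * indicator (ball c r) y) \<in> borel_measurable \<mu>"
        "(\<lambda>y. h1 y * indicator (ball c r) y) \<in> borel_measurable \<mu>" by measurable
    qed (simp add: nn_integral_cmult_indicator)
    also have "ennreal (t / 2) * emeasure \<mu> (ball c r) = ennreal (t / 2 * m)"
      using t m by (simp add: ennreal_mult[symmetric])
    also have "ennreal t * emeasure \<mu> (ball c r) = ennreal (t * m)"
      using t m by (simp add: ennreal_mult[symmetric])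
    finally have "ennreal (t * m) < ennreal (t / 2 * m) + (\<integral>\<^sup>+y\<in>ball c r. h1 y \<partial>\<mu>)" .
    also have "\<dots> = (\<integral>\<^sup>+y\<in>ball c r. h1 y \<partial>\<mu>) + ennreal (t / 2 * m)" by (rule add.commute)
    finally have "ennreal (t / 2 * m) < (\<integral>\<^sup>+y\<in>ball c r. h1 y \<partial>\<mu>)"
    proof (cases "\<integral>\<^sup>+y\<in>ball c r. h1 y \<partial>\<mu>")
      case (real i)
      then have "ennreal (t * m) < ennreal i + ennreal (t / 2 * m)"
        using \<open>ennreal (t * m) < _\<close> by (simp add: add.commute)
      then have "ennreal (t * m) < ennreal (i + t / 2 * m)"
        using t m real(1) by (subst ennreal_plus) auto
      then have "t * m < i + t / 2 * m" using t m by (simp add: ennreal_less_iff)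
      then show ?thesis unfolding real using t m by (simp add: ennreal_less_iff)
    qed simp
    then show "ennreal (t / 2) * emeasure \<mu> (ball c r) < (\<integral>\<^sup>+y\<in>ball c r. h1 y \<partial>\<mu>)"
      unfolding m using t m by (subst ennreal_mult[symmetric]) auto
  qed
  then have "emeasure \<mu> {x. ennreal t < maximal \<mu> h x} \<le> emeasure \<mu> {x. ennreal (t / 2) < maximal \<mu> h1 x}"
    by (rule emeasure_mono) simp
  then have "ennreal t * emeasure \<mu> {x. ennreal t < maximal \<mu> h x} \<le> 2 * (ennreal (t / 2) * emeasure \<mu> {x. ennreal (t / 2) < maximal \<mu> h1 x})"
    unfolding t2 mult.assoc by (intro mult_left_mono) auto
  also have "\<dots> \<le> 2 * (ennreal D * (\<integral>\<^sup>+x. h1 x \<partial>\<mu>))"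
    by (intro mult_left_mono maximal_weak) auto
  also have "2 * (ennreal D * (\<integral>\<^sup>+x. h1 x \<partial>\<mu>)) = ennreal (2 * D) * (\<integral>\<^sup>+x. h1 x \<partial>\<mu>)"
    using D_nonneg by (simp add: ennreal_mult' mult.assoc)
  finally show "ennreal t * emeasure \<mu> {x \<in> space \<mu>. ennreal t < maximal \<mu> h x}
       \<le> ennreal (2 * D) * (\<integral>\<^sup>+x. h x * indicator {x. ennreal t < 2 * h x} x \<partial>\<mu>)"
    unfolding h1_def by simp
next
  show "maximal \<mu> h \<in> borel_measurable \<mu>" "h \<in> borel_measurable \<mu>" by measurable
qed (rule sigma_finite q | use D_nonneg in simp)+

end

section \<open>Dual pairs of Muckenhoupt weights\<close>

definition wt :: "('a::euclidean_space \<Rightarrow> real) \<Rightarrow> 'a measure" where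
  "wt v = density lborel (\<lambda>x. ennreal (v x))"

lemma sets_wt [simp, measurable_cong]: "sets (wt v) = sets borel"
  by (simp add: wt_def)

lemma emeasure_wt:
  "v \<in> borel_measurable borel \<Longrightarrow> A \<in> sets borel \<Longrightarrow> emeasure (wt v) A = (\<integral>\<^sup>+x\<in>A. ennreal (v x) \<partial>lborel)"
  by (simp add: wt_def emeasure_density)

lemma nn_integral_wt:
  "v \<in> borel_measurable borel \<Longrightarrow> h \<in> borel_measurable borel \<Longrightarrow>
    (\<integral>\<^sup>+x. h x \<partial>wt v) = (\<integral>\<^sup>+x. ennreal (v x) * h x \<partial>lborel)"
  by (simp add: wt_def nn_integral_density)

lemma emeasure_lborel_ball_scale:
  fixes c :: "'a::euclidean_space"
  assumes "0 \<le> t" "0 \<le> r"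
  shows "emeasure lborel (ball c (t * r)) = ennreal (t ^ DIM('a)) * emeasure lborel (ball c r)"
  using assms by (simp add: emeasure_ball ennreal_mult[symmetric] power_mult_distrib mult_ac unit_ball_vol_nonneg)

lemma emeasure_lborel_ball_pos: "0 < r \<Longrightarrow> 0 < emeasure lborel (ball (c::'a::euclidean_space) r)"
  by (simp add: emeasure_ball)

text \<open>With \<open>v = W\<^sup>q\<close>, \<open>u = W\<^sup>-\<^sup>p'\<close> and \<open>a = (1/q) / (1/q + 1/p')\<close> this is the class \<open>A(p,q)\<close>; equivalently
  \<open>v\<close> is an \<open>A\<^sub>r\<close> weight for \<open>r = 1/a\<close> with dual weight \<open>u\<close>. The definition is symmetric under
  exchanging \<open>v\<close> with \<open>u\<close> and \<open>a\<close> with \<open>1 - a\<close>.\<close>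

locale weight_pair =
  fixes v u :: "'a::euclidean_space \<Rightarrow> real" and a K :: real
  assumes v_measurable [measurable]: "v \<in> borel_measurable borel"
    and u_measurable [measurable]: "u \<in> borel_measurable borel"
    and v_pos: "\<And>x. 0 < v x" and u_pos: "\<And>x. 0 < u x"
    and a_pos: "0 < a" and a_less: "a < 1" and K_pos: "0 < K"
    and dual: "\<And>x. v x powr a * u x powr (1 - a) = 1"
    and char: "\<And>c r. 0 < r \<Longrightarrow> epowr (emeasure (wt v) (ball c r)) a * epowr (emeasure (wt u) (ball c r)) (1 - a)
       \<le> ennreal K * emeasure lborel (ball c r)"
begin

lemma swap: "weight_pair u v (1 - a) K"
  using v_pos u_pos a_pos a_less K_pos dual char
  by unfold_locales (auto simp: mult.commute)

text \<open>Hoelder's inequality applied to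
  \<open>1 = v\<^sup>a u\<^sup>(\<^sup>1\<^sup>-\<^sup>a\<^sup>)\<close>. It is the converse of
  \<open>char\<close>, valid for all Borel sets, and the pair of inequalities yields every
  comparison between the weights and Lebesgue measure below.\<close>

lemma lebesgue_le:
  assumes [measurable]: "E \<in> sets borel"
  shows "emeasure lborel E \<le> epowr (emeasure (wt v) E) a * epowr (emeasure (wt u) E) (1 - a)"
proof -
  have "emeasure lborel E = (\<integral>\<^sup>+x. indicator E x \<partial>lborel)" by simp
  also have "\<dots> = (\<integral>\<^sup>+x. epowr (ennreal (v x) * indicator E x) a * epowr (ennreal (u x) * indicator E x) (1 - a) \<partial>lborel)"
  proof (rule nn_integral_cong)
    fix x
    show "indicator E x = epowr (ennreal (v x) * indicator E x) a * epowr (ennreal (u x) * indicator E x) (1 - a)"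
      using a_pos a_less less_imp_le[OF v_pos] less_imp_le[OF u_pos] dual[of x]
      by (cases "x \<in> E") (auto simp: epowr_ennreal ennreal_mult[symmetric])
  qed
  also have "\<dots> \<le> epowr (\<integral>\<^sup>+x\<in>E. ennreal (v x) \<partial>lborel) a * epowr (\<integral>\<^sup>+x\<in>E. ennreal (u x) \<partial>lborel) (1 - a)"
    by (rule Hoelder_nn_integral) (use a_pos a_less in measurable)
  finally show ?thesis by (simp add: emeasure_wt)
qed

text \<open>In logarithms the duality relation is linear, and this is its solution for
  \<open>u\<close>. It converts an integral against \<open>v\<close> into one against
  \<open>u\<close> in the maximal theorem.\<close>

lemma dual_eq: "v x * (1 / v x) powr (1 / (1 - a)) = u x"
proof -
  define l m where "l = ln (v x)" and "m = ln (u x)"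
  have e: "v x = exp l" "u x = exp m" using v_pos[of x] u_pos[of x] by (auto simp: l_def m_def)
  have "a * l + (1 - a) * m = 0"
    using dual[of x] unfolding e by (simp add: powr_def exp_add[symmetric])
  then have "l + (- l) / (1 - a) = m" using a_less by (simp add: field_simps)
  moreover have "1 / exp l = exp (- l)" by (simp add: exp_minus inverse_eq_divide)
  ultimately show ?thesis
    unfolding e by (simp add: powr_def exp_add[symmetric])
qed

text \<open>If the weighted measure were 0, \<open>lebesgue_le\<close> would give Lebesgue measure
  0, whatever the dual factor is.\<close>

lemma ball_pos: "0 < r \<Longrightarrow> 0 < emeasure (wt v) (ball c r)"
  using lebesgue_le[of "ball c r"] emeasure_lborel_ball_pos[of r c] a_pos
  by (cases "emeasure (wt v) (ball c r) = 0") (auto simp: zero_less_iff_neq_zero)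

end

context weight_pair
begin

text \<open>The product in \<open>char\<close> is finite and its dual factor is nonzero, so the
  other factor cannot be infinite.\<close>

lemma ball_finite: "emeasure (wt v) (ball c r) < top"
proof (cases "0 < r")
  case True
  interpret dual: weight_pair u v "1 - a" K by (rule swap)
  have "epowr (emeasure (wt v) (ball c r)) a * epowr (emeasure (wt u) (ball c r)) (1 - a) < top"
    using char[OF True, of c] emeasure_lborel_ball_finite[of c r]
    by (metis ennreal_mult_less_top ennreal_less_top infinity_ennreal_def order_le_less_trans)
  moreover have "epowr (emeasure (wt u) (ball c r)) (1 - a) \<noteq> 0"
    using dual.ball_pos[OF True, of c] a_less by simp
  ultimately show ?thesis
    using a_pos by (auto simp: ennreal_mult_less_top less_top[symmetric])
qed (simp add: ball_empty)

text \<open>Bound the Lebesgue measure of \<open>E\<close> by \<open>lebesgue_le\<close>, enlarge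
  \<open>E\<close> to the ball in the factor of \<open>u\<close>, and remove that factor with
  \<open>char\<close>. Doubling, reverse doubling and the decay of exceptional sets are all
  instances.\<close>

lemma compare:
  assumes [measurable]: "E \<in> sets borel" and r: "0 < r" and sub: "E \<subseteq> ball c r" and \<theta>: "0 < \<theta>"
    and le: "ennreal \<theta> * emeasure lborel (ball c r) \<le> emeasure lborel E"
  shows "emeasure (wt v) (ball c r) \<le> ennreal ((K / \<theta>) powr (1 / a)) * emeasure (wt v) E"
proof -
  let ?B = "ball c r" and ?L = "emeasure lborel (ball c r)"
  have "ennreal \<theta> * ?L * epowr (emeasure (wt v) ?B) a
     \<le> epowr (emeasure (wt v) E) a * epowr (emeasure (wt u) ?B) (1 - a) * epowr (emeasure (wt v) ?B) a"
  proof (rule mult_right_mono)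
    have "ennreal \<theta> * ?L \<le> emeasure lborel E" by fact
    also have "\<dots> \<le> epowr (emeasure (wt v) E) a * epowr (emeasure (wt u) E) (1 - a)"
      by (rule lebesgue_le) fact
    also have "\<dots> \<le> epowr (emeasure (wt v) E) a * epowr (emeasure (wt u) ?B) (1 - a)"
      using sub a_less by (intro mult_left_mono epowr_mono emeasure_mono) auto
    finally show "ennreal \<theta> * ?L \<le> epowr (emeasure (wt v) E) a * epowr (emeasure (wt u) ?B) (1 - a)" .
  qed simp
  also have "\<dots> = epowr (emeasure (wt v) E) a * (epowr (emeasure (wt v) ?B) a * epowr (emeasure (wt u) ?B) (1 - a))"
    by (simp add: mult_ac)
  also have "\<dots> \<le> epowr (emeasure (wt v) E) a * (ennreal K * ?L)"
    by (intro mult_left_mono char r) simp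
  finally have "?L * (ennreal \<theta> * epowr (emeasure (wt v) ?B) a) \<le> ?L * (ennreal K * epowr (emeasure (wt v) E) a)"
    by (simp add: mult_ac)
  then have "ennreal \<theta> * epowr (emeasure (wt v) ?B) a \<le> ennreal K * epowr (emeasure (wt v) E) a"
    using emeasure_lborel_ball_pos[OF r, of c] emeasure_lborel_ball_finite[of c r]
    by (subst (asm) ennreal_mult_le_mult_iff) auto
  then have "ennreal (1 / \<theta>) * (ennreal \<theta> * epowr (emeasure (wt v) ?B) a) \<le> ennreal (1 / \<theta>) * (ennreal K * epowr (emeasure (wt v) E) a)"
    by (rule mult_left_mono) simp
  then have "epowr (emeasure (wt v) ?B) a \<le> ennreal (K / \<theta>) * epowr (emeasure (wt v) E) a"
    using \<theta> K_pos by (simp add: mult.assoc[symmetric] ennreal_mult[symmetric])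
  also have "\<dots> = epowr (ennreal ((K / \<theta>) powr (1 / a)) * emeasure (wt v) E) a"
    using a_pos \<theta> K_pos by (simp add: epowr_mult epowr_ennreal powr_powr)
  finally show ?thesis using a_pos by (simp add: epowr_le_iff)
qed

lemma enlarge:
  assumes r: "0 < r" and t: "1 \<le> t"
  shows "emeasure (wt v) (ball c (t * r)) \<le> ennreal ((K * t ^ DIM('a)) powr (1 / a)) * emeasure (wt v) (ball c r)"
proof -
  have "emeasure (wt v) (ball c (t * r)) \<le> ennreal ((K / (1 / t ^ DIM('a))) powr (1 / a)) * emeasure (wt v) (ball c r)"
  proof (rule compare)
    show "ball c r \<subseteq> ball c (t * r)"
      using r t by (intro subset_ball) simp
    show "ennreal (1 / t ^ DIM('a)) * emeasure lborel (ball c (t * r)) \<le> emeasure lborel (ball c r)"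
      using r t by (subst emeasure_lborel_ball_scale) (auto simp: mult.assoc[symmetric] ennreal_mult[symmetric])
  qed (use r t in auto)
  then show ?thesis by simp
qed

lemma doubling: "doubling_measure (wt v) ((K * 5 ^ DIM('a)) powr (1 / a))"
  using ball_pos ball_finite enlarge[of _ 5] by unfold_locales auto

lemma reverse_doubling:
  obtains \<delta> where "0 < \<delta>" "\<delta> < 1"
    "\<And>c r k. 0 < r \<Longrightarrow> emeasure (wt v) (ball c r) \<le> ennreal (\<delta> ^ k) * emeasure (wt v) (ball c (2 ^ k * r))"
proof -
  \<comment> \<open>The maximum with 2 keeps \<open>1 - 1 / D\<close> strictly positive.\<close>
  define D where "D = max 2 ((K / (1/2)) powr (1 / a))"
  define \<delta> where "\<delta> = 1 - 1 / D"
  have \<delta>: "0 < \<delta>" "\<delta> < 1" by (auto simp: \<delta>_def D_def field_simps)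
  have step: "emeasure (wt v) (ball c r) \<le> ennreal \<delta> * emeasure (wt v) (ball c (2 * r))" if r: "0 < r" for c r
  proof -
    let ?B = "ball c r" and ?B2 = "ball c (2 * r)"
    have sub: "?B \<subseteq> ?B2" using r by (intro subset_ball) simp
    \<comment> \<open>The annulus fills at least half of the doubled ball, because
      \<open>2 ^ n - 1 \<ge> 2 ^ n / 2\<close>.\<close>
    have "ennreal (1/2) * emeasure lborel ?B2 \<le> emeasure lborel (?B2 - ?B)"
    proof -
      have L: "emeasure lborel ?B2 = ennreal (2 ^ DIM('a) * measure lborel ?B)" "emeasure lborel ?B = ennreal (measure lborel ?B)"
        using emeasure_lborel_ball_scale[of 2 r c] r emeasure_eq_ennreal_measure[of lborel ?B] emeasure_lborel_ball_finite[of c r]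
        by (auto simp: ennreal_mult less_top[symmetric])
      have "2 ^ 1 \<le> (2::real) ^ DIM('a)" by (rule power_increasing) (auto simp: Suc_leI)
      then have "1 \<le> (2::real) ^ DIM('a) / 2" by simp
      then have "1 * measure lborel ?B \<le> (2 ^ DIM('a) / 2) * measure lborel ?B"
        by (rule mult_right_mono) simp
      moreover have "emeasure lborel (?B2 - ?B) = ennreal (2 ^ DIM('a) * measure lborel ?B - measure lborel ?B)"
        using emeasure_Diff[of lborel ?B ?B2] sub emeasure_lborel_ball_finite[of c r] unfolding L
        by (simp add: ennreal_minus)
      moreover have "ennreal (1/2) * emeasure lborel ?B2 = ennreal (1/2 * (2 ^ DIM('a) * measure lborel ?B))"
        unfolding L by (subst ennreal_mult) auto
      ultimately show ?thesis by (simp only:) (rule ennreal_leI, simp add: mult.commute)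
    qed
    then have "emeasure (wt v) ?B2 \<le> ennreal ((K / (1/2)) powr (1 / a)) * emeasure (wt v) (?B2 - ?B)"
      using r by (intro compare) auto
    also have "\<dots> \<le> ennreal D * emeasure (wt v) (?B2 - ?B)"
      by (intro mult_right_mono ennreal_leI) (auto simp: D_def)
    finally have *: "emeasure (wt v) ?B2 \<le> ennreal D * emeasure (wt v) (?B2 - ?B)" .
    define m2 m where "m2 = measure (wt v) ?B2" and "m = measure (wt v) ?B"
    have m: "emeasure (wt v) ?B2 = ennreal m2" "emeasure (wt v) ?B = ennreal m" "0 \<le> m" "0 \<le> m2"
      using ball_finite by (auto simp: m2_def m_def emeasure_eq_ennreal_measure less_top[symmetric])
    have mle: "m \<le> m2" using emeasure_mono[OF sub, of "wt v"] m by simp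
    have "emeasure (wt v) (?B2 - ?B) = ennreal (m2 - m)"
      using emeasure_Diff[of "wt v" ?B ?B2] sub m by (simp add: ennreal_minus)
    with * m mle have "m2 \<le> D * (m2 - m)"
      by (simp add: ennreal_mult[symmetric] D_def)
    then have "m \<le> \<delta> * m2" by (simp add: \<delta>_def D_def field_simps)
    then show ?thesis using m \<delta> by (simp add: ennreal_mult[symmetric] ennreal_leI)
  qed
  have "emeasure (wt v) (ball c r) \<le> ennreal (\<delta> ^ k) * emeasure (wt v) (ball c (2 ^ k * r))" if r: "0 < r" for c r k
  proof (induction k)
    case (Suc k)
    note Suc
    also have "ennreal (\<delta> ^ k) * emeasure (wt v) (ball c (2 ^ k * r))
        \<le> ennreal (\<delta> ^ k) * (ennreal \<delta> * emeasure (wt v) (ball c (2 * (2 ^ k * r))))"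
      using r by (intro mult_left_mono step) auto
    finally show ?case using \<delta> by (simp add: ennreal_mult mult_ac)
  qed simp
  with \<delta> show ?thesis by (rule that)
qed

text \<open>Lerner's argument: up to a constant, \<open>M F\<close> is dominated pointwise by an iteration of the maximal
  functions with respect to the measures \<open>u\<close> and \<open>v\<close>, both of which are doubling.\<close>

lemma average_le:
  fixes F :: "'a \<Rightarrow> ennreal"
  assumes [measurable]: "F \<in> borel_measurable borel" and x: "x \<in> ball c \<rho>"
  defines "G \<equiv> \<lambda>y. epowr (maximal (wt u) (\<lambda>y. F y * ennreal (1 / u y)) y) ((1 - a) / a) * ennreal (1 / v y)"
  shows "(\<integral>\<^sup>+y\<in>ball c \<rho>. F y \<partial>lborel) / emeasure lborel (ball c \<rho>)
    \<le> ennreal (K powr (1 / (1 - a))) * epowr (maximal (wt v) G x) (a / (1 - a))"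
proof -
  interpret dual: weight_pair u v "1 - a" K by (rule swap)
  interpret U: doubling_measure "wt u" "(K * 5 ^ DIM('a)) powr (1 / (1 - a))" by (rule dual.doubling)
  let ?B = "ball c \<rho>" and ?h = "\<lambda>y. F y * ennreal (1 / u y)"
  have \<rho>: "0 < \<rho>" using x by (simp add: le_less_trans[OF zero_le_dist])
  have [measurable]: "?B \<in> sets borel" by simp
  have [measurable]: "G \<in> borel_measurable borel" unfolding G_def by measurable
  define V U L where "V = measure (wt v) ?B" and "U = measure (wt u) ?B" and "L = measure lborel ?B"
  have V: "emeasure (wt v) ?B = ennreal V" and U: "emeasure (wt u) ?B = ennreal U" and L: "emeasure lborel ?B = ennreal L"
    using ball_finite dual.ball_finite emeasure_lborel_ball_finite[of c \<rho>]
    by (auto simp: V_def U_def L_def emeasure_eq_ennreal_measure less_top[symmetric])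
  have pos: "0 < V" "0 < U" "0 < L"
    using ball_pos[OF \<rho>, of c] dual.ball_pos[OF \<rho>, of c] emeasure_lborel_ball_pos[OF \<rho>, of c]
    unfolding V U L by auto
  have a: "0 < a" "a < 1" "0 < 1 - a" "0 < (1 - a) / a" "0 < a / (1 - a)" using a_pos a_less by auto
  \<comment> \<open>The average of \<open>F / u\<close> in the measure \<open>u\<close>; multiplied
    by the \<open>u\<close>-measure of the ball it gives back the Lebesgue integral of
    \<open>F\<close>.\<close>
  define A where "A = (\<integral>\<^sup>+y\<in>?B. ?h y \<partial>wt u) / emeasure (wt u) ?B"
  have I: "(\<integral>\<^sup>+y\<in>?B. F y \<partial>lborel) = (\<integral>\<^sup>+y\<in>?B. ?h y \<partial>wt u)"
  proof -
    have "(\<integral>\<^sup>+y\<in>?B. ?h y \<partial>wt u) = (\<integral>\<^sup>+y. ennreal (u y) * (?h y * indicator ?B y) \<partial>lborel)"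
      by (rule nn_integral_wt) measurable
    also have "\<dots> = (\<integral>\<^sup>+y\<in>?B. F y \<partial>lborel)"
    proof (rule nn_integral_cong)
      fix y
      have "ennreal (u y) * ennreal (1 / u y) = 1"
        using u_pos[of y] by (simp add: ennreal_mult[symmetric])
      then show "ennreal (u y) * (?h y * indicator ?B y) = F y * indicator ?B y"
        by (metis (no_types, lifting) mult.assoc mult.commute mult.right_neutral)
    qed
    finally show ?thesis by simp
  qed
  \<comment> \<open>On the ball the \<open>u\<close>-maximal function is at least the constant
    \<open>A\<close>. Integrating \<open>G\<close> against \<open>v\<close> cancels its factor
    \<open>1 / v\<close> and leaves a Lebesgue integral.\<close>
  have "epowr A ((1 - a) / a) * ennreal L = (\<integral>\<^sup>+y\<in>?B. epowr A ((1 - a) / a) \<partial>lborel)"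
    by (simp add: nn_integral_cmult_indicator L)
  also have "\<dots> \<le> (\<integral>\<^sup>+y. ennreal (v y) * (G y * indicator ?B y) \<partial>lborel)"
  proof (rule nn_integral_mono)
    fix y
    have "ennreal (v y) * ennreal (1 / v y) = 1"
      using v_pos[of y] by (simp add: ennreal_mult[symmetric])
    then have "ennreal (v y) * G y = epowr (maximal (wt u) ?h y) ((1 - a) / a)"
      unfolding G_def by (simp only: mult.left_commute[of "ennreal (v y)"] mult_1_right)
    moreover have "A \<le> maximal (wt u) ?h y" if "y \<in> ?B"
      unfolding A_def using that by (rule maximal_upper)
    ultimately show "epowr A ((1 - a) / a) * indicator ?B y \<le> ennreal (v y) * (G y * indicator ?B y)"
      using a by (auto simp: indicator_def intro!: epowr_mono)
  qed
  also have "\<dots> = (\<integral>\<^sup>+y\<in>?B. G y \<partial>wt v)"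
    by (rule nn_integral_wt[symmetric]) measurable
  finally have "epowr A ((1 - a) / a) * ennreal L / ennreal V \<le> (\<integral>\<^sup>+y\<in>?B. G y \<partial>wt v) / emeasure (wt v) ?B"
    unfolding V by (rule divide_right_mono_ennreal)
  also have "\<dots> \<le> maximal (wt v) G x" by (rule maximal_upper[OF x])
  finally have "epowr A ((1 - a) / a) * ennreal (L / V) \<le> maximal (wt v) G x"
    using pos by (simp add: divide_ennreal[symmetric] ennreal_times_divide)
  then have "epowr (epowr A ((1 - a) / a) * ennreal (L / V)) (a / (1 - a)) \<le> epowr (maximal (wt v) G x) (a / (1 - a))"
    using a by (intro epowr_mono) auto
  then have *: "A * ennreal ((L / V) powr (a / (1 - a))) \<le> epowr (maximal (wt v) G x) (a / (1 - a))"
    using a pos by (simp add: epowr_mult epowr_epowr epowr_ennreal)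
  have "ennreal (V powr a * U powr (1 - a)) \<le> ennreal (K * L)"
    using char[OF \<rho>, of c] a pos K_pos unfolding V U L by (simp add: epowr_ennreal ennreal_mult)
  then have "V powr a * U powr (1 - a) \<le> K * L"
    using pos K_pos by (subst (asm) ennreal_le_iff) auto
  \<comment> \<open>The power \<open>1 / (1 - a) = 1 + a / (1 - a)\<close> isolates the first power
    of \<open>U\<close> and splits off one factor \<open>L\<close>, the one that normalises the
    Lebesgue average.\<close>
  then have "(V powr a * U powr (1 - a)) powr (1 / (1 - a)) \<le> (K * L) powr (1 / (1 - a))"
    using a pos by (intro powr_mono2) auto
  then have "V powr (a / (1 - a)) * U \<le> K powr (1 / (1 - a)) * L powr (1 / (1 - a))"
    using a pos K_pos by (simp add: powr_mult powr_powr)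
  also have "1 / (1 - a) = 1 + a / (1 - a)" using a by (simp add: field_simps)
  also have "L powr (1 + a / (1 - a)) = L * L powr (a / (1 - a))"
    using pos by (simp add: powr_add)
  finally have UL: "U / L \<le> K powr (1 + a / (1 - a)) * (L / V) powr (a / (1 - a))"
    using pos by (simp add: powr_divide field_simps)
  have "(\<integral>\<^sup>+y\<in>?B. F y \<partial>lborel) = A * ennreal U"
    unfolding I A_def U using pos by (simp add: ennreal_divide_times ennreal_times_divide[symmetric] ennreal_divide_self)
  then have "(\<integral>\<^sup>+y\<in>?B. F y \<partial>lborel) / emeasure lborel ?B = A * ennreal (U / L)"
    unfolding L using pos by (simp add: divide_ennreal[symmetric] ennreal_times_divide)
  also have "\<dots> \<le> A * ennreal (K powr (1 + a / (1 - a)) * (L / V) powr (a / (1 - a)))"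
    by (intro mult_left_mono ennreal_leI UL) simp
  also have "\<dots> = ennreal (K powr (1 + a / (1 - a))) * (A * ennreal ((L / V) powr (a / (1 - a))))"
    by (simp add: ennreal_mult mult_ac)
  also have "\<dots> \<le> ennreal (K powr (1 + a / (1 - a))) * epowr (maximal (wt v) G x) (a / (1 - a))"
    by (intro mult_left_mono *) simp
  also have "1 + a / (1 - a) = 1 / (1 - a)" using a by (simp add: field_simps)
  finally show ?thesis .
qed

text \<open>The maximal function of \<open>v\<close> is used at exponent \<open>1 / (1 - a)\<close>,
  that of \<open>u\<close> at exponent \<open>1 / a\<close>. The powers in \<open>average_le\<close>
  are tuned so that the output of one bound is the input of the other, with \<open>dual_eq\<close>
  passing between the two measures.\<close>

lemma muckenhoupt:
  obtains C where "0 \<le> C"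
    "\<And>F :: 'a \<Rightarrow> ennreal. F \<in> borel_measurable borel \<Longrightarrow>
      (\<integral>\<^sup>+x. epowr (maximal lborel F x) (1 / a) \<partial>wt v) \<le> ennreal C * (\<integral>\<^sup>+x. epowr (F x) (1 / a) \<partial>wt v)"
proof -
  interpret dual: weight_pair u v "1 - a" K by (rule swap)
  interpret U: doubling_measure "wt u" "(K * 5 ^ DIM('a)) powr (1 / (1 - a))" by (rule dual.doubling)
  interpret V: doubling_measure "wt v" "(K * 5 ^ DIM('a)) powr (1 / a)" by (rule doubling)
  have a: "0 < a" "a < 1" "0 < 1 - a" "0 < (1 - a) / a" "0 < a / (1 - a)" using a_pos a_less by auto
  obtain C1 where C1: "0 \<le> C1" "\<And>h. h \<in> borel_measurable borel \<Longrightarrow>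
      (\<integral>\<^sup>+x. epowr (maximal (wt u) h x) (1 / a) \<partial>wt u) \<le> ennreal C1 * (\<integral>\<^sup>+x. epowr (h x) (1 / a) \<partial>wt u)"
  proof (rule that)
    show "0 \<le> (1 / a) * (2 * (K * 5 ^ DIM('a)) powr (1 / (1 - a))) * 2 powr (1 / a - 1) / (1 / a - 1)" using a U.D_nonneg by simp
  qed (rule U.maximal_strong, use a in auto)
  obtain C2 where C2: "0 \<le> C2" "\<And>h. h \<in> borel_measurable borel \<Longrightarrow>
      (\<integral>\<^sup>+x. epowr (maximal (wt v) h x) (1 / (1 - a)) \<partial>wt v) \<le> ennreal C2 * (\<integral>\<^sup>+x. epowr (h x) (1 / (1 - a)) \<partial>wt v)"
  proof (rule that)
    show "0 \<le> (1 / (1 - a)) * (2 * (K * 5 ^ DIM('a)) powr (1 / a)) * 2 powr (1 / (1 - a) - 1) / (1 / (1 - a) - 1)" using a V.D_nonneg by simp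
  qed (rule V.maximal_strong, use a in auto)
  define C where "C = K powr (1 / (1 - a) / a) * C2 * C1"
  have C: "0 \<le> C" using C1 C2 by (simp add: C_def)
  have "(\<integral>\<^sup>+x. epowr (maximal lborel F x) (1 / a) \<partial>wt v) \<le> ennreal C * (\<integral>\<^sup>+x. epowr (F x) (1 / a) \<partial>wt v)"
    if [measurable]: "F \<in> borel_measurable borel" for F
  proof -
    let ?h = "\<lambda>y. F y * ennreal (1 / u y)"
    define G where "G y = epowr (maximal (wt u) ?h y) ((1 - a) / a) * ennreal (1 / v y)" for y
    have [measurable]: "G \<in> borel_measurable borel" unfolding G_def by measurable
    have "maximal lborel F x \<le> ennreal (K powr (1 / (1 - a))) * epowr (maximal (wt v) G x) (a / (1 - a))" for x
      unfolding maximal_def[of lborel] G_def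
      by (rule SUP_least) (use average_le[OF that] in auto)
    then have "epowr (maximal lborel F x) (1 / a) \<le> epowr (ennreal (K powr (1 / (1 - a))) * epowr (maximal (wt v) G x) (a / (1 - a))) (1 / a)" for x
      using a by (intro epowr_mono) auto
    also have "epowr (ennreal (K powr (1 / (1 - a))) * epowr (maximal (wt v) G x) (a / (1 - a))) (1 / a)
       = ennreal (K powr (1 / (1 - a) / a)) * epowr (maximal (wt v) G x) (1 / (1 - a))" for x
      using a by (simp add: epowr_mult epowr_epowr epowr_ennreal powr_powr)
    finally have "(\<integral>\<^sup>+x. epowr (maximal lborel F x) (1 / a) \<partial>wt v)
       \<le> (\<integral>\<^sup>+x. ennreal (K powr (1 / (1 - a) / a)) * epowr (maximal (wt v) G x) (1 / (1 - a)) \<partial>wt v)"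
      by (rule nn_integral_mono)
    also have "\<dots> = ennreal (K powr (1 / (1 - a) / a)) * (\<integral>\<^sup>+x. epowr (maximal (wt v) G x) (1 / (1 - a)) \<partial>wt v)"
      by (rule nn_integral_cmult) measurable
    also have "\<dots> \<le> ennreal (K powr (1 / (1 - a) / a)) * (ennreal C2 * (\<integral>\<^sup>+x. epowr (G x) (1 / (1 - a)) \<partial>wt v))"
      by (intro mult_left_mono C2) auto
    also have "(\<integral>\<^sup>+x. epowr (G x) (1 / (1 - a)) \<partial>wt v) = (\<integral>\<^sup>+x. ennreal (v x) * epowr (G x) (1 / (1 - a)) \<partial>lborel)"
      by (rule nn_integral_wt) measurable
    also have "\<dots> = (\<integral>\<^sup>+x. ennreal (u x) * epowr (maximal (wt u) ?h x) (1 / a) \<partial>lborel)"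
    proof (rule nn_integral_cong)
      fix x
      note dual_eq[of x]
      then have "ennreal (v x) * epowr (ennreal (1 / v x)) (1 / (1 - a)) = ennreal (u x)"
        using v_pos[of x] a by (simp add: epowr_ennreal ennreal_mult[symmetric])
      moreover have "epowr (G x) (1 / (1 - a)) = epowr (maximal (wt u) ?h x) (1 / a) * epowr (ennreal (1 / v x)) (1 / (1 - a))"
        using a by (simp add: G_def epowr_mult epowr_epowr)
      ultimately show "ennreal (v x) * epowr (G x) (1 / (1 - a)) = ennreal (u x) * epowr (maximal (wt u) ?h x) (1 / a)"
        by (simp only: mult.left_commute[of "ennreal (v x)"] mult.commute[of _ "ennreal (u x)"])
    qed
    also have "\<dots> = (\<integral>\<^sup>+x. epowr (maximal (wt u) ?h x) (1 / a) \<partial>wt u)"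
      by (rule nn_integral_wt[symmetric]) measurable
    also have "ennreal (K powr (1 / (1 - a) / a)) * (ennreal C2 * \<dots>)
       \<le> ennreal (K powr (1 / (1 - a) / a)) * (ennreal C2 * (ennreal C1 * (\<integral>\<^sup>+x. epowr (?h x) (1 / a) \<partial>wt u)))"
      by (intro mult_left_mono C1) auto
    also have "(\<integral>\<^sup>+x. epowr (?h x) (1 / a) \<partial>wt u) = (\<integral>\<^sup>+x. ennreal (u x) * epowr (?h x) (1 / a) \<partial>lborel)"
      by (rule nn_integral_wt) measurable
    also have "\<dots> = (\<integral>\<^sup>+x. ennreal (v x) * epowr (F x) (1 / a) \<partial>lborel)"
    proof (rule nn_integral_cong)
      fix x
      have "u x * (1 / u x) powr (1 / a) = v x" using dual.dual_eq[of x] by simp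
      then have "ennreal (u x) * epowr (ennreal (1 / u x)) (1 / a) = ennreal (v x)"
        using u_pos[of x] a by (simp add: epowr_ennreal ennreal_mult[symmetric])
      moreover have "epowr (?h x) (1 / a) = epowr (F x) (1 / a) * epowr (ennreal (1 / u x)) (1 / a)"
        using a by (simp add: epowr_mult)
      ultimately show "ennreal (u x) * epowr (?h x) (1 / a) = ennreal (v x) * epowr (F x) (1 / a)"
        by (metis mult.assoc mult.commute)
    qed
    also have "\<dots> = (\<integral>\<^sup>+x. epowr (F x) (1 / a) \<partial>wt v)"
      by (rule nn_integral_wt[symmetric]) measurable
    finally show ?thesis
      using C1(1) C2(1) by (simp add: C_def ennreal_mult' mult.assoc)
  qed
  with C show ?thesis by (rule that)
qed

end

section \<open>Dyadic cells and the weighted John--Nirenberg inequality\<close>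

text \<open>A half-open dyadic cube of side \<open>h / 2 ^ k\<close> in the grid based at the point
  \<open>o'\<close>, named by any of its points \<open>x\<close>. Base point and side are free so
  that a given ball can be enclosed in a single cell of generation 0.\<close>

definition cell :: "'a::euclidean_space \<Rightarrow> real \<Rightarrow> nat \<Rightarrow> 'a \<Rightarrow> 'a set" where
  "cell o' h k x = {y. \<forall>i\<in>Basis. \<lfloor>2 ^ k * ((y - o') \<bullet> i) / h\<rfloor> = \<lfloor>2 ^ k * ((x - o') \<bullet> i) / h\<rfloor>}"

lemma cell_refl: "x \<in> cell o' h k x"
  by (simp add: cell_def)

lemma cell_eq: "y \<in> cell o' h k x \<Longrightarrow> cell o' h k y = cell o' h k x"
  by (auto simp: cell_def)

lemma cell_Suc_subset: "cell o' h (Suc k) x \<subseteq> cell o' h k x"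
proof
  fix y assume y: "y \<in> cell o' h (Suc k) x"
  \<comment> \<open>Passing to the coarser grid halves the integer index, rounding down.\<close>
  have *: "\<lfloor>2 ^ k * t / h\<rfloor> = \<lfloor>2 ^ Suc k * t / h\<rfloor> div 2" for t :: real
    using floor_divide_real_eq_div[of 2 "2 ^ Suc k * t / h"] by simp
  show "y \<in> cell o' h k x"
    using y unfolding cell_def mem_Collect_eq * by simp
qed

lemma cell_subset: "j \<le> k \<Longrightarrow> cell o' h k x \<subseteq> cell o' h j x"
proof (induction k rule: dec_induct)
  case (step k) then show ?case using cell_Suc_subset by blast
qed simp

lemma cell_eq_le: "y \<in> cell o' h k x \<Longrightarrow> j \<le> k \<Longrightarrow> cell o' h j y = cell o' h j x"
  using cell_subset cell_eq by blast

lemma sets_cell [measurable, simp]: "cell o' h k x \<in> sets borel"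
proof -
  have "{y. \<forall>i\<in>Basis. \<lfloor>2 ^ k * ((y - o') \<bullet> i) / h\<rfloor> = \<lfloor>2 ^ k * ((x - o') \<bullet> i) / h\<rfloor>}
      = (\<Inter>i\<in>Basis. {y \<in> space borel. \<lfloor>2 ^ k * ((y - o') \<bullet> i) / h\<rfloor> = \<lfloor>2 ^ k * ((x - o') \<bullet> i) / h\<rfloor>})"
    by auto
  also have "\<dots> \<in> sets borel"
  proof (intro sets.finite_INT)
    fix i :: 'a
    show "{y \<in> space borel. \<lfloor>2 ^ k * ((y - o') \<bullet> i) / h\<rfloor> = \<lfloor>2 ^ k * ((x - o') \<bullet> i) / h\<rfloor>} \<in> sets borel"
      by measurable
  qed auto
  finally show ?thesis unfolding cell_def .
qed

lemma cell_bounds: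
  fixes o' :: "'a::euclidean_space"
  assumes h: "0 < h"
  obtains l where "box l (l + (h / 2 ^ k) *\<^sub>R One) \<subseteq> cell o' h k x"
    "cell o' h k x \<subseteq> cbox l (l + (h / 2 ^ k) *\<^sub>R One)"
    "\<And>y. y \<in> cell o' h k x \<longleftrightarrow> (\<forall>i\<in>Basis. l \<bullet> i \<le> y \<bullet> i \<and> y \<bullet> i < l \<bullet> i + h / 2 ^ k)"
proof -
  define s where "s = h / 2 ^ k"
  have s: "0 < s" using h by (simp add: s_def)
  define l where "l = o' + (\<Sum>i\<in>Basis. (s * of_int \<lfloor>2 ^ k * ((x - o') \<bullet> i) / h\<rfloor>) *\<^sub>R i)"
  have l: "l \<bullet> i = o' \<bullet> i + s * of_int \<lfloor>2 ^ k * ((x - o') \<bullet> i) / h\<rfloor>" if "i \<in> Basis" for i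
    using that by (simp add: l_def inner_add_left)
  have iff: "y \<in> cell o' h k x \<longleftrightarrow> (\<forall>i\<in>Basis. l \<bullet> i \<le> y \<bullet> i \<and> y \<bullet> i < l \<bullet> i + s)" for y
    unfolding cell_def mem_Collect_eq
  proof (rule ball_cong[OF refl])
    fix i :: 'a assume i: "i \<in> Basis"
    define m where "m = \<lfloor>2 ^ k * ((x - o') \<bullet> i) / h\<rfloor>"
    have "2 ^ k * ((y - o') \<bullet> i) / h = ((y - o') \<bullet> i) / s" by (simp add: s_def)
    then show "(\<lfloor>2 ^ k * ((y - o') \<bullet> i) / h\<rfloor> = \<lfloor>2 ^ k * ((x - o') \<bullet> i) / h\<rfloor>) = (l \<bullet> i \<le> y \<bullet> i \<and> y \<bullet> i < l \<bullet> i + s)"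
      unfolding l[OF i] m_def[symmetric] using s
      by (simp add: floor_eq_iff pos_le_divide_eq pos_divide_less_eq inner_diff_left algebra_simps) 
  qed
  show ?thesis
    by (rule that[of l]) (use iff in \<open>auto simp: s_def mem_box inner_add_left less_imp_le\<close>)
qed

lemma emeasure_cell:
  fixes o' :: "'a::euclidean_space"
  assumes h: "0 < h"
  shows "emeasure lborel (cell o' h k x) = ennreal ((h / 2 ^ k) ^ DIM('a))"
proof -
  obtain l where l: "box l (l + (h / 2 ^ k) *\<^sub>R One) \<subseteq> cell o' h k x"
    "cell o' h k x \<subseteq> cbox l (l + (h / 2 ^ k) *\<^sub>R One)"
    using cell_bounds[OF h] by metis
  have "emeasure lborel (box l (l + (h / 2 ^ k) *\<^sub>R One)) = ennreal ((h / 2 ^ k) ^ DIM('a))"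
    "emeasure lborel (cbox l (l + (h / 2 ^ k) *\<^sub>R One)) = ennreal ((h / 2 ^ k) ^ DIM('a))"
    using h by (auto simp: emeasure_lborel_box_eq emeasure_lborel_cbox_eq inner_add_left)
  then show ?thesis
    using emeasure_mono[OF l(1), of lborel] emeasure_mono[OF l(2), of lborel] by simp
qed

lemma cell_subset_ball:
  fixes o' :: "'a::euclidean_space"
  assumes h: "0 < h"
  shows "cell o' h k x \<subseteq> ball x (real DIM('a) * (h / 2 ^ k))"
proof
  fix y assume y: "y \<in> cell o' h k x"
  obtain l where l: "\<And>y. y \<in> cell o' h k x \<longleftrightarrow> (\<forall>i\<in>Basis. l \<bullet> i \<le> y \<bullet> i \<and> y \<bullet> i < l \<bullet> i + h / 2 ^ k)"
    using cell_bounds[OF h] by metis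
  have "dist x y \<le> (\<Sum>i\<in>Basis. \<bar>(x - y) \<bullet> i\<bar>)" unfolding dist_norm by (rule norm_le_l1)
  also have "\<dots> < (\<Sum>i\<in>(Basis::'a set). h / 2 ^ k)"
  proof (rule sum_strict_mono)
    fix i :: 'a assume "i \<in> Basis"
    then show "\<bar>(x - y) \<bullet> i\<bar> < h / 2 ^ k"
      using y[unfolded l] cell_refl[of x o' h k, unfolded l] by (fastforce simp: inner_diff_left)
  qed auto
  finally show "y \<in> ball x (real DIM('a) * (h / 2 ^ k))" by simp
qed

lemma countable_cells: "0 < h \<Longrightarrow> countable {cell (o'::'a::euclidean_space) h k x | k x. True}"
proof -
  assume h: "0 < h"
  \<comment> \<open>Every cell contains a nonempty open box, hence a point of a countable dense set,
    and that point names the cell.\<close>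
  obtain D :: "'a set" where D: "countable D" "\<And>X. open X \<Longrightarrow> X \<noteq> {} \<Longrightarrow> \<exists>d\<in>D. d \<in> X"
    using countable_dense_exists by metis
  have "{cell o' h k x | k x. True} \<subseteq> (\<lambda>(k, d). cell o' h k d) ` (UNIV \<times> D)"
  proof clarify
    fix k x
    obtain l where l: "box l (l + (h / 2 ^ k) *\<^sub>R One) \<subseteq> cell o' h k x"
      using cell_bounds[OF h] by metis
    have "box l (l + (h / 2 ^ k) *\<^sub>R One) \<noteq> {}" using h by (simp add: box_ne_empty inner_add_left)
    then obtain d where "d \<in> D" "d \<in> box l (l + (h / 2 ^ k) *\<^sub>R One)" using D(2) by blast
    then show "cell o' h k x \<in> (\<lambda>(k, d). cell o' h k d) ` (UNIV \<times> D)"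
      using l cell_eq[of d o' h k x] by (intro image_eqI[of _ _ "(k, d)"]) auto
  qed
  then show ?thesis by (rule countable_subset) (use D(1) in auto)
qed

text \<open>The maximal cells with property \<open>P\<close>: none of the coarser cells around them
  has it. Generations start at 0, so every cell with the property lies in a maximal one.\<close>

definition top_cells :: "'a::euclidean_space \<Rightarrow> real \<Rightarrow> ('a set \<Rightarrow> bool) \<Rightarrow> 'a set set" where
  "top_cells o' h P = {cell o' h k x | k x. P (cell o' h k x) \<and> (\<forall>j<k. \<not> P (cell o' h j x))}"

lemma countable_top_cells: "0 < h \<Longrightarrow> countable (top_cells o' h P)"
  by (rule countable_subset[OF _ countable_cells[of h o']]) (auto simp: top_cells_def)

lemma sets_top_cells: "Q \<in> top_cells o' h P \<Longrightarrow> Q \<in> sets borel"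
  by (auto simp: top_cells_def)

text \<open>Seen from a common point \<open>z\<close>, both cells are the cell around
  \<open>z\<close> of the first generation with the property.\<close>

lemma disjoint_top_cells: "disjoint (top_cells o' h P)"
proof (rule disjointI)
  fix S T assume S: "S \<in> top_cells o' h P" and T: "T \<in> top_cells o' h P" and ne: "S \<noteq> T"
  show "S \<inter> T = {}"
  proof (rule ccontr)
    assume "S \<inter> T \<noteq> {}"
    then obtain z where z: "z \<in> S" "z \<in> T" by blast
    have "\<exists>k. Q = cell o' h k z \<and> P (cell o' h k z) \<and> (\<forall>j<k. \<not> P (cell o' h j z))"
      if Q: "Q \<in> top_cells o' h P" "z \<in> Q" for Q
    proof -
      obtain k x where k: "Q = cell o' h k x" "P (cell o' h k x)" "\<forall>j<k. \<not> P (cell o' h j x)"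
        using Q(1) unfolding top_cells_def by blast
      have "cell o' h j z = cell o' h j x" if "j \<le> k" for j
        using \<open>z \<in> Q\<close> that unfolding k(1) by (rule cell_eq_le)
      then show ?thesis using k by (intro exI[of _ k]) auto
    qed
    from this[OF S z(1)] this[OF T z(2)] ne show False
      by (metis linorder_neqE_nat)
  qed
qed

lemma Union_top_cells: "\<Union>(top_cells o' h P) = {x. \<exists>k. P (cell o' h k x)}"
proof (intro set_eqI iffI)
  fix x assume "x \<in> \<Union>(top_cells o' h P)"
  then obtain k y where "x \<in> cell o' h k y" "P (cell o' h k y)" unfolding top_cells_def by blast
  then show "x \<in> {x. \<exists>k. P (cell o' h k x)}" by simp (metis cell_eq)
next
  fix x assume "x \<in> {x. \<exists>k. P (cell o' h k x)}"
  then obtain k where "P (cell o' h k x)" "\<forall>j<k. \<not> P (cell o' h j x)"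
    using exists_least_iff[of "\<lambda>k. P (cell o' h k x)"] by auto
  then show "x \<in> \<Union>(top_cells o' h P)" unfolding top_cells_def using cell_refl[of x o' h k] by blast
qed

text \<open>Sums a local estimate over the stopping cells: subadditivity on the left, additivity
  over the disjoint cells on the right.\<close>

lemma emeasure_UN_le_Union:
  assumes T: "countable T" "disjoint T"
    and A: "\<And>Q. Q \<in> T \<Longrightarrow> A Q \<in> sets M" and N: "\<And>Q. Q \<in> T \<Longrightarrow> Q \<in> sets N"
    and le: "\<And>Q. Q \<in> T \<Longrightarrow> emeasure M (A Q) \<le> c * emeasure N Q"
  shows "emeasure M (\<Union>Q\<in>T. A Q) \<le> c * emeasure N (\<Union>T)"
proof -
  have "emeasure M (\<Union>Q\<in>T. A Q) \<le> (\<integral>\<^sup>+Q. emeasure M (A Q) \<partial>count_space T)"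
    using T A by (intro emeasure_UN_le)
  also have "\<dots> \<le> (\<integral>\<^sup>+Q. c * emeasure N Q \<partial>count_space T)"
    using le by (intro nn_integral_mono) auto
  also have "\<dots> = c * (\<integral>\<^sup>+Q. emeasure N Q \<partial>count_space T)"
    by (rule nn_integral_cmult) simp
  also have "(\<integral>\<^sup>+Q. emeasure N Q \<partial>count_space T) = emeasure N (\<Union>Q\<in>T. Q)"
    using T N by (intro emeasure_UN_countable[symmetric]) (auto simp: disjoint_def disjoint_family_on_def)
  finally show ?thesis by simp
qed

text \<open>That \<open>g \<le> \<tau>\<close> almost everywhere off the stopping cells is derived from outer regularity, not from the Lebesgue differentiation theorem:
  the part where \<open>g > \<tau> + \<epsilon>\<close> is covered by cells inside an open set of nearly the same measure,
  on each of which the average of \<open>g\<close> is at most \<open>\<tau>\<close>.\<close>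

lemma calderon_zygmund:
  fixes o' :: "'a::euclidean_space" and g :: "'a \<Rightarrow> ennreal"
  assumes h: "0 < h" and g [measurable]: "g \<in> borel_measurable borel" and \<tau>: "0 < \<tau>"
    and S: "S = cell o' h k0 x0"
    and gS: "(\<integral>\<^sup>+y\<in>S. g y \<partial>lborel) \<le> ennreal \<tau> * emeasure lborel S"
  obtains T where "countable T" "disjoint T" "\<Union>T \<subseteq> S"
    "\<And>Q. Q \<in> T \<Longrightarrow> \<exists>k x. Q = cell o' h k x"
    "\<And>Q. Q \<in> T \<Longrightarrow> ennreal \<tau> * emeasure lborel Q \<le> (\<integral>\<^sup>+y\<in>Q. g y \<partial>lborel)"
    "\<And>Q. Q \<in> T \<Longrightarrow> (\<integral>\<^sup>+y\<in>Q. g y \<partial>lborel) \<le> ennreal (2 ^ DIM('a) * \<tau>) * emeasure lborel Q"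
    "AE x in lborel. x \<in> S - \<Union>T \<longrightarrow> g x \<le> ennreal \<tau>"
proof -
  let ?c = "cell o' h"
  \<comment> \<open>The cell \<open>S\<close> itself fails the inequality by \<open>gS\<close>, and
    larger cells fail the inclusion. Hence every selected cell has a parent that lies inside
    \<open>S\<close> and was not selected.\<close>
  define P where "P Q \<longleftrightarrow> Q \<subseteq> S \<and> ennreal \<tau> * emeasure lborel Q < (\<integral>\<^sup>+y\<in>Q. g y \<partial>lborel)" for Q
  define T where "T = top_cells o' h P"
  have cT: "countable T" unfolding T_def by (rule countable_top_cells[OF h])
  have dT: "disjoint T" unfolding T_def by (rule disjoint_top_cells)
  have TD: "Q \<in> T \<Longrightarrow> \<exists>k x. Q = ?c k x \<and> P (?c k x) \<and> (\<forall>j<k. \<not> P (?c j x))" for Q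
    unfolding T_def top_cells_def by blast
  have sT: "Q \<in> T \<Longrightarrow> Q \<in> sets borel" for Q unfolding T_def by (rule sets_top_cells)
  have [measurable]: "\<Union>T \<in> sets borel" using cT sT by (intro sets.countable_Union) auto
  have [measurable]: "S \<in> sets borel" unfolding S by simp
  have upper: "(\<integral>\<^sup>+y\<in>Q. g y \<partial>lborel) \<le> ennreal (2 ^ DIM('a) * \<tau>) * emeasure lborel Q" if QT: "Q \<in> T" for Q
  proof -
    obtain k x where Q: "Q = ?c k x" "P (?c k x)" "\<And>j. j < k \<Longrightarrow> \<not> P (?c j x)" using TD[OF QT] by blast
    have xS: "x \<in> S" using Q(2) cell_refl[of x o' h k] unfolding P_def by blast
    have kk0: "k0 < k"
    proof (rule ccontr)
      assume "\<not> k0 < k"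
      then have "S \<subseteq> ?c k x" using cell_subset[of k k0 o' h x] cell_eq xS unfolding S by (metis not_less)
      then have "?c k x = S" using Q(2) unfolding P_def by blast
      then show False using Q(2) gS unfolding P_def by (simp add: not_less[symmetric])
    qed
    then obtain j where j: "k = Suc j" "k0 \<le> j" by (cases k) auto
    have "?c j x \<subseteq> S" using cell_subset[OF j(2), of o' h x] cell_eq[of x] xS unfolding S by metis
    moreover have "\<not> P (?c j x)" using Q(3) j by simp
    ultimately have "(\<integral>\<^sup>+y\<in>?c j x. g y \<partial>lborel) \<le> ennreal \<tau> * emeasure lborel (?c j x)"
      by (simp add: P_def not_less)
    moreover have "(\<integral>\<^sup>+y\<in>Q. g y \<partial>lborel) \<le> (\<integral>\<^sup>+y\<in>?c j x. g y \<partial>lborel)"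
      unfolding Q(1) j using cell_Suc_subset[of o' h j x] by (intro nn_integral_mono) (auto simp: indicator_def)
    moreover have "ennreal \<tau> * emeasure lborel (?c j x) = ennreal (2 ^ DIM('a) * \<tau>) * emeasure lborel Q"
    proof -
      \<comment> \<open>The parent has \<open>2 ^ n\<close> times the volume, which is the factor in
        the upper bound.\<close>
      have "h / 2 ^ j = 2 * (h / 2 ^ Suc j)" by simp
      then have "\<tau> * (h / 2 ^ j) ^ DIM('a) = (2 ^ DIM('a) * \<tau>) * (h / 2 ^ Suc j) ^ DIM('a)"
        by (simp only: power_mult_distrib mult_ac)
      moreover have "ennreal \<tau> * ennreal ((h / 2 ^ j) ^ DIM('a)) = ennreal (\<tau> * (h / 2 ^ j) ^ DIM('a))"
        using h \<tau> by (intro ennreal_mult[symmetric]) auto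
      moreover have "ennreal (2 ^ DIM('a) * \<tau>) * ennreal ((h / 2 ^ Suc j) ^ DIM('a)) = ennreal ((2 ^ DIM('a) * \<tau>) * (h / 2 ^ Suc j) ^ DIM('a))"
        using h \<tau> by (intro ennreal_mult[symmetric]) auto
      ultimately show ?thesis
        unfolding Q(1) j emeasure_cell[OF h] by (simp only:)
    qed
    ultimately show ?thesis by simp
  qed
  have AE: "AE x in lborel. x \<in> S - \<Union>T \<longrightarrow> g x \<le> ennreal \<tau>"
  proof -
    define E where "E N = {x \<in> S - \<Union>T. ennreal (\<tau> + 1 / Suc N) < g x}" for N
    have [measurable]: "E N \<in> sets borel" for N unfolding E_def by measurable
    have null: "E N \<in> null_sets lborel" for N
    proof (rule ccontr)
      assume "E N \<notin> null_sets lborel"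
      then have pos: "emeasure lborel (E N) \<noteq> 0" by auto
      have "emeasure lborel (E N) \<le> emeasure lborel S" by (rule emeasure_mono) (auto simp: E_def)
      then have fin: "emeasure lborel (E N) < top" unfolding S emeasure_cell[OF h] by (rule order_le_less_trans) simp
      obtain e where e: "emeasure lborel (E N) = ennreal e" "0 < e"
        using pos fin by (cases "emeasure lborel (E N)") auto
      \<comment> \<open>With this choice \<open>\<tau> * \<epsilon>\<close> is half of
        \<open>e / Suc N\<close>, the amount by which the integral of \<open>g\<close> over
        \<open>E N\<close> must exceed \<open>\<tau> * e\<close>.\<close>
      define \<epsilon> where "\<epsilon> = e / (2 * \<tau> * Suc N)"
      have \<epsilon>: "0 < \<epsilon>" using e \<tau> by (simp add: \<epsilon>_def)
      have "E N \<in> sets lebesgue" by (rule sets_completionI_sets) simp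
      then obtain U where U: "open U" "E N \<subseteq> U" "emeasure lebesgue (U - E N) < ennreal \<epsilon>"
        using \<epsilon> by (rule sets_lebesgue_outer_open)
      have [measurable]: "U \<in> sets borel" using U by simp
      have Um: "emeasure lborel U \<le> ennreal (e + \<epsilon>)"
      proof -
        have "emeasure lborel U = emeasure lborel (E N) + emeasure lborel (U - E N)"
        proof (subst plus_emeasure)
          show "emeasure lborel U = emeasure lborel (E N \<union> (U - E N))"
            using U(2) by (intro arg_cong[where f="emeasure lborel"]) blast
        qed auto
        also have "\<dots> \<le> ennreal e + ennreal \<epsilon>"
          using U(3) e by (intro add_mono) (auto simp: less_imp_le)
        finally show ?thesis using e \<epsilon> by (simp add: ennreal_plus)
      qed
      \<comment> \<open>A cell inside \<open>S\<close> that meets \<open>E N\<close> has a point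
        outside all stopping cells. As these cover every cell with property \<open>P\<close>, the
        average of \<open>g\<close> over it is at most \<open>\<tau>\<close>.\<close>
      define R where "R Q \<longleftrightarrow> Q \<subseteq> U \<and> Q \<subseteq> S \<and> Q \<inter> E N \<noteq> {}" for Q
      define W where "W = top_cells o' h R"
      have cW: "countable W" unfolding W_def by (rule countable_top_cells[OF h])
      have sW: "Q \<in> W \<Longrightarrow> Q \<in> sets borel" for Q unfolding W_def by (rule sets_top_cells)
      have [measurable]: "\<Union>W \<in> sets borel" using cW sW by (intro sets.countable_Union) auto
      have WU: "\<Union>W \<subseteq> U" unfolding W_def top_cells_def R_def by blast
      have EW: "E N \<subseteq> \<Union>W"
      proof
        fix x assume x: "x \<in> E N"
        then obtain d where d: "0 < d" "ball x d \<subseteq> U" using U(1,2) open_contains_ball by blast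
        obtain k where k: "real DIM('a) * h / d < 2 ^ k"
          using real_arch_pow[of 2 "real DIM('a) * h / d"] by auto
        \<comment> \<open>Fine enough for the cell to fit into \<open>U\<close>, and at least
          \<open>k0\<close> so that it stays inside \<open>S\<close>.\<close>
        define k' where "k' = max k k0"
        have "(2::real) ^ k \<le> 2 ^ k'" by (intro power_increasing) (auto simp: k'_def)
        with k have "real DIM('a) * h / d < 2 ^ k'" by linarith
        then have "real DIM('a) * (h / 2 ^ k') < d" using d h by (simp add: field_simps)
        then have "?c k' x \<subseteq> U" using cell_subset_ball[OF h, of o' k' x] d(2) subset_ball[of "real DIM('a) * (h / 2 ^ k')" d x] by force
        moreover have "x \<in> S" using x by (simp add: E_def)
        then have "?c k' x \<subseteq> S" using cell_subset[of k0 k' o' h x] cell_eq[of x] unfolding S k'_def by (metis max.cobounded2)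
        ultimately have "R (?c k' x)" unfolding R_def using x cell_refl[of x o' h k'] by blast
        then show "x \<in> \<Union>W" unfolding W_def Union_top_cells by blast
      qed
      have Wle: "emeasure (density lborel g) Q \<le> ennreal \<tau> * emeasure lborel Q" if QW: "Q \<in> W" for Q
      proof -
        obtain k y where Q: "Q = ?c k y" "R Q" using QW unfolding W_def top_cells_def by blast
        then obtain x where x: "x \<in> Q" "x \<in> E N" "Q \<subseteq> S" unfolding R_def by blast
        then have "Q = ?c k x" using cell_eq Q(1) by blast
        moreover have "x \<notin> \<Union>T" using x by (simp add: E_def)
        ultimately have "\<not> P Q" unfolding T_def Union_top_cells by blast
        then show ?thesis using x(3) sW[OF QW] by (simp add: P_def emeasure_density not_less)
      qed
      have "ennreal (\<tau> + 1 / Suc N) * ennreal e = (\<integral>\<^sup>+x. ennreal (\<tau> + 1 / Suc N) * indicator (E N) x \<partial>lborel)"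
        by (simp add: nn_integral_cmult_indicator e)
      also have "\<dots> \<le> (\<integral>\<^sup>+x. g x * indicator (\<Union>W) x \<partial>lborel)"
        using EW by (intro nn_integral_mono) (auto simp: indicator_def E_def less_imp_le)
      also have "\<dots> = emeasure (density lborel g) (\<Union>Q\<in>W. Q)" by (simp add: emeasure_density)
      also have "\<dots> \<le> ennreal \<tau> * emeasure lborel (\<Union>W)"
        using cW sW Wle by (intro emeasure_UN_le_Union) (auto simp: W_def disjoint_top_cells)
      also have "\<dots> \<le> ennreal \<tau> * ennreal (e + \<epsilon>)"
        using emeasure_mono[OF WU, of lborel] Um by (intro mult_left_mono) auto
      finally have "ennreal ((\<tau> + 1 / Suc N) * e) \<le> ennreal (\<tau> * (e + \<epsilon>))"
        using \<tau> e \<epsilon> by (simp add: ennreal_mult)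
      then have "(\<tau> + 1 / Suc N) * e \<le> \<tau> * (e + \<epsilon>)"
        using \<tau> e \<epsilon> by (subst (asm) ennreal_le_iff) auto
      then have "e / Suc N \<le> \<tau> * \<epsilon>" by (simp add: algebra_simps)
      also have "\<tau> * \<epsilon> = e / Suc N / 2" using \<tau> by (simp add: \<epsilon>_def)
      finally have "e / Suc N \<le> e / Suc N / 2" .
      moreover have "0 < e / Suc N" using e by simp
      moreover have "\<not> (z \<le> z / 2 \<and> 0 < z)" for z :: real by simp
      ultimately show False by blast
    qed
    have "AE x in lborel. \<forall>N. x \<notin> E N"
      unfolding AE_all_countable using null by (auto intro: AE_not_in)
    then show ?thesis
    proof (rule AE_mp, intro AE_I2 impI)
      fix x assume x: "\<forall>N. x \<notin> E N" and xS: "x \<in> S - \<Union>T"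
      have "g x \<le> ennreal (\<tau> + 1 / Suc N)" for N using x xS unfolding E_def by (simp add: not_less)
      moreover have "(\<lambda>N. ennreal (\<tau> + 1 / Suc N)) \<longlonglongrightarrow> ennreal (\<tau> + 0)"
        by (intro tendsto_ennrealI tendsto_add tendsto_const LIMSEQ_Suc lim_1_over_n)
      ultimately show "g x \<le> ennreal \<tau>" by (intro LIMSEQ_le_const[of _ "ennreal \<tau>" "g x"]) auto
    qed
  qed
  show ?thesis
  proof (rule that[OF cT dT])
    show "\<Union>T \<subseteq> S" using TD unfolding P_def by blast
    show "\<And>Q. Q \<in> T \<Longrightarrow> \<exists>k x. Q = ?c k x" using TD by blast
    show "ennreal \<tau> * emeasure lborel Q \<le> (\<integral>\<^sup>+y\<in>Q. g y \<partial>lborel)" if "Q \<in> T" for Q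
      using TD[OF that] unfolding P_def by (auto simp: less_imp_le)
  qed (use upper AE in auto)
qed

text \<open>A witness for membership in \<open>BMO\<close>: the constant subtracted on the ball \<open>ball c r\<close> is \<open>m c r\<close>.\<close>

locale bmo =
  fixes \<beta> :: "'a::euclidean_space \<Rightarrow> real" and m :: "'a \<Rightarrow> real \<Rightarrow> real" and L :: real
  assumes \<beta>_measurable [measurable]: "\<beta> \<in> borel_measurable borel" and L_pos: "0 < L"
    and osc: "\<And>c r. 0 < r \<Longrightarrow> (\<integral>\<^sup>+y\<in>ball c r. ennreal \<bar>\<beta> y - m c r\<bar> \<partial>lborel) \<le> ennreal L * emeasure lborel (ball c r)"
begin

text \<open>The triangle inequality for \<open>s\<close>, \<open>t\<close> and the value of the
  function, averaged over a common set: the device by which the constants of different balls or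
  cells are compared.\<close>

lemma mean_diff_le:
  assumes [measurable]: "A \<in> sets borel" and A: "emeasure lborel A \<noteq> 0" "emeasure lborel A \<noteq> top"
    and x: "0 \<le> x" "(\<integral>\<^sup>+y\<in>A. ennreal \<bar>\<beta> y - s\<bar> \<partial>lborel) \<le> ennreal x * emeasure lborel A"
    and y: "0 \<le> y" "(\<integral>\<^sup>+y\<in>A. ennreal \<bar>\<beta> y - t\<bar> \<partial>lborel) \<le> ennreal y * emeasure lborel A"
  shows "\<bar>s - t\<bar> \<le> x + y"
proof -
  have "ennreal \<bar>s - t\<bar> * emeasure lborel A = (\<integral>\<^sup>+y\<in>A. ennreal \<bar>s - t\<bar> \<partial>lborel)"
    by (simp add: nn_integral_cmult_indicator)
  also have "\<dots> \<le> (\<integral>\<^sup>+y. ennreal \<bar>\<beta> y - s\<bar> * indicator A y + ennreal \<bar>\<beta> y - t\<bar> * indicator A y \<partial>lborel)"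
    by (intro nn_integral_mono) (auto simp: indicator_def ennreal_plus[symmetric] simp del: ennreal_plus)
  also have "\<dots> = (\<integral>\<^sup>+y\<in>A. ennreal \<bar>\<beta> y - s\<bar> \<partial>lborel) + (\<integral>\<^sup>+y\<in>A. ennreal \<bar>\<beta> y - t\<bar> \<partial>lborel)"
    by (rule nn_integral_add) measurable
  also have "\<dots> \<le> ennreal x * emeasure lborel A + ennreal y * emeasure lborel A"
    using x y by (intro add_mono)
  also have "\<dots> = ennreal (x + y) * emeasure lborel A"
    using x y by (simp add: distrib_right)
  finally have "ennreal \<bar>s - t\<bar> \<le> ennreal (x + y)"
    using A by (metis ennreal_mult_le_mult_iff mult.commute)
  then show ?thesis using x y by (subst (asm) ennreal_le_iff) auto
qed

lemma mean_step:
  assumes r: "0 < r"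
  shows "\<bar>m c r - m c (2 * r)\<bar> \<le> L * (1 + 2 ^ DIM('a))"
proof -
  have "\<bar>m c r - m c (2 * r)\<bar> \<le> L + L * 2 ^ DIM('a)"
  proof (rule mean_diff_le[of "ball c r"])
    have "(\<integral>\<^sup>+y\<in>ball c r. ennreal \<bar>\<beta> y - m c (2 * r)\<bar> \<partial>lborel) \<le> (\<integral>\<^sup>+y\<in>ball c (2 * r). ennreal \<bar>\<beta> y - m c (2 * r)\<bar> \<partial>lborel)"
      using r by (intro nn_integral_mono) (auto simp: indicator_def)
    also have "\<dots> \<le> ennreal L * emeasure lborel (ball c (2 * r))" using r by (intro osc) auto
    also have "\<dots> = ennreal (L * 2 ^ DIM('a)) * emeasure lborel (ball c r)"
      using emeasure_lborel_ball_scale[of 2 r c] r L_pos by (simp add: ennreal_mult mult.assoc)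
    finally show "(\<integral>\<^sup>+y\<in>ball c r. ennreal \<bar>\<beta> y - m c (2 * r)\<bar> \<partial>lborel) \<le> ennreal (L * 2 ^ DIM('a)) * emeasure lborel (ball c r)" .
  qed (use r L_pos osc[OF r] emeasure_lborel_ball_pos[OF r, of c] emeasure_lborel_ball_finite[of c r] in auto)
  then show ?thesis by (simp add: algebra_simps)
qed

text \<open>Linear in \<open>k\<close>, hence at most geometric after exponentiation: this is the
  rate that reverse doubling has to beat.\<close>

lemma mean_steps:
  assumes r: "0 < r"
  shows "\<bar>m c r - m c (2 ^ k * r)\<bar> \<le> real k * (L * (1 + 2 ^ DIM('a)))"
proof (induction k)
  case (Suc k)
  have "\<bar>m c (2 ^ k * r) - m c (2 * (2 ^ k * r))\<bar> \<le> L * (1 + 2 ^ DIM('a))"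
    using r by (intro mean_step) simp
  with Suc have "\<bar>m c r - m c (2 * (2 ^ k * r))\<bar> \<le> real k * (L * (1 + 2 ^ DIM('a))) + L * (1 + 2 ^ DIM('a))"
    by linarith
  then show ?case by (simp add: algebra_simps)
qed simp

end

text \<open>The volume of a ball whose radius is the dimension times the side of a cube, relative to
  that cube. By \<open>cell_subset_ball\<close> such a ball around any point of the cube contains
  it.\<close>

definition cell_ratio :: "'a::euclidean_space itself \<Rightarrow> real" where
  "cell_ratio _ = unit_ball_vol (real DIM('a)) * real DIM('a) ^ DIM('a)"

lemma cell_ratio_pos: "0 < cell_ratio TYPE('a::euclidean_space)"
  by (simp add: cell_ratio_def)

lemma emeasure_circumscribed_ball:
  fixes x :: "'a::euclidean_space"
  assumes "0 < h"
  shows "emeasure lborel (ball x (real DIM('a) * (h / 2 ^ k))) = ennreal (cell_ratio TYPE('a)) * emeasure lborel (cell o' h k x)"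
proof -
  define t where "t = h / 2 ^ k"
  have t: "0 \<le> t" using assms by (simp add: t_def)
  then have "emeasure lborel (ball x (real DIM('a) * t)) = ennreal (unit_ball_vol (real DIM('a)) * (real DIM('a) * t) ^ DIM('a))"
    by (intro emeasure_ball) simp
  also have "unit_ball_vol (real DIM('a)) * (real DIM('a) * t) ^ DIM('a) = cell_ratio TYPE('a) * t ^ DIM('a)"
    by (simp add: cell_ratio_def power_mult_distrib)
  also have "ennreal (cell_ratio TYPE('a) * t ^ DIM('a)) = ennreal (cell_ratio TYPE('a)) * ennreal (t ^ DIM('a))"
    using t cell_ratio_pos[where 'a='a] by (intro ennreal_mult) auto
  finally show ?thesis unfolding emeasure_cell[OF assms] t_def[symmetric] .
qed

section \<open>Weighted exponential integrability of the oscillation\<close>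

locale weight_pair_bmo = weight_pair v u a K + bmo \<beta> m L
  for v u :: "'a::euclidean_space \<Rightarrow> real" and a K and \<beta> :: "'a \<Rightarrow> real" and m L
begin

text \<open>The complement of \<open>F\<close> keeps half of the cell, hence a fixed proportion of
  the circumscribed ball. By \<open>compare\<close> it carries at least the fraction
  \<open>1 / D\<close> of the weighted measure, and \<open>F\<close> gets the rest.\<close>

lemma cell_complement_le:
  assumes h: "0 < h" and S: "S = cell o' h k x" and [measurable]: "F \<in> sets borel" and F: "F \<subseteq> S"
    and le: "emeasure lborel F \<le> ennreal (1/2) * emeasure lborel S"
  defines "D \<equiv> max 2 ((K * (2 * cell_ratio TYPE('a))) powr (1 / a))"
  shows "emeasure (wt v) F \<le> ennreal (1 - 1 / D) * emeasure (wt v) S"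
proof -
  let ?R = "cell_ratio TYPE('a)"
  let ?B = "ball x (real DIM('a) * (h / 2 ^ k))"
  have [measurable]: "S \<in> sets borel" unfolding S by simp
  have sub: "S \<subseteq> ?B" unfolding S by (rule cell_subset_ball[OF h])
  have r: "0 < real DIM('a) * (h / 2 ^ k)" using h by simp
  define s where "s = (h / 2 ^ k) ^ DIM('a)"
  have s: "emeasure lborel S = ennreal s" "0 \<le> s"
    unfolding S emeasure_cell[OF h] s_def using h by auto
  have "emeasure lborel F \<le> ennreal (s / 2)"
    using le s by (simp add: ennreal_mult[symmetric] del: ennreal_half)
  then obtain f where f: "emeasure lborel F = ennreal f" "0 \<le> f" "f \<le> s / 2"
    using s by (cases "emeasure lborel F") (auto simp: top_unique)
  have SF: "emeasure lborel (S - F) = ennreal (s - f)"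
    using emeasure_Diff[of lborel F S] F f s by (simp add: ennreal_minus)
  have "emeasure (wt v) ?B \<le> ennreal ((K / (1 / (2 * ?R))) powr (1 / a)) * emeasure (wt v) (S - F)"
  proof (rule compare[OF _ r])
    have "ennreal (1 / (2 * ?R)) * emeasure lborel ?B = ennreal (1 / (2 * ?R) * (?R * s))"
      unfolding emeasure_circumscribed_ball[OF h, of x k o'] S[symmetric] s
      using cell_ratio_pos[where 'a='a] s by (simp add: ennreal_mult[symmetric] less_imp_le)
    also have "1 / (2 * ?R) * (?R * s) = s / 2" using cell_ratio_pos[where 'a='a] by simp
    also have "ennreal (s / 2) \<le> ennreal (s - f)" using f by (intro ennreal_leI) simp
    finally show "ennreal (1 / (2 * ?R)) * emeasure lborel ?B \<le> emeasure lborel (S - F)" unfolding SF .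
  qed (use sub cell_ratio_pos[where 'a='a] in auto)
  also have "\<dots> \<le> ennreal D * emeasure (wt v) (S - F)"
    by (intro mult_right_mono ennreal_leI) (auto simp: D_def)
  finally have "emeasure (wt v) S \<le> ennreal D * emeasure (wt v) (S - F)"
    using emeasure_mono[OF sub, of "wt v"] by simp
  moreover
  have "emeasure (wt v) S < top"
    using emeasure_mono[OF sub, of "wt v"] ball_finite by (simp add: order_le_less_trans)
  then obtain ms where ms: "emeasure (wt v) S = ennreal ms" "0 \<le> ms" by (cases "emeasure (wt v) S") auto
  moreover
  have "emeasure (wt v) F \<le> emeasure (wt v) S" using F by (intro emeasure_mono) auto
  then obtain mf where mf: "emeasure (wt v) F = ennreal mf" "0 \<le> mf" "mf \<le> ms"
    using ms by (cases "emeasure (wt v) F") (auto simp: top_unique)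
  moreover have "emeasure (wt v) (S - F) = ennreal (ms - mf)"
    using emeasure_Diff[of "wt v" F S] F ms mf by (simp add: ennreal_minus)
  ultimately have "ms \<le> D * (ms - mf)"
    by (simp add: ennreal_mult[symmetric] D_def)
  then have "mf \<le> (1 - 1 / D) * ms" by (simp add: D_def field_simps)
  moreover have "0 \<le> 1 - 1 / D" by (simp add: D_def)
  ultimately show ?thesis using ms mf by (simp add: ennreal_mult[symmetric] ennreal_leI)
qed

lemma cell_osc:
  assumes h: "0 < h" and S: "S = cell o' h k x"
  shows "\<exists>c. (\<integral>\<^sup>+y\<in>S. ennreal \<bar>\<beta> y - c\<bar> \<partial>lborel) \<le> ennreal (L * cell_ratio TYPE('a)) * emeasure lborel S"
proof
  let ?r = "real DIM('a) * (h / 2 ^ k)"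
  have "(\<integral>\<^sup>+y\<in>S. ennreal \<bar>\<beta> y - m x ?r\<bar> \<partial>lborel) \<le> (\<integral>\<^sup>+y\<in>ball x ?r. ennreal \<bar>\<beta> y - m x ?r\<bar> \<partial>lborel)"
    using cell_subset_ball[OF h, of o' k x] unfolding S by (intro nn_integral_mono) (auto simp: indicator_def)
  also have "\<dots> \<le> ennreal L * emeasure lborel (ball x ?r)" using h by (intro osc) simp
  also have "\<dots> = ennreal (L * cell_ratio TYPE('a)) * emeasure lborel S"
    unfolding emeasure_circumscribed_ball[OF h, of x k o'] S[symmetric] using L_pos cell_ratio_pos[where 'a='a]
    by (simp add: ennreal_mult mult.assoc)
  finally show "(\<integral>\<^sup>+y\<in>S. ennreal \<bar>\<beta> y - m x ?r\<bar> \<partial>lborel) \<le> ennreal (L * cell_ratio TYPE('a)) * emeasure lborel S" .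
qed

text \<open>\<open>osc_const\<close> bounds the mean oscillation over every cell;
  \<open>osc_step\<close> bounds the change of the subtracted constant from a cell to a stopping
  cell, where the height is \<open>2 * osc_const\<close> and the parent contributes
  \<open>2 ^ n\<close>; \<open>decay\<close> is the factor of
  \<open>cell_complement_le\<close>.\<close>

definition "osc_const = L * cell_ratio TYPE('a)"
definition "osc_step = osc_const * (2 ^ DIM('a) * 2 + 1)"
definition "decay = 1 - 1 / max 2 ((K * (2 * cell_ratio TYPE('a))) powr (1 / a))"

lemma osc_const_pos: "0 < osc_const"
  using L_pos cell_ratio_pos[where 'a='a] by (simp add: osc_const_def)

lemma osc_step_pos: "0 < osc_step"
  using osc_const_pos unfolding osc_step_def by (intro mult_pos_pos) (auto intro: add_nonneg_pos)

lemma decay: "0 < decay" "decay < 1"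
  by (auto simp: decay_def field_simps)

text \<open>Stopping cells are selected by Lebesgue averages of the deviation but measured with
  \<open>v\<close>: their union has at most half the Lebesgue measure of \<open>S\<close>, and
  \<open>cell_complement_le\<close> turns this into the factor \<open>decay\<close>. The induction
  continues inside each stopping cell with that cell's own constant.\<close>

lemma cell_decay:
  assumes h: "0 < h" and S: "S = cell o' h k x"
    and c: "(\<integral>\<^sup>+y\<in>S. ennreal \<bar>\<beta> y - c\<bar> \<partial>lborel) \<le> ennreal osc_const * emeasure lborel S"
  shows "emeasure (wt v) {y \<in> S. real n * osc_step < \<bar>\<beta> y - c\<bar>} \<le> ennreal (decay ^ n) * emeasure (wt v) S"
  using S c
proof (induction n arbitrary: S k x c)
  case 0
  have [measurable]: "S \<in> sets borel" unfolding 0 by simp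
  show ?case by (auto intro!: emeasure_mono)
next
  case (Suc n)
  have [measurable]: "S \<in> sets borel" unfolding Suc by simp
  define g where "g y = ennreal \<bar>\<beta> y - c\<bar>" for y
  have [measurable]: "g \<in> borel_measurable borel" unfolding g_def by measurable
  have "(\<integral>\<^sup>+y\<in>S. g y \<partial>lborel) \<le> ennreal (2 * osc_const) * emeasure lborel S"
    unfolding g_def using Suc.prems(2) osc_const_pos
    by (rule_tac order_trans[OF _ mult_right_mono]) (auto intro: ennreal_leI)
  then obtain T where T: "countable T" "disjoint T" "\<Union>T \<subseteq> S"
    and Tcell: "\<And>Q. Q \<in> T \<Longrightarrow> \<exists>k x. Q = cell o' h k x"
    and Tlow: "\<And>Q. Q \<in> T \<Longrightarrow> ennreal (2 * osc_const) * emeasure lborel Q \<le> (\<integral>\<^sup>+y\<in>Q. g y \<partial>lborel)"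
    and Tup: "\<And>Q. Q \<in> T \<Longrightarrow> (\<integral>\<^sup>+y\<in>Q. g y \<partial>lborel) \<le> ennreal (2 ^ DIM('a) * (2 * osc_const)) * emeasure lborel Q"
    and off: "AE x in lborel. x \<in> S - \<Union>T \<longrightarrow> g x \<le> ennreal (2 * osc_const)"
    using calderon_zygmund[OF h _ _ Suc.prems(1), of g "2 * osc_const"] osc_const_pos by auto
  have sT: "Q \<in> T \<Longrightarrow> Q \<in> sets borel" for Q using Tcell by force
  have [measurable]: "\<Union>T \<in> sets borel" using T(1) sT by (intro sets.countable_Union) auto
  \<comment> \<open>Stopping at twice the mean oscillation leaves the stopping cells at most half of
    \<open>S\<close>.\<close>
  have half: "emeasure lborel (\<Union>T) \<le> ennreal (1/2) * emeasure lborel S"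
  proof -
    have "emeasure lborel (\<Union>Q\<in>T. Q) \<le> ennreal (1 / (2 * osc_const)) * emeasure (density lborel g) (\<Union>T)"
    proof (rule emeasure_UN_le_Union[OF T(1,2)])
      fix Q assume Q: "Q \<in> T"
      have "ennreal (1 / (2 * osc_const)) * (ennreal (2 * osc_const) * emeasure lborel Q) \<le> ennreal (1 / (2 * osc_const)) * (\<integral>\<^sup>+y\<in>Q. g y \<partial>lborel)"
        by (intro mult_left_mono Tlow Q) simp
      then show "emeasure lborel Q \<le> ennreal (1 / (2 * osc_const)) * emeasure (density lborel g) Q"
        using osc_const_pos sT[OF Q] by (simp add: emeasure_density mult.assoc[symmetric] ennreal_mult[symmetric])
    qed (use sT in auto)
    also have "emeasure (density lborel g) (\<Union>T) \<le> emeasure (density lborel g) S"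
      using T(3) by (intro emeasure_mono) auto
    also have "\<dots> = (\<integral>\<^sup>+y\<in>S. g y \<partial>lborel)" by (simp add: emeasure_density)
    also have "\<dots> \<le> ennreal osc_const * emeasure lborel S" unfolding g_def by (rule Suc.prems)
    also have "ennreal (1 / (2 * osc_const)) * (ennreal osc_const * emeasure lborel S) = ennreal (1/2) * emeasure lborel S"
      using osc_const_pos by (simp add: mult.assoc[symmetric] ennreal_mult[symmetric] del: ennreal_half)
    finally show ?thesis by (simp add: mult_left_mono)
  qed
  have "\<forall>Q\<in>T. \<exists>d. (\<integral>\<^sup>+y\<in>Q. ennreal \<bar>\<beta> y - d\<bar> \<partial>lborel) \<le> ennreal osc_const * emeasure lborel Q"
    using Tcell cell_osc[OF h] unfolding osc_const_def by blast
  then obtain d where d: "\<And>Q. Q \<in> T \<Longrightarrow> (\<integral>\<^sup>+y\<in>Q. ennreal \<bar>\<beta> y - d Q\<bar> \<partial>lborel) \<le> ennreal osc_const * emeasure lborel Q"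
    by metis
  define A where "A Q = {y \<in> Q. real n * osc_step < \<bar>\<beta> y - d Q\<bar>}" for Q
  have A_sets: "A Q \<in> sets borel" if "Q \<in> T" for Q
    using sT[OF that] unfolding A_def by measurable
  \<comment> \<open>The constants of \<open>Q\<close> and of \<open>S\<close> are compared on
    \<open>Q\<close>; \<open>osc_step\<close> is the bound that results.\<close>
  have close: "\<bar>d Q - c\<bar> \<le> osc_step" if Q: "Q \<in> T" for Q
  proof -
    obtain k x where kx: "Q = cell o' h k x" using Tcell[OF Q] by blast
    have "\<bar>d Q - c\<bar> \<le> osc_const + 2 ^ DIM('a) * (2 * osc_const)"
    proof (rule mean_diff_le[of Q])
      show "(\<integral>\<^sup>+y\<in>Q. ennreal \<bar>\<beta> y - c\<bar> \<partial>lborel) \<le> ennreal (2 ^ DIM('a) * (2 * osc_const)) * emeasure lborel Q"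
        using Tup[OF Q] unfolding g_def .
    qed (use d[OF Q] sT[OF Q] osc_const_pos h in \<open>auto simp: kx emeasure_cell\<close>)
    then show ?thesis unfolding osc_step_def by (simp add: algebra_simps)
  qed
  have step_ge: "2 * osc_const \<le> osc_step"
  proof -
    have "(1::real) \<le> 2 ^ DIM('a)" by (rule one_le_power) simp
    then have "2 \<le> 2 ^ DIM('a) * 2 + (1::real)" by linarith
    then have "osc_const * 2 \<le> osc_const * (2 ^ DIM('a) * 2 + 1)"
      using osc_const_pos by (rule mult_left_mono[OF _ less_imp_le])
    then show ?thesis by (simp add: osc_step_def)
  qed
  \<comment> \<open>Off the stopping cells the deviation is at most one step. Inside
    \<open>Q\<close> one step is spent on replacing \<open>c\<close> by \<open>d Q\<close>, and
    \<open>n\<close> steps remain.\<close>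
  have "AE y in lborel. y \<in> {y \<in> S. real (Suc n) * osc_step < \<bar>\<beta> y - c\<bar>} \<longrightarrow> y \<in> (\<Union>Q\<in>T. A Q)"
    using off
  proof (rule AE_mp, intro AE_I2 impI)
    fix y assume 1: "y \<in> S - \<Union>T \<longrightarrow> g y \<le> ennreal (2 * osc_const)" and 2: "y \<in> {y \<in> S. real (Suc n) * osc_step < \<bar>\<beta> y - c\<bar>}"
    have ge: "osc_step \<le> real (Suc n) * osc_step" using osc_step_pos by (simp add: algebra_simps)
    have "y \<in> \<Union>T"
    proof (rule ccontr)
      assume "y \<notin> \<Union>T"
      then have "\<bar>\<beta> y - c\<bar> \<le> 2 * osc_const" using 1 2 osc_const_pos unfolding g_def by (simp add: ennreal_le_iff)
      then show False using 2 ge step_ge by auto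
    qed
    then obtain Q where Q: "Q \<in> T" "y \<in> Q" by blast
    have "real (Suc n) * osc_step < \<bar>\<beta> y - d Q\<bar> + osc_step"
      using 2 close[OF Q(1)] by auto
    then have "y \<in> A Q" using Q by (simp add: A_def algebra_simps)
    then show "y \<in> (\<Union>Q\<in>T. A Q)" using Q by blast
  qed
  then have "emeasure (wt v) {y \<in> S. real (Suc n) * osc_step < \<bar>\<beta> y - c\<bar>} \<le> emeasure (wt v) (\<Union>Q\<in>T. A Q)"
    using T(1) A_sets unfolding wt_def
    by (intro emeasure_mono_AE) (auto simp: AE_density elim!: AE_mp intro!: sets.countable_UN')
  also have "\<dots> \<le> ennreal (decay ^ n) * emeasure (wt v) (\<Union>T)"
  proof (rule emeasure_UN_le_Union[OF T(1,2)])
    fix Q assume Q: "Q \<in> T"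
    then obtain k x where "Q = cell o' h k x" using Tcell by blast
    then show "emeasure (wt v) (A Q) \<le> ennreal (decay ^ n) * emeasure (wt v) Q"
      unfolding A_def using d[OF Q] by (rule Suc.IH)
  qed (use sT A_sets in auto)
  also have "\<dots> \<le> ennreal (decay ^ n) * (ennreal decay * emeasure (wt v) S)"
    unfolding decay_def
    by (intro mult_left_mono cell_complement_le[OF h Suc.prems(1) _ T(3) half]) auto
  finally show ?case using decay by (simp add: ennreal_mult mult_ac)
qed

lemma john_nirenberg_cell:
  obtains \<gamma> C where "0 < \<gamma>" "0 < C"
    "\<And>o' h k x c. 0 < h \<Longrightarrow>
      (\<integral>\<^sup>+y\<in>cell o' h k x. ennreal \<bar>\<beta> y - c\<bar> \<partial>lborel) \<le> ennreal osc_const * emeasure lborel (cell o' h k x) \<Longrightarrow>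
      (\<integral>\<^sup>+y\<in>cell o' h k x. ennreal (exp (\<gamma> * \<bar>\<beta> y - c\<bar>)) \<partial>wt v) \<le> ennreal C * emeasure (wt v) (cell o' h k x)"
proof -
  \<comment> \<open>\<open>\<theta>\<close> is the square root of \<open>decay\<close>, and
    \<open>\<gamma>\<close> is chosen so that one step of the exponential costs
    \<open>1 / \<theta>\<close>. Growth times decay after \<open>n\<close> steps is then a multiple
    of \<open>\<theta> ^ n\<close>, a geometric series with sum \<open>C\<close>.\<close>
  define \<theta> where "\<theta> = exp (ln decay / 2)"
  define \<gamma> where "\<gamma> = - ln decay / (2 * osc_step)"
  define C where "C = 1 / \<theta> * (1 / (1 - \<theta>))"
  have \<theta>: "0 < \<theta>" "\<theta> < 1" "\<theta> * \<theta> = decay"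
    using decay by (auto simp: \<theta>_def exp_add[symmetric])
  have "ln decay < 0" using decay by (simp add: ln_less_zero)
  then have \<gamma>: "0 < \<gamma>" using osc_step_pos unfolding \<gamma>_def by (intro divide_pos_pos) auto
  have e: "exp (\<gamma> * osc_step) = 1 / \<theta>"
    using osc_step_pos by (simp add: \<gamma>_def \<theta>_def exp_minus inverse_eq_divide)
  have e_pow: "exp (\<gamma> * (real (Suc n) * osc_step)) = (1 / \<theta>) ^ Suc n" for n
    unfolding e[symmetric] exp_of_nat_mult[symmetric] by (simp add: mult_ac)
  have coeff: "exp (\<gamma> * (real (Suc n) * osc_step)) * decay ^ n = 1 / \<theta> * \<theta> ^ n" for n
    unfolding e_pow \<theta>(3)[symmetric] using \<theta>(1) by (simp add: power_mult_distrib power_divide)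
  have "0 < C" using \<theta> by (simp add: C_def)
  moreover have "(\<integral>\<^sup>+y\<in>cell o' h k x. ennreal (exp (\<gamma> * \<bar>\<beta> y - c\<bar>)) \<partial>wt v) \<le> ennreal C * emeasure (wt v) (cell o' h k x)"
    if h: "0 < h" and c: "(\<integral>\<^sup>+y\<in>cell o' h k x. ennreal \<bar>\<beta> y - c\<bar> \<partial>lborel) \<le> ennreal osc_const * emeasure lborel (cell o' h k x)"
    for o' h k x c
  proof -
    define S where "S = cell o' h k x"
    have [measurable]: "S \<in> sets borel" unfolding S_def by simp
    \<comment> \<open>Level 0 is all of \<open>S\<close>, so that points with zero deviation are
      covered as well.\<close>
    define A where "A n = (if n = 0 then S else {y \<in> S. real n * osc_step < \<bar>\<beta> y - c\<bar>})" for n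
    have "{y \<in> S. t < \<bar>\<beta> y - c\<bar>} \<in> sets borel" for t by measurable
    then have [measurable]: "A n \<in> sets borel" for n by (simp add: A_def)
    have A_le: "emeasure (wt v) (A n) \<le> ennreal (decay ^ n) * emeasure (wt v) S" for n
      using cell_decay[OF h S_def c[folded S_def], of n] by (simp add: A_def)
    have le_suminf: "f n \<le> suminf f" for f :: "nat \<Rightarrow> ennreal" and n
      using sum_le_suminf[of f "{n}"] by simp
    have point: "ennreal (exp (\<gamma> * \<bar>\<beta> y - c\<bar>)) * indicator S y
       \<le> (\<Sum>n. ennreal (exp (\<gamma> * (real (Suc n) * osc_step))) * indicator (A n) y)" for y
    proof (cases "y \<in> S")
      case True
      \<comment> \<open>The deviation lies between \<open>n\<close> and \<open>n + 1\<close> steps,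
        the upper end included; \<open>nat\<close> sends a zero deviation to
        \<open>n = 0\<close>.\<close>
      define n where "n = nat (\<lceil>\<bar>\<beta> y - c\<bar> / osc_step\<rceil> - 1)"
      have "\<bar>\<beta> y - c\<bar> / osc_step \<le> real (Suc n)" unfolding n_def by linarith
      then have up: "\<bar>\<beta> y - c\<bar> \<le> real (Suc n) * osc_step"
        using osc_step_pos by (simp add: pos_divide_le_eq)
      have "y \<in> A n"
      proof (cases "n = 0")
        case False
        then have "real n < \<bar>\<beta> y - c\<bar> / osc_step" unfolding n_def by linarith
        then show ?thesis using osc_step_pos True False by (simp add: A_def pos_less_divide_eq)
      qed (use True in \<open>simp add: A_def\<close>)
      have "ennreal (exp (\<gamma> * \<bar>\<beta> y - c\<bar>)) * indicator S y \<le> ennreal (exp (\<gamma> * (real (Suc n) * osc_step))) * indicator (A n) y"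
        using True \<open>y \<in> A n\<close> up \<gamma> by (auto intro!: ennreal_leI mult_left_mono)
      also have "\<dots> \<le> (\<Sum>n. ennreal (exp (\<gamma> * (real (Suc n) * osc_step))) * indicator (A n) y)"
        by (rule le_suminf)
      finally show ?thesis .
    qed simp
    have "(\<integral>\<^sup>+y\<in>S. ennreal (exp (\<gamma> * \<bar>\<beta> y - c\<bar>)) \<partial>wt v)
       \<le> (\<integral>\<^sup>+y. (\<Sum>n. ennreal (exp (\<gamma> * (real (Suc n) * osc_step))) * indicator (A n) y) \<partial>wt v)"
      by (rule nn_integral_mono) (rule point)
    also have "\<dots> = (\<Sum>n. \<integral>\<^sup>+y. ennreal (exp (\<gamma> * (real (Suc n) * osc_step))) * indicator (A n) y \<partial>wt v)"
      by (rule nn_integral_suminf) measurable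
    also have "\<dots> = (\<Sum>n. ennreal (exp (\<gamma> * (real (Suc n) * osc_step))) * emeasure (wt v) (A n))"
      by (simp add: nn_integral_cmult_indicator)
    also have "\<dots> \<le> (\<Sum>n. ennreal (1 / \<theta> * \<theta> ^ n) * emeasure (wt v) S)"
    proof (rule suminf_le)
      fix n
      have "ennreal (exp (\<gamma> * (real (Suc n) * osc_step))) * emeasure (wt v) (A n)
        \<le> ennreal (exp (\<gamma> * (real (Suc n) * osc_step))) * (ennreal (decay ^ n) * emeasure (wt v) S)"
        by (intro mult_left_mono A_le) simp
      also have "\<dots> = ennreal (1 / \<theta> * \<theta> ^ n) * emeasure (wt v) S"
        unfolding coeff[symmetric] using decay by (subst ennreal_mult) (auto simp: mult.assoc)
      finally show "ennreal (exp (\<gamma> * (real (Suc n) * osc_step))) * emeasure (wt v) (A n) \<le> ennreal (1 / \<theta> * \<theta> ^ n) * emeasure (wt v) S" .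
    qed auto
    also have "\<dots> = (\<Sum>n. ennreal (1 / \<theta> * \<theta> ^ n)) * emeasure (wt v) S" by (rule ennreal_suminf_multc)
    also have "(\<Sum>n. ennreal (1 / \<theta> * \<theta> ^ n)) = ennreal C"
    proof -
      have "(\<lambda>n. 1 / \<theta> * \<theta> ^ n) sums C"
        unfolding C_def using \<theta> by (intro sums_mult geometric_sums) simp
      then show ?thesis using \<theta> by (intro suminf_ennreal_eq) auto
    qed
    finally show ?thesis unfolding S_def .
  qed
  ultimately show ?thesis using \<gamma> that[of \<gamma> C] by blast
qed

text \<open>The ball is enclosed in a cube, the estimate for the cube is applied with the cube's own
  constant, and doubling compares the measures. Replacing that constant by \<open>m c r\<close>
  costs only a fixed factor.\<close>

lemma john_nirenberg:
  obtains \<gamma> C where "0 < \<gamma>" "0 < C"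
    "\<And>c r. 0 < r \<Longrightarrow> (\<integral>\<^sup>+y\<in>ball c r. ennreal (exp (\<gamma> * \<bar>\<beta> y - m c r\<bar>)) \<partial>wt v) \<le> ennreal C * emeasure (wt v) (ball c r)"
proof -
  obtain \<gamma> C where \<gamma>: "0 < \<gamma>" "0 < C" and
    JN: "\<And>o' h k x c. 0 < h \<Longrightarrow>
      (\<integral>\<^sup>+y\<in>cell o' h k x. ennreal \<bar>\<beta> y - c\<bar> \<partial>lborel) \<le> ennreal osc_const * emeasure lborel (cell o' h k x) \<Longrightarrow>
      (\<integral>\<^sup>+y\<in>cell o' h k x. ennreal (exp (\<gamma> * \<bar>\<beta> y - c\<bar>)) \<partial>wt v) \<le> ennreal C * emeasure (wt v) (cell o' h k x)"
    by (rule john_nirenberg_cell) blast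
  \<comment> \<open>\<open>R\<close> is the volume of a cube of side \<open>2 * r\<close> relative
    to a ball of radius \<open>r\<close>, and \<open>X\<close> bounds the distance between the
    constants of the ball and of the cube.\<close>
  define R where "R = 2 ^ DIM('a) / unit_ball_vol (real DIM('a))"
  have R: "0 < R" by (simp add: R_def)
  define X where "X = L + osc_const * R"
  define D where "D = (K * (2 * real DIM('a)) ^ DIM('a)) powr (1 / a)"
  have D: "0 < D" using K_pos by (simp add: D_def)
  have "(\<integral>\<^sup>+y\<in>ball c r. ennreal (exp (\<gamma> * \<bar>\<beta> y - m c r\<bar>)) \<partial>wt v) \<le> ennreal (exp (\<gamma> * X) * C * D) * emeasure (wt v) (ball c r)"
    if r: "0 < r" for c r
  proof -
    \<comment> \<open>With the grid based at the lower corner and side \<open>2 * r\<close>, the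
      cell of generation 0 around \<open>c\<close> is the cube circumscribed about the ball.\<close>
    define S where "S = cell (c - r *\<^sub>R One) (2 * r) 0 c"
    have [measurable]: "S \<in> sets borel" unfolding S_def by simp
    have BS: "ball c r \<subseteq> S"
    proof
      fix y assume "y \<in> ball c r"
      then have d: "norm (y - c) < r" by (simp add: dist_norm norm_minus_commute)
      show "y \<in> S"
        unfolding S_def cell_def mem_Collect_eq
      proof
        fix i :: 'a assume i: "i \<in> Basis"
        have "\<bar>(y - c) \<bullet> i\<bar> < r" using Basis_le_norm[OF i, of "y - c"] d by linarith
        then have 1: "- r < y \<bullet> i - c \<bullet> i" "y \<bullet> i - c \<bullet> i < r" by (auto simp: inner_diff_left)
        have "\<lfloor>(y \<bullet> i - (c \<bullet> i - r)) / (2 * r)\<rfloor> = 0" "\<lfloor>(c \<bullet> i - (c \<bullet> i - r)) / (2 * r)\<rfloor> = 0"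
          using 1 r by (auto simp: floor_eq_iff)
        then show "\<lfloor>2 ^ 0 * ((y - (c - r *\<^sub>R One)) \<bullet> i) / (2 * r)\<rfloor> = \<lfloor>2 ^ 0 * ((c - (c - r *\<^sub>R One)) \<bullet> i) / (2 * r)\<rfloor>"
          using i by (simp add: inner_diff_left inner_add_left)
      qed
    qed
    have SB: "S \<subseteq> ball c (2 * real DIM('a) * r)"
      using cell_subset_ball[of "2 * r" "c - r *\<^sub>R One" 0 c] r by (simp add: S_def mult_ac)
    have SR: "emeasure lborel S = ennreal R * emeasure lborel (ball c r)"
      using r less_imp_neq[OF unit_ball_vol_pos[of "real DIM('a)"]]
      by (simp add: S_def emeasure_cell emeasure_ball R_def ennreal_mult[symmetric] power_mult_distrib)
    obtain d where d: "(\<integral>\<^sup>+y\<in>S. ennreal \<bar>\<beta> y - d\<bar> \<partial>lborel) \<le> ennreal osc_const * emeasure lborel S"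
      using cell_osc[OF _ S_def] r unfolding osc_const_def by auto
    have "\<bar>m c r - d\<bar> \<le> L + osc_const * R"
    proof (rule mean_diff_le[of "ball c r"])
      have "(\<integral>\<^sup>+y\<in>ball c r. ennreal \<bar>\<beta> y - d\<bar> \<partial>lborel) \<le> (\<integral>\<^sup>+y\<in>S. ennreal \<bar>\<beta> y - d\<bar> \<partial>lborel)"
        using BS by (intro nn_integral_mono) (auto simp: indicator_def)
      also note d
      also have "ennreal osc_const * emeasure lborel S = ennreal (osc_const * R) * emeasure lborel (ball c r)"
        unfolding SR using osc_const_pos R by (simp add: ennreal_mult mult.assoc)
      finally show "(\<integral>\<^sup>+y\<in>ball c r. ennreal \<bar>\<beta> y - d\<bar> \<partial>lborel) \<le> ennreal (osc_const * R) * emeasure lborel (ball c r)" .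
    qed (use r L_pos osc_const_pos R osc[OF r, of c] emeasure_lborel_ball_pos[OF r, of c] emeasure_lborel_ball_finite[of c r] in auto)
    then have X: "\<bar>m c r - d\<bar> \<le> X" by (simp add: X_def)
    have "exp (\<gamma> * \<bar>\<beta> y - m c r\<bar>) \<le> exp (\<gamma> * X) * exp (\<gamma> * \<bar>\<beta> y - d\<bar>)" for y
    proof -
      have "\<bar>\<beta> y - m c r\<bar> \<le> X + \<bar>\<beta> y - d\<bar>" using X by linarith
      then have "\<gamma> * \<bar>\<beta> y - m c r\<bar> \<le> \<gamma> * (X + \<bar>\<beta> y - d\<bar>)" using \<gamma> by (intro mult_left_mono) auto
      then show ?thesis by (simp add: exp_add[symmetric] distrib_left)
    qed
    then have "(\<integral>\<^sup>+y\<in>ball c r. ennreal (exp (\<gamma> * \<bar>\<beta> y - m c r\<bar>)) \<partial>wt v)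
       \<le> (\<integral>\<^sup>+y. ennreal (exp (\<gamma> * X)) * (ennreal (exp (\<gamma> * \<bar>\<beta> y - d\<bar>)) * indicator S y) \<partial>wt v)"
      using BS by (intro nn_integral_mono) (auto simp: indicator_def ennreal_mult[symmetric] intro!: ennreal_leI)
    also have "\<dots> = ennreal (exp (\<gamma> * X)) * (\<integral>\<^sup>+y\<in>S. ennreal (exp (\<gamma> * \<bar>\<beta> y - d\<bar>)) \<partial>wt v)"
      by (rule nn_integral_cmult) measurable
    also have "\<dots> \<le> ennreal (exp (\<gamma> * X)) * (ennreal C * emeasure (wt v) S)"
      using d r unfolding S_def by (intro mult_left_mono JN) auto
    also have "emeasure (wt v) S \<le> emeasure (wt v) (ball c (2 * real DIM('a) * r))"
      by (rule emeasure_mono[OF SB]) simp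
    also have "\<dots> \<le> ennreal D * emeasure (wt v) (ball c r)"
    proof -
      have "1 \<le> real DIM('a)" using DIM_ge_Suc0[where 'a='a] by simp
      then have "1 \<le> 2 * real DIM('a)" by linarith
      then show ?thesis unfolding D_def by (rule enlarge[OF r])
    qed
    finally show ?thesis using \<gamma> D by (simp add: ennreal_mult mult.assoc mult_left_mono)
  qed
  moreover have "0 < exp (\<gamma> * X) * C * D" using \<gamma> D by simp
  ultimately show ?thesis using \<gamma>(1) that by blast
qed

end

section \<open>Exponential perturbation of weight pairs\<close>

context weight_pair_bmo
begin

text \<open>By \<open>swap\<close> the dual weight satisfies the same hypotheses, so both weights
  have such a bound; the smaller exponent and the larger constant serve both, for either sign of
  \<open>s\<close>.\<close>

lemma exp_osc:
  obtains \<gamma> C where "0 < \<gamma>" "0 < C"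
    "\<And>s c r. \<bar>s\<bar> \<le> \<gamma> \<Longrightarrow> 0 < r \<Longrightarrow>
      (\<integral>\<^sup>+y\<in>ball c r. ennreal (exp (s * (\<beta> y - m c r))) \<partial>wt v) \<le> ennreal C * emeasure (wt v) (ball c r)"
    "\<And>s c r. \<bar>s\<bar> \<le> \<gamma> \<Longrightarrow> 0 < r \<Longrightarrow>
      (\<integral>\<^sup>+y\<in>ball c r. ennreal (exp (s * (\<beta> y - m c r))) \<partial>wt u) \<le> ennreal C * emeasure (wt u) (ball c r)"
proof -
  interpret dual: weight_pair u v "1 - a" K by (rule swap)
  interpret dual: weight_pair_bmo u v "1 - a" K \<beta> m L ..
  obtain \<gamma>1 C1 where 1: "0 < \<gamma>1" "0 < C1"
    "\<And>c r. 0 < r \<Longrightarrow> (\<integral>\<^sup>+y\<in>ball c r. ennreal (exp (\<gamma>1 * \<bar>\<beta> y - m c r\<bar>)) \<partial>wt v) \<le> ennreal C1 * emeasure (wt v) (ball c r)"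
    by (rule john_nirenberg) blast
  obtain \<gamma>2 C2 where 2: "0 < \<gamma>2" "0 < C2"
    "\<And>c r. 0 < r \<Longrightarrow> (\<integral>\<^sup>+y\<in>ball c r. ennreal (exp (\<gamma>2 * \<bar>\<beta> y - m c r\<bar>)) \<partial>wt u) \<le> ennreal C2 * emeasure (wt u) (ball c r)"
    by (rule dual.john_nirenberg) blast
  define \<gamma> C where "\<gamma> = min \<gamma>1 \<gamma>2" and "C = max C1 C2"
  have *: "exp (s * z) \<le> exp (g * \<bar>z\<bar>)" if "\<bar>s\<bar> \<le> \<gamma>" "\<gamma> \<le> g" for s z g :: real
  proof -
    have "s * z \<le> \<bar>s\<bar> * \<bar>z\<bar>" by (metis abs_ge_self abs_mult)
    also have "\<dots> \<le> g * \<bar>z\<bar>" using that by (intro mult_right_mono) auto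
    finally show ?thesis by simp
  qed
  show ?thesis
  proof (rule that[of \<gamma> C])
    fix s c r assume s: "\<bar>s\<bar> \<le> \<gamma>" and r: "0 < (r::real)"
    have "(\<integral>\<^sup>+y\<in>ball c r. ennreal (exp (s * (\<beta> y - m c r))) \<partial>wt v) \<le> (\<integral>\<^sup>+y\<in>ball c r. ennreal (exp (\<gamma>1 * \<bar>\<beta> y - m c r\<bar>)) \<partial>wt v)"
      using *[OF s, of \<gamma>1] by (intro nn_integral_mono mult_right_mono ennreal_leI) (auto simp: \<gamma>_def)
    also have "\<dots> \<le> ennreal C1 * emeasure (wt v) (ball c r)" by (rule 1(3)[OF r])
    also have "\<dots> \<le> ennreal C * emeasure (wt v) (ball c r)" by (intro mult_right_mono ennreal_leI) (auto simp: C_def)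
    finally show "(\<integral>\<^sup>+y\<in>ball c r. ennreal (exp (s * (\<beta> y - m c r))) \<partial>wt v) \<le> ennreal C * emeasure (wt v) (ball c r)" .
    have "(\<integral>\<^sup>+y\<in>ball c r. ennreal (exp (s * (\<beta> y - m c r))) \<partial>wt u) \<le> (\<integral>\<^sup>+y\<in>ball c r. ennreal (exp (\<gamma>2 * \<bar>\<beta> y - m c r\<bar>)) \<partial>wt u)"
      using *[OF s, of \<gamma>2] by (intro nn_integral_mono mult_right_mono ennreal_leI) (auto simp: \<gamma>_def)
    also have "\<dots> \<le> ennreal C2 * emeasure (wt u) (ball c r)" by (rule 2(3)[OF r])
    also have "\<dots> \<le> ennreal C * emeasure (wt u) (ball c r)" by (intro mult_right_mono ennreal_leI) (auto simp: C_def)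
    finally show "(\<integral>\<^sup>+y\<in>ball c r. ennreal (exp (s * (\<beta> y - m c r))) \<partial>wt u) \<le> ennreal C * emeasure (wt u) (ball c r)" .
  qed (use 1 2 in \<open>auto simp: \<gamma>_def C_def\<close>)
qed

lemma exp_weight_eq:
  assumes [measurable]: "w \<in> borel_measurable borel" and w: "\<And>x. 0 \<le> w x"
    and [measurable]: "A \<in> sets borel"
  shows "(\<integral>\<^sup>+y\<in>A. ennreal (exp (s * \<beta> y)) \<partial>wt w) = ennreal (exp (s * d)) * (\<integral>\<^sup>+y\<in>A. ennreal (exp (s * (\<beta> y - d))) \<partial>wt w)"
proof -
  have "(\<integral>\<^sup>+y\<in>A. ennreal (exp (s * \<beta> y)) \<partial>wt w) = (\<integral>\<^sup>+y. ennreal (exp (s * d)) * (ennreal (exp (s * (\<beta> y - d))) * indicator A y) \<partial>wt w)"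
    by (intro nn_integral_cong) (simp add: mult.assoc[symmetric] ennreal_mult[symmetric] exp_add[symmetric] algebra_simps)
  also have "\<dots> = ennreal (exp (s * d)) * (\<integral>\<^sup>+y\<in>A. ennreal (exp (s * (\<beta> y - d))) \<partial>wt w)"
    by (rule nn_integral_cmult) measurable
  finally show ?thesis .
qed

lemma emeasure_exp_weight:
  assumes [measurable]: "w \<in> borel_measurable borel" "A \<in> sets borel" and w: "\<And>x. 0 \<le> w x"
  shows "emeasure (wt (\<lambda>x. exp (s * \<beta> x) * w x)) A = (\<integral>\<^sup>+y\<in>A. ennreal (exp (s * \<beta> y)) \<partial>wt w)"
proof -
  have "(\<integral>\<^sup>+y\<in>A. ennreal (exp (s * \<beta> y)) \<partial>wt w) = (\<integral>\<^sup>+y. ennreal (w y) * (ennreal (exp (s * \<beta> y)) * indicator A y) \<partial>lborel)"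
    by (rule nn_integral_wt) measurable
  also have "\<dots> = emeasure (wt (\<lambda>x. exp (s * \<beta> x) * w x)) A"
    using w by (subst emeasure_wt) (auto intro!: nn_integral_cong simp: ennreal_mult mult_ac)
  finally show ?thesis by simp
qed

text \<open>The exponents \<open>s / a\<close> and \<open>- s / (1 - a)\<close> preserve the duality
  relation. On a ball they leave the factors \<open>exp (s * m c r)\<close> and
  \<open>exp (- s * m c r)\<close> once the powers \<open>a\<close> and \<open>1 - a\<close> are
  taken. These cancel, so the new constant does not depend on \<open>s\<close>.\<close>

lemma perturb:
  obtains \<gamma> K' where "0 < \<gamma>"
    "\<And>s. \<bar>s / a\<bar> \<le> \<gamma> \<Longrightarrow> \<bar>s / (1 - a)\<bar> \<le> \<gamma> \<Longrightarrow>
      weight_pair (\<lambda>x. exp (s / a * \<beta> x) * v x) (\<lambda>x. exp (- s / (1 - a) * \<beta> x) * u x) a K'"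
proof -
  obtain \<gamma> C where \<gamma>: "0 < \<gamma>" "0 < C" and
    V: "\<And>s c r. \<bar>s\<bar> \<le> \<gamma> \<Longrightarrow> 0 < r \<Longrightarrow>
      (\<integral>\<^sup>+y\<in>ball c r. ennreal (exp (s * (\<beta> y - m c r))) \<partial>wt v) \<le> ennreal C * emeasure (wt v) (ball c r)" and
    U: "\<And>s c r. \<bar>s\<bar> \<le> \<gamma> \<Longrightarrow> 0 < r \<Longrightarrow>
      (\<integral>\<^sup>+y\<in>ball c r. ennreal (exp (s * (\<beta> y - m c r))) \<partial>wt u) \<le> ennreal C * emeasure (wt u) (ball c r)"
    by (rule exp_osc) blast
  have a: "0 < a" "a < 1" using a_pos a_less by auto
  have "weight_pair (\<lambda>x. exp (s / a * \<beta> x) * v x) (\<lambda>x. exp (- s / (1 - a) * \<beta> x) * u x) a (C * K)"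
    if s: "\<bar>s / a\<bar> \<le> \<gamma>" "\<bar>s / (1 - a)\<bar> \<le> \<gamma>" for s
  proof
    fix x
    show "(exp (s / a * \<beta> x) * v x) powr a * (exp (- s / (1 - a) * \<beta> x) * u x) powr (1 - a) = 1"
    proof -
      have "(exp (s / a * \<beta> x) * v x) powr a * (exp (- s / (1 - a) * \<beta> x) * u x) powr (1 - a)
        = (exp (s / a * \<beta> x) powr a * exp (- s / (1 - a) * \<beta> x) powr (1 - a)) * (v x powr a * u x powr (1 - a))"
        using v_pos[of x] u_pos[of x] by (simp add: powr_mult)
      also have "exp (s / a * \<beta> x) powr a * exp (- s / (1 - a) * \<beta> x) powr (1 - a) = 1"
        using a by (simp add: powr_def exp_add[symmetric])
      finally show ?thesis by (simp add: dual)
    qed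
  next
    fix c and r :: real assume r: "0 < r"
    let ?B = "ball c r" and ?d = "m c r"
    have s2: "\<bar>- s / (1 - a)\<bar> \<le> \<gamma>" using s(2) by simp
    have 1: "emeasure (wt (\<lambda>x. exp (s / a * \<beta> x) * v x)) ?B \<le> ennreal (exp (s / a * ?d)) * (ennreal C * emeasure (wt v) ?B)"
      unfolding emeasure_exp_weight[OF v_measurable borel_open[OF open_ball] less_imp_le[OF v_pos]]
        exp_weight_eq[OF v_measurable less_imp_le[OF v_pos] borel_open[OF open_ball], of _ _ _ ?d]
      by (intro mult_left_mono V[OF s(1) r]) simp
    have 2: "emeasure (wt (\<lambda>x. exp (- s / (1 - a) * \<beta> x) * u x)) ?B \<le> ennreal (exp (- s / (1 - a) * ?d)) * (ennreal C * emeasure (wt u) ?B)"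
      unfolding emeasure_exp_weight[OF u_measurable borel_open[OF open_ball] less_imp_le[OF u_pos]]
        exp_weight_eq[OF u_measurable less_imp_le[OF u_pos] borel_open[OF open_ball], of _ _ _ ?d]
      by (intro mult_left_mono U[OF s2 r]) simp
    have "epowr (emeasure (wt (\<lambda>x. exp (s / a * \<beta> x) * v x)) ?B) a * epowr (emeasure (wt (\<lambda>x. exp (- s / (1 - a) * \<beta> x) * u x)) ?B) (1 - a)
      \<le> epowr (ennreal (exp (s / a * ?d)) * (ennreal C * emeasure (wt v) ?B)) a * epowr (ennreal (exp (- s / (1 - a) * ?d)) * (ennreal C * emeasure (wt u) ?B)) (1 - a)"
      using a by (intro mult_mono epowr_mono 1 2) auto
    also have "\<dots> = (epowr (ennreal (exp (s / a * ?d))) a * epowr (ennreal (exp (- s / (1 - a) * ?d))) (1 - a)) * (epowr (ennreal C) a * epowr (ennreal C) (1 - a))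
       * (epowr (emeasure (wt v) ?B) a * epowr (emeasure (wt u) ?B) (1 - a))"
      using a by (simp add: epowr_mult mult_ac)
    also have "epowr (ennreal (exp (s / a * ?d))) a * epowr (ennreal (exp (- s / (1 - a) * ?d))) (1 - a) = 1"
      using a by (simp add: epowr_ennreal ennreal_mult[symmetric] powr_def exp_add[symmetric])
    also have "epowr (ennreal C) a * epowr (ennreal C) (1 - a) = ennreal C"
      using a epowr_add[of a "1 - a" "ennreal C"] by simp
    also have "1 * ennreal C * (epowr (emeasure (wt v) ?B) a * epowr (emeasure (wt u) ?B) (1 - a)) \<le> 1 * ennreal C * (ennreal K * emeasure lborel ?B)"
      by (intro mult_left_mono char r) simp
    also have "\<dots> = ennreal (C * K) * emeasure lborel ?B" using \<gamma> K_pos by (simp add: ennreal_mult mult.assoc)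
    finally show "epowr (emeasure (wt (\<lambda>x. exp (s / a * \<beta> x) * v x)) ?B) a * epowr (emeasure (wt (\<lambda>x. exp (- s / (1 - a) * \<beta> x) * u x)) ?B) (1 - a)
      \<le> ennreal (C * K) * emeasure lborel ?B" .
  qed (use v_pos u_pos a \<gamma> K_pos in auto)
  with \<gamma>(1) show ?thesis by (rule that)
qed

end

section \<open>The fractional maximal function\<close>

text \<open>With \<open>e = 1 - \<alpha>/n\<close> this is the fractional maximal function of order \<open>\<alpha>\<close>.\<close>

definition frac_maximal :: "real \<Rightarrow> ('a::euclidean_space \<Rightarrow> ennreal) \<Rightarrow> 'a \<Rightarrow> ennreal" where
  "frac_maximal e h x = (SUP (c, r)\<in>{(c, r). x \<in> ball c r}. ennreal (r powr (- real DIM('a) * e)) * (\<integral>\<^sup>+y\<in>ball c r. h y \<partial>lborel))"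

lemma frac_maximal_upper:
  fixes x :: "'a::euclidean_space"
  shows "x \<in> ball c r \<Longrightarrow> ennreal (r powr (- real DIM('a) * e)) * (\<integral>\<^sup>+y\<in>ball c r. h y \<partial>lborel) \<le> frac_maximal e h x"
  unfolding frac_maximal_def by (rule SUP_upper2[of "(c, r)"]) simp_all

lemma frac_maximal_least:
  fixes x :: "'a::euclidean_space"
  assumes "\<And>c r. 0 < r \<Longrightarrow> x \<in> ball c r \<Longrightarrow> ennreal (r powr (- real DIM('a) * e)) * (\<integral>\<^sup>+y\<in>ball c r. h y \<partial>lborel) \<le> y"
  shows "frac_maximal e h x \<le> y"
  unfolding frac_maximal_def
proof (rule SUP_least, safe)
  fix c r assume x: "x \<in> ball c r"
  then have "0 < r" by (simp add: le_less_trans[OF zero_le_dist])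
  then show "ennreal (r powr (- real DIM('a) * e)) * (\<integral>\<^sup>+y\<in>ball c r. h y \<partial>lborel) \<le> y"
    using x by (rule assms)
qed

lemma frac_maximal_measurable [measurable]:
  fixes h :: "'a::euclidean_space \<Rightarrow> ennreal"
  shows "frac_maximal e h \<in> borel_measurable borel"
proof (rule borel_measurableI_greater)
  fix t
  have "{x. t < frac_maximal e h x} =
    (\<Union>(c, r)\<in>{(c, r). t < ennreal (r powr (- real DIM('a) * e)) * (\<integral>\<^sup>+y\<in>ball c r. h y \<partial>lborel)}. ball c r)"
    (is "?L = ?R")
  proof (intro set_eqI iffI)
    fix x assume "x \<in> ?L"
    then obtain p where "p \<in> {(c, r). x \<in> ball c r}"
      "t < (case p of (c, r) \<Rightarrow> ennreal (r powr (- real DIM('a) * e)) * (\<integral>\<^sup>+y\<in>ball c r. h y \<partial>lborel))"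
      unfolding frac_maximal_def mem_Collect_eq less_SUP_iff by blast
    then show "x \<in> ?R" by (intro UN_I[of p]) (auto simp del: mem_ball)
  next
    fix x assume "x \<in> ?R"
    then show "x \<in> ?L" using frac_maximal_upper[of x _ _ e h] by (auto simp del: mem_ball intro: less_le_trans)
  qed
  then have "open ?L" by (simp only:) auto
  then show "{x \<in> space borel. t < frac_maximal e h x} \<in> sets borel" by simp
qed

lemma frac_maximal_add_le:
  assumes [measurable]: "h1 \<in> borel_measurable borel" "h2 \<in> borel_measurable borel"
  shows "frac_maximal e (\<lambda>y. h1 y + h2 y) x \<le> frac_maximal e h1 x + frac_maximal e h2 x"
proof (rule frac_maximal_least)
  fix c and r :: real assume x: "x \<in> ball c r"
  have [measurable]: "ball c r \<in> sets borel" by simp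
  have "(\<integral>\<^sup>+y\<in>ball c r. (h1 y + h2 y) \<partial>lborel) = (\<integral>\<^sup>+y\<in>ball c r. h1 y \<partial>lborel) + (\<integral>\<^sup>+y\<in>ball c r. h2 y \<partial>lborel)"
    unfolding distrib_right by (rule nn_integral_add) measurable
  then show "ennreal (r powr (- real DIM('a) * e)) * (\<integral>\<^sup>+y\<in>ball c r. (h1 y + h2 y) \<partial>lborel) \<le> frac_maximal e h1 x + frac_maximal e h2 x"
    by (simp only: distrib_left) (intro add_mono frac_maximal_upper x)
qed

text \<open>Writing \<open>F = (h W)\<^sup>P\<^sup>a v\<^sup>-\<^sup>a\<close>, Hoelder's inequality bounds the fractional maximal function of \<open>h\<close> by a power of
  the ordinary maximal function of \<open>F\<close> times a global norm, which reduces it to \<open>muckenhoupt\<close>.\<close>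

lemma (in weight_pair) frac_maximal_bound:
  assumes e: "0 < e" "e < 1"
  defines "Q \<equiv> 1 / (a * e)" and "P \<equiv> 1 / (a * e + 1 - e)"
  obtains C where "0 \<le> C"
    "\<And>h :: 'a \<Rightarrow> ennreal. h \<in> borel_measurable borel \<Longrightarrow>
      (\<integral>\<^sup>+x. epowr (frac_maximal e h x) Q \<partial>wt v)
        \<le> ennreal C * epowr (\<integral>\<^sup>+x. epowr (h x * ennreal (v x powr (a * e))) P \<partial>lborel) (Q / P)"
proof -
  have a: "0 < a" "a < 1" using a_pos a_less by auto
  have ae: "0 < a * e" using a e by simp
  then have ae': "0 < a * e + 1 - e" using e by linarith
  have QP: "0 < Q" "0 < P" using ae ae' by (auto simp: Q_def P_def)
  obtain C where C: "0 \<le> C" "\<And>F :: 'a \<Rightarrow> ennreal. F \<in> borel_measurable borel \<Longrightarrow>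
      (\<integral>\<^sup>+x. epowr (maximal lborel F x) (1 / a) \<partial>wt v) \<le> ennreal C * (\<integral>\<^sup>+x. epowr (F x) (1 / a) \<partial>wt v)"
    by (rule muckenhoupt) blast
  define \<omega> where "\<omega> = unit_ball_vol (real DIM('a))"
  have \<omega>: "0 < \<omega>" by (simp add: \<omega>_def)
  have "(\<integral>\<^sup>+x. epowr (frac_maximal e h x) Q \<partial>wt v)
        \<le> ennreal (\<omega> powr (1 / a) * C) * epowr (\<integral>\<^sup>+x. epowr (h x * ennreal (v x powr (a * e))) P \<partial>lborel) (Q / P)"
    if [measurable]: "h \<in> borel_measurable borel" for h :: "'a \<Rightarrow> ennreal"
  proof -
    define \<phi> where "\<phi> x = h x * ennreal (v x powr (a * e))" for x
    define F where "F x = epowr (\<phi> x) (P * a) * ennreal (v x powr (- a))" for x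
    define \<Phi> where "\<Phi> = (\<integral>\<^sup>+x. epowr (\<phi> x) P \<partial>lborel)"
    have [measurable]: "\<phi> \<in> borel_measurable borel" unfolding \<phi>_def by measurable
    have [measurable]: "F \<in> borel_measurable borel" unfolding F_def by measurable
    \<comment> \<open>Prepares Hoelder's inequality with the powers \<open>e\<close> and
      \<open>1 - e\<close>: the powers of \<open>v\<close> cancel, and those of
      \<open>\<phi>\<close> add up to 1 because \<open>P * (a * e + 1 - e) = 1\<close>.\<close>
    have h_eq: "h x = epowr (F x) e * epowr (epowr (\<phi> x) P) (1 - e)" for x
    proof -
      have "epowr (F x) e * epowr (epowr (\<phi> x) P) (1 - e) = ennreal (v x powr (- a * e)) * (epowr (\<phi> x) (P * a * e) * epowr (\<phi> x) (P * (1 - e)))"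
        using a e QP v_pos[of x] by (simp add: F_def epowr_mult epowr_epowr epowr_ennreal powr_powr mult_ac)
      also have "epowr (\<phi> x) (P * a * e) * epowr (\<phi> x) (P * (1 - e)) = epowr (\<phi> x) (P * a * e + P * (1 - e))"
        using a e QP by (intro epowr_add[symmetric]) auto
      also have "P * a * e + P * (1 - e) = P * (a * e + 1 - e)" by (simp add: algebra_simps)
      also have "\<dots> = 1" using ae' by (simp add: P_def)
      also have "ennreal (v x powr (- a * e)) * epowr (\<phi> x) 1 = h x * (ennreal (v x powr (- a * e)) * ennreal (v x powr (a * e)))"
        by (simp add: \<phi>_def mult_ac)
      also have "ennreal (v x powr (- a * e)) * ennreal (v x powr (a * e)) = 1"
        using v_pos[of x] by (simp add: ennreal_mult[symmetric] powr_add[symmetric])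
      finally show ?thesis by simp
    qed
    have le: "frac_maximal e h x \<le> ennreal (\<omega> powr e) * epowr (maximal lborel F x) e * epowr \<Phi> (1 - e)" for x
    proof (rule frac_maximal_least)
      fix c and r :: real assume r: "0 < r" and x: "x \<in> ball c r"
      have [measurable]: "ball c r \<in> sets borel" by simp
      have "(\<integral>\<^sup>+y\<in>ball c r. h y \<partial>lborel) = (\<integral>\<^sup>+y. epowr (F y * indicator (ball c r) y) e * epowr (epowr (\<phi> y) P * indicator (ball c r) y) (1 - e) \<partial>lborel)"
        using e by (intro nn_integral_cong) (auto simp: h_eq indicator_def)
      also have "\<dots> \<le> epowr (\<integral>\<^sup>+y\<in>ball c r. F y \<partial>lborel) e * epowr (\<integral>\<^sup>+y\<in>ball c r. epowr (\<phi> y) P \<partial>lborel) (1 - e)"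
        using e by (intro Hoelder_nn_integral) measurable
      also have "\<dots> \<le> epowr (\<integral>\<^sup>+y\<in>ball c r. F y \<partial>lborel) e * epowr \<Phi> (1 - e)"
        unfolding \<Phi>_def using e by (intro mult_left_mono epowr_mono nn_integral_mono) (auto simp: indicator_def)
      finally have "ennreal (r powr (- real DIM('a) * e)) * (\<integral>\<^sup>+y\<in>ball c r. h y \<partial>lborel)
        \<le> ennreal (r powr (- real DIM('a) * e)) * (epowr (\<integral>\<^sup>+y\<in>ball c r. F y \<partial>lborel) e * epowr \<Phi> (1 - e))"
        by (rule mult_left_mono) simp
      also have "\<dots> = (epowr (ennreal (r powr (- real DIM('a)))) e * epowr (\<integral>\<^sup>+y\<in>ball c r. F y \<partial>lborel) e) * epowr \<Phi> (1 - e)"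
        using e r by (simp add: epowr_ennreal powr_powr mult.assoc)
      also have "epowr (ennreal (r powr (- real DIM('a)))) e * epowr (\<integral>\<^sup>+y\<in>ball c r. F y \<partial>lborel) e
         = epowr (ennreal (r powr (- real DIM('a))) * (\<integral>\<^sup>+y\<in>ball c r. F y \<partial>lborel)) e"
        using e by (simp add: epowr_mult)
      also have "ennreal (r powr (- real DIM('a))) * (\<integral>\<^sup>+y\<in>ball c r. F y \<partial>lborel) = ennreal \<omega> * ((\<integral>\<^sup>+y\<in>ball c r. F y \<partial>lborel) / emeasure lborel (ball c r))"
      proof -
        have "r powr (- real DIM('a)) = \<omega> * (1 / (\<omega> * r ^ DIM('a)))"
          using r \<omega> by (simp add: powr_minus powr_realpow inverse_eq_divide)
        then have "ennreal (r powr (- real DIM('a))) = ennreal \<omega> * ennreal (1 / (\<omega> * r ^ DIM('a)))"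
          using r \<omega> by (simp only:) (subst ennreal_mult, auto)
        moreover have "emeasure lborel (ball c r) = ennreal (\<omega> * r ^ DIM('a))"
          using r by (simp add: emeasure_ball \<omega>_def)
        ultimately show ?thesis
          using r \<omega> by (simp add: divide_ennreal_def inverse_ennreal inverse_eq_divide mult_ac)
      qed
      also have "epowr (ennreal \<omega> * ((\<integral>\<^sup>+y\<in>ball c r. F y \<partial>lborel) / emeasure lborel (ball c r))) e * epowr \<Phi> (1 - e)
        \<le> epowr (ennreal \<omega> * maximal lborel F x) e * epowr \<Phi> (1 - e)"
        using e by (intro mult_right_mono epowr_mono mult_left_mono maximal_upper x) auto
      also have "epowr (ennreal \<omega> * maximal lborel F x) e = ennreal (\<omega> powr e) * epowr (maximal lborel F x) e"
        using e \<omega> by (simp add: epowr_mult epowr_ennreal)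
      finally show "ennreal (r powr (- real DIM('a) * e)) * (\<integral>\<^sup>+y\<in>ball c r. h y \<partial>lborel) \<le> ennreal (\<omega> powr e) * epowr (maximal lborel F x) e * epowr \<Phi> (1 - e)" .
    qed
    \<comment> \<open>At the power \<open>Q\<close> the maximal function of \<open>F\<close> appears
      with exponent \<open>1 / a\<close>, the one of \<open>muckenhoupt\<close>, and
      \<open>F\<close> is built so that \<open>v\<close> times its power \<open>1 / a\<close> is
      \<open>\<phi>\<close> to the power \<open>P\<close>.\<close>
    have eQ: "e * Q = 1 / a" using a e by (simp add: Q_def)
    \<comment> \<open>Provides the measurability of the ordinary maximal function.\<close>
    interpret L: doubling_measure "lborel :: 'a measure" "5 ^ DIM('a)"
    proof
      show "emeasure lborel (ball (c::'a) (5 * r)) \<le> ennreal (5 ^ DIM('a)) * emeasure lborel (ball c r)" if "0 < r" for c r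
        using that by (subst emeasure_lborel_ball_scale) auto
      show "emeasure lborel (ball (c::'a) r) < top" for c r using emeasure_lborel_ball_finite[of c r] by simp
    qed (auto simp: emeasure_lborel_ball_pos)
    have eQ': "Q * e = 1 / a" using eQ by (simp add: mult.commute)
    have "(\<integral>\<^sup>+x. epowr (frac_maximal e h x) Q \<partial>wt v) \<le> (\<integral>\<^sup>+x. epowr (ennreal (\<omega> powr e) * epowr (maximal lborel F x) e * epowr \<Phi> (1 - e)) Q \<partial>wt v)"
      using QP by (intro nn_integral_mono epowr_mono le) auto
    also have "\<dots> = (\<integral>\<^sup>+x. (ennreal (\<omega> powr (1 / a)) * epowr \<Phi> ((1 - e) * Q)) * epowr (maximal lborel F x) (1 / a) \<partial>wt v)"
      using QP e \<omega> by (intro nn_integral_cong) (simp add: epowr_mult epowr_epowr epowr_ennreal powr_powr eQ eQ' mult_ac)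
    also have "\<dots> = (ennreal (\<omega> powr (1 / a)) * epowr \<Phi> ((1 - e) * Q)) * (\<integral>\<^sup>+x. epowr (maximal lborel F x) (1 / a) \<partial>wt v)"
      by (rule nn_integral_cmult) measurable
    also have "\<dots> \<le> (ennreal (\<omega> powr (1 / a)) * epowr \<Phi> ((1 - e) * Q)) * (ennreal C * (\<integral>\<^sup>+x. epowr (F x) (1 / a) \<partial>wt v))"
      by (intro mult_left_mono C) auto
    also have "(\<integral>\<^sup>+x. epowr (F x) (1 / a) \<partial>wt v) = (\<integral>\<^sup>+x. ennreal (v x) * epowr (F x) (1 / a) \<partial>lborel)"
      by (rule nn_integral_wt) measurable
    also have "\<dots> = \<Phi>"
      unfolding \<Phi>_def
    proof (rule nn_integral_cong)
      fix x
      have "ennreal (v x) * epowr (F x) (1 / a) = epowr (\<phi> x) P * (ennreal (v x) * ennreal (v x powr (-1)))"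
        using a QP by (simp add: F_def epowr_mult epowr_epowr epowr_ennreal powr_powr mult_ac)
      also have "ennreal (v x) * ennreal (v x powr (-1)) = 1"
        using v_pos[of x] by (simp add: ennreal_mult[symmetric] powr_minus)
      finally show "ennreal (v x) * epowr (F x) (1 / a) = epowr (\<phi> x) P" by simp
    qed
    also have "(ennreal (\<omega> powr (1 / a)) * epowr \<Phi> ((1 - e) * Q)) * (ennreal C * \<Phi>) = ennreal (\<omega> powr (1 / a) * C) * (epowr \<Phi> ((1 - e) * Q) * epowr \<Phi> 1)"
      using C(1) by (simp add: ennreal_mult mult_ac)
    also have "epowr \<Phi> ((1 - e) * Q) * epowr \<Phi> 1 = epowr \<Phi> ((1 - e) * Q + 1)"
      using e QP by (intro epowr_add[symmetric]) auto
    also have "(1 - e) * Q + 1 = Q / P" using a e by (simp add: Q_def P_def field_simps)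
    finally show ?thesis unfolding \<Phi>_def \<phi>_def .
  qed
  then show ?thesis using C(1) \<omega> by (intro that[of "\<omega> powr (1 / a) * C"]) auto
qed

section \<open>The conjugated fractional maximal function on Morrey spaces\<close>

context weight_pair_bmo
begin

text \<open>Conjugation by \<open>exp (s \<beta>)\<close> amounts to replacing the pair of weights by the perturbed one.\<close>

lemma frac_maximal_conjugate:
  assumes e: "0 < e" "e < 1"
  defines "Q \<equiv> 1 / (a * e)" and "P \<equiv> 1 / (a * e + 1 - e)"
  assumes pair: "weight_pair (\<lambda>x. exp (s * Q * \<beta> x) * v x) u' a K'"
  obtains C where "0 \<le> C"
    "\<And>G :: 'a \<Rightarrow> ennreal. G \<in> borel_measurable borel \<Longrightarrow>
      (\<integral>\<^sup>+x. epowr (ennreal (exp (s * \<beta> x)) * frac_maximal e (\<lambda>y. ennreal (exp (- s * \<beta> y)) * G y) x) Q \<partial>wt v)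
        \<le> ennreal C * epowr (\<integral>\<^sup>+x. epowr (G x * ennreal (v x powr (a * e))) P \<partial>lborel) (Q / P)"
proof -
  interpret W: weight_pair "\<lambda>x. exp (s * Q * \<beta> x) * v x" u' a K' by (rule pair)
  have Q: "0 < Q" "Q * (a * e) = 1" using e a_pos by (auto simp: Q_def)
  obtain C where C: "0 \<le> C" "\<And>h :: 'a \<Rightarrow> ennreal. h \<in> borel_measurable borel \<Longrightarrow>
      (\<integral>\<^sup>+x. epowr (frac_maximal e h x) Q \<partial>wt (\<lambda>x. exp (s * Q * \<beta> x) * v x))
        \<le> ennreal C * epowr (\<integral>\<^sup>+x. epowr (h x * ennreal ((exp (s * Q * \<beta> x) * v x) powr (a * e))) P \<partial>lborel) (Q / P)"
    by (rule W.frac_maximal_bound[OF e, folded Q_def P_def]) blast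
  show ?thesis
  proof (rule that[OF C(1)])
    fix G :: "'a \<Rightarrow> ennreal" assume [measurable]: "G \<in> borel_measurable borel"
    let ?h = "\<lambda>y. ennreal (exp (- s * \<beta> y)) * G y"
    have "(\<integral>\<^sup>+x. epowr (ennreal (exp (s * \<beta> x)) * frac_maximal e ?h x) Q \<partial>wt v)
       = (\<integral>\<^sup>+x. ennreal (v x) * epowr (ennreal (exp (s * \<beta> x)) * frac_maximal e ?h x) Q \<partial>lborel)"
      by (rule nn_integral_wt) measurable
    also have "\<dots> = (\<integral>\<^sup>+x. ennreal (exp (s * Q * \<beta> x) * v x) * epowr (frac_maximal e ?h x) Q \<partial>lborel)"
    proof (rule nn_integral_cong)
      fix x
      have "epowr (ennreal (exp (s * \<beta> x))) Q = ennreal (exp (s * Q * \<beta> x))"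
        using Q by (simp add: epowr_ennreal powr_def mult_ac)
      then show "ennreal (v x) * epowr (ennreal (exp (s * \<beta> x)) * frac_maximal e ?h x) Q
         = ennreal (exp (s * Q * \<beta> x) * v x) * epowr (frac_maximal e ?h x) Q"
        using Q v_pos[of x] by (simp add: epowr_mult ennreal_mult less_imp_le mult_ac)
    qed
    also have "\<dots> = (\<integral>\<^sup>+x. epowr (frac_maximal e ?h x) Q \<partial>wt (\<lambda>x. exp (s * Q * \<beta> x) * v x))"
      by (rule nn_integral_wt[symmetric]) measurable
    also have "\<dots> \<le> ennreal C * epowr (\<integral>\<^sup>+x. epowr (?h x * ennreal ((exp (s * Q * \<beta> x) * v x) powr (a * e))) P \<partial>lborel) (Q / P)"
      by (rule C) measurable
    also have "(\<lambda>x. ?h x * ennreal ((exp (s * Q * \<beta> x) * v x) powr (a * e))) = (\<lambda>x. G x * ennreal (v x powr (a * e)))"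
    proof
      fix x
      \<comment> \<open>As \<open>Q * (a * e) = 1\<close>, the perturbed weight contributes exactly
        \<open>exp (s * \<beta> x)\<close>, which cancels the conjugating factor in front of
        \<open>G\<close>.\<close>
      have "exp (s * Q * \<beta> x) powr (a * e) = exp (s * \<beta> x * (Q * (a * e)))"
        by (simp add: powr_def mult_ac)
      then have "(exp (s * Q * \<beta> x) * v x) powr (a * e) = exp (s * \<beta> x) * v x powr (a * e)"
        using v_pos[of x] Q by (simp add: powr_mult)
      then have "?h x * ennreal ((exp (s * Q * \<beta> x) * v x) powr (a * e)) = G x * ennreal (v x powr (a * e)) * (ennreal (exp (- s * \<beta> x)) * ennreal (exp (s * \<beta> x)))"
        by (simp add: ennreal_mult mult_ac)
      also have "ennreal (exp (- s * \<beta> x)) * ennreal (exp (s * \<beta> x)) = 1"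
        by (simp add: ennreal_mult[symmetric] exp_add[symmetric])
      finally show "?h x * ennreal ((exp (s * Q * \<beta> x) * v x) powr (a * e)) = G x * ennreal (v x powr (a * e))" by simp
    qed
    finally show "(\<integral>\<^sup>+x. epowr (ennreal (exp (s * \<beta> x)) * frac_maximal e ?h x) Q \<partial>wt v)
        \<le> ennreal C * epowr (\<integral>\<^sup>+x. epowr (G x * ennreal (v x powr (a * e))) P \<partial>lborel) (Q / P)" .
  qed
qed

lemma measure_ball: "emeasure (wt v) (ball c r) = ennreal (measure (wt v) (ball c r))"
  using ball_finite[of c r] by (simp add: emeasure_eq_ennreal_measure)

lemma measure_ball_pos: "0 < r \<Longrightarrow> 0 < measure (wt v) (ball c r)"
  using ball_pos[of r c] unfolding measure_ball by simp

text \<open>The factor \<open>exp (- s (m c (2^k r) - m c r))\<close>, exponential in \<open>k\<close>, is absorbed by reverse doubling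
  when \<open>s\<close> is small.\<close>

lemma dyadic_ball_bound:
  assumes e: "0 < e" "e < 1"
  defines "Q \<equiv> 1 / (a * e)" and "P \<equiv> 1 / (a * e + 1 - e)" and "P' \<equiv> 1 / (e * (1 - a))"
  assumes \<kappa>: "0 < \<kappa>" "\<kappa> < P / Q"
    and C1: "0 < C1" "\<And>c r. 0 < r \<Longrightarrow> (\<integral>\<^sup>+y\<in>ball c r. ennreal (exp (- s * P' * (\<beta> y - m c r))) \<partial>wt u) \<le> ennreal C1 * emeasure (wt u) (ball c r)"
    and \<delta>: "0 < \<delta>" "\<delta> < 1" "\<And>c r k. 0 < r \<Longrightarrow> emeasure (wt v) (ball c r) \<le> ennreal (\<delta> ^ k) * emeasure (wt v) (ball c (2 ^ k * r))"
    and s: "\<bar>s\<bar> * (L * (1 + 2 ^ DIM('a))) \<le> - (1 / Q - \<kappa> / P) * ln \<delta>"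
    and G [measurable]: "G \<in> borel_measurable borel"
    and GN: "\<And>c r. 0 < r \<Longrightarrow> (\<integral>\<^sup>+x\<in>ball c r. epowr (G x * ennreal (v x powr (a * e))) P \<partial>lborel) \<le> N * epowr (emeasure (wt v) (ball c r)) \<kappa>"
    and r: "0 < r"
  shows "ennreal ((2 ^ k * r) powr (- real DIM('a) * e)) * (\<integral>\<^sup>+y\<in>ball c (2 ^ k * r). ennreal (exp (- s * \<beta> y)) * G y \<partial>lborel)
    \<le> epowr N (1 / P) * ennreal (C1 powr (1 / P') * (K * unit_ball_vol (real DIM('a))) powr e
        * measure (wt v) (ball c r) powr (- (1 / Q - \<kappa> / P)) * exp (- s * m c r))"
proof -
  interpret dual: weight_pair u v "1 - a" K by (rule swap)
  interpret dual: weight_pair_bmo u v "1 - a" K \<beta> m L ..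
  have a: "0 < a" "a < 1" using a_pos a_less by auto
  have ae: "0 < a * e" using a e by simp
  have ae': "0 < a * e + 1 - e" using ae e by linarith
  have QP: "0 < Q" "0 < P" "0 < P'" using ae ae' a e by (auto simp: Q_def P_def P'_def)
  \<comment> \<open>\<open>P'\<close> is the exponent dual to \<open>P\<close>, and all reciprocals
    are polynomials in \<open>a\<close> and \<open>e\<close>.\<close>
  have inv: "1 / Q = a * e" "1 / P = a * e + 1 - e" "1 / P' = e * (1 - a)" "1 - 1 / P = 1 / P'"
    by (auto simp: Q_def P_def P'_def algebra_simps)
  have "0 < 1 / P'" using QP by simp
  then have P1: "0 < 1 / P" "1 / P < 1" using QP inv(4) by (simp, linarith)
  define \<tau> where "\<tau> = 1 / Q - \<kappa> / P"
  have \<tau>: "0 < \<tau>" using \<kappa> QP by (simp add: \<tau>_def field_simps)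
  define \<omega> where "\<omega> = unit_ball_vol (real DIM('a))"
  have \<omega>: "0 < \<omega>" by (simp add: \<omega>_def)
  define \<rho> where "\<rho> = 2 ^ k * r"
  have \<rho>: "0 < \<rho>" using r by (simp add: \<rho>_def)
  define V U V0 where "V = measure (wt v) (ball c \<rho>)" and "U = measure (wt u) (ball c \<rho>)" and "V0 = measure (wt v) (ball c r)"
  have VU: "0 < V" "0 < U" "0 < V0"
    unfolding V_def U_def V0_def using \<rho> r by (auto intro: measure_ball_pos dual.measure_ball_pos)
  have eV: "emeasure (wt v) (ball c \<rho>) = ennreal V" "emeasure (wt u) (ball c \<rho>) = ennreal U" "emeasure (wt v) (ball c r) = ennreal V0"
    by (auto simp: V_def U_def V0_def measure_ball dual.measure_ball)
  have [measurable]: "ball c \<rho> \<in> sets borel" by simp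
  have int_u: "(\<integral>\<^sup>+y\<in>ball c \<rho>. ennreal (exp (- s * P' * \<beta> y)) \<partial>wt u) \<le> ennreal (exp (- s * P' * m c \<rho>) * (C1 * U))"
  proof -
    have "(\<integral>\<^sup>+y\<in>ball c \<rho>. ennreal (exp (- s * P' * \<beta> y)) \<partial>wt u)
       = ennreal (exp (- s * P' * m c \<rho>)) * (\<integral>\<^sup>+y\<in>ball c \<rho>. ennreal (exp (- s * P' * (\<beta> y - m c \<rho>))) \<partial>wt u)"
      by (rule exp_weight_eq) (auto simp: u_pos less_imp_le)
    also have "\<dots> \<le> ennreal (exp (- s * P' * m c \<rho>)) * (ennreal C1 * emeasure (wt u) (ball c \<rho>))"
      by (intro mult_left_mono C1 \<rho>) simp
    finally show ?thesis using C1 VU by (simp add: eV ennreal_mult[symmetric])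
  qed
  have Hoelder: "(\<integral>\<^sup>+y\<in>ball c \<rho>. ennreal (exp (- s * \<beta> y)) * G y \<partial>lborel)
     \<le> epowr (\<integral>\<^sup>+y\<in>ball c \<rho>. epowr (G y * ennreal (v y powr (a * e))) P \<partial>lborel) (1 / P)
       * epowr (\<integral>\<^sup>+y\<in>ball c \<rho>. ennreal (exp (- s * P' * \<beta> y)) \<partial>wt u) (1 - 1 / P)"
  proof -
    have "(\<integral>\<^sup>+y\<in>ball c \<rho>. ennreal (exp (- s * \<beta> y)) * G y \<partial>lborel)
       = (\<integral>\<^sup>+y. epowr (epowr (G y * ennreal (v y powr (a * e))) P * indicator (ball c \<rho>) y) (1 / P)
           * epowr (ennreal (u y) * (ennreal (exp (- s * P' * \<beta> y)) * indicator (ball c \<rho>) y)) (1 - 1 / P) \<partial>lborel)"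
    proof (rule nn_integral_cong)
      fix y
      show "ennreal (exp (- s * \<beta> y)) * G y * indicator (ball c \<rho>) y
         = epowr (epowr (G y * ennreal (v y powr (a * e))) P * indicator (ball c \<rho>) y) (1 / P)
           * epowr (ennreal (u y) * (ennreal (exp (- s * P' * \<beta> y)) * indicator (ball c \<rho>) y)) (1 - 1 / P)"
      proof (cases "y \<in> ball c \<rho>")
        case True
        \<comment> \<open>The duality relation to the power \<open>e\<close>: the factor inserted
          for Hoelder's inequality is 1.\<close>
        have "v y powr (a * e) * u y powr (1 / P') = (v y powr a * u y powr (1 - a)) powr e"
          unfolding inv(3) using v_pos[of y] u_pos[of y] by (simp add: powr_mult powr_powr mult_ac)
        then have vu: "ennreal (v y powr (a * e)) * ennreal (u y powr (1 / P')) = 1"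
          using dual[of y] by (simp add: ennreal_mult[symmetric])
        have ex: "epowr (ennreal (exp (- s * P' * \<beta> y))) (1 / P') = ennreal (exp (- s * \<beta> y))"
          using QP by (simp add: epowr_ennreal powr_def)
        have "epowr (epowr (G y * ennreal (v y powr (a * e))) P) (1 / P) * epowr (ennreal (u y) * ennreal (exp (- s * P' * \<beta> y))) (1 / P')
          = ennreal (exp (- s * \<beta> y)) * G y * (ennreal (v y powr (a * e)) * ennreal (u y powr (1 / P')))"
          unfolding epowr_inverse_cancel[OF QP(2)] epowr_mult[of "1 / P'", OF divide_pos_pos[OF zero_less_one QP(3)]] ex
          using QP u_pos[of y] by (simp add: epowr_ennreal less_imp_le mult_ac)
        then show ?thesis using True unfolding inv(4) vu by simp
      next
        case False
        then show ?thesis using P1 by simp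
      qed
    qed
    also have "\<dots> \<le> epowr (\<integral>\<^sup>+y\<in>ball c \<rho>. epowr (G y * ennreal (v y powr (a * e))) P \<partial>lborel) (1 / P)
       * epowr (\<integral>\<^sup>+y. ennreal (u y) * (ennreal (exp (- s * P' * \<beta> y)) * indicator (ball c \<rho>) y) \<partial>lborel) (1 - 1 / P)"
      using P1 by (intro Hoelder_nn_integral) measurable
    also have "(\<integral>\<^sup>+y. ennreal (u y) * (ennreal (exp (- s * P' * \<beta> y)) * indicator (ball c \<rho>) y) \<partial>lborel) = (\<integral>\<^sup>+y\<in>ball c \<rho>. ennreal (exp (- s * P' * \<beta> y)) \<partial>wt u)"
      by (rule nn_integral_wt[symmetric]) measurable
    finally show ?thesis .
  qed
  also have "\<dots> \<le> epowr (N * epowr (ennreal V) \<kappa>) (1 / P) * epowr (ennreal (exp (- s * P' * m c \<rho>) * (C1 * U))) (1 - 1 / P)"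
    using P1 GN[OF \<rho>, of c] int_u by (intro mult_mono epowr_mono) (auto simp: eV)
  also have "\<dots> = epowr N (1 / P) * ennreal (V powr (\<kappa> / P) * (exp (- s * m c \<rho>) * C1 powr (1 / P') * U powr (1 / P')))"
  proof -
    have "epowr (N * epowr (ennreal V) \<kappa>) (1 / P) = epowr N (1 / P) * ennreal (V powr (\<kappa> / P))"
      using P1 VU \<kappa> by (simp add: epowr_mult epowr_ennreal powr_powr)
    moreover have "epowr (ennreal (exp (- s * P' * m c \<rho>) * (C1 * U))) (1 / P') = ennreal (exp (- s * m c \<rho>) * C1 powr (1 / P') * U powr (1 / P'))"
    proof -
      have "(exp (- s * P' * m c \<rho>) * (C1 * U)) powr (1 / P') = exp (- s * P' * m c \<rho>) powr (1 / P') * (C1 powr (1 / P') * U powr (1 / P'))"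
        using C1 VU by (simp add: powr_mult)
      also have "exp (- s * P' * m c \<rho>) powr (1 / P') = exp (- s * m c \<rho>)"
        using QP by (simp add: powr_def)
      finally show ?thesis using QP C1 VU by (simp add: epowr_ennreal mult.assoc)
    qed
    ultimately show ?thesis unfolding inv(4) using VU C1 by (simp add: ennreal_mult mult.assoc)
  qed
  finally have "ennreal (\<rho> powr (- real DIM('a) * e)) * (\<integral>\<^sup>+y\<in>ball c \<rho>. ennreal (exp (- s * \<beta> y)) * G y \<partial>lborel)
    \<le> ennreal (\<rho> powr (- real DIM('a) * e)) * (epowr N (1 / P) * ennreal (V powr (\<kappa> / P) * (exp (- s * m c \<rho>) * C1 powr (1 / P') * U powr (1 / P'))))"
    by (rule mult_left_mono) simp
  also have "\<dots> = epowr N (1 / P) * ennreal (\<rho> powr (- real DIM('a) * e) * (V powr (\<kappa> / P) * (exp (- s * m c \<rho>) * C1 powr (1 / P') * U powr (1 / P'))))"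
    by (subst ennreal_mult) (auto simp: mult_ac)
  also have "\<dots> \<le> epowr N (1 / P) * ennreal (C1 powr (1 / P') * (K * \<omega>) powr e * V0 powr (- \<tau>) * exp (- s * m c r))"
  proof (intro mult_left_mono ennreal_leI)
    \<comment> \<open>The Muckenhoupt condition to the power \<open>e\<close> trades the radius
      factor and \<open>U powr (1 / P')\<close> for \<open>V powr (- (1 / Q))\<close>. Together with
      \<open>V powr (\<kappa> / P)\<close> from the Morrey bound the total power of \<open>V\<close>
      is \<open>- \<tau>\<close>.\<close>
    have "ennreal (V powr a * U powr (1 - a)) \<le> ennreal (K * (\<omega> * \<rho> ^ DIM('a)))"
      using char[OF \<rho>, of c] a VU K_pos \<rho> \<omega> unfolding eV by (simp add: epowr_ennreal ennreal_mult emeasure_ball \<omega>_def[symmetric])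
    then have "V powr a * U powr (1 - a) \<le> K * \<omega> * \<rho> powr (real DIM('a))"
      using K_pos \<rho> \<omega> by (simp add: ennreal_le_iff powr_realpow mult.assoc)
    then have "(V powr a * U powr (1 - a)) powr e \<le> (K * \<omega> * \<rho> powr (real DIM('a))) powr e"
      using e by (intro powr_mono2) auto
    then have "V powr (1 / Q) * U powr (1 / P') \<le> (K * \<omega>) powr e * \<rho> powr (real DIM('a) * e)"
      using K_pos \<omega> \<rho> VU unfolding inv by (simp add: powr_mult powr_powr mult_ac)
    then have "\<rho> powr (- real DIM('a) * e) * (V powr (- (1 / Q)) * (V powr (1 / Q) * U powr (1 / P')))
       \<le> \<rho> powr (- real DIM('a) * e) * (V powr (- (1 / Q)) * ((K * \<omega>) powr e * \<rho> powr (real DIM('a) * e)))"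
      by (intro mult_left_mono) auto
    then have 1: "\<rho> powr (- real DIM('a) * e) * U powr (1 / P') \<le> (K * \<omega>) powr e * V powr (- (1 / Q))"
      using VU \<rho> by (simp add: powr_minus field_simps)
    \<comment> \<open>In logarithms, reverse doubling gains
      \<open>k * \<tau> * \<bar>ln \<delta>\<bar>\<close>, while the drift of the means loses at
      most \<open>k\<close> times the left-hand side of assumption \<open>s\<close>.\<close>
    have 2: "V powr (- \<tau>) * exp (- s * m c \<rho>) \<le> V0 powr (- \<tau>) * exp (- s * m c r)"
    proof -
      have "ennreal V0 \<le> ennreal (\<delta> ^ k * V)"
        using \<delta>(3)[OF r, of c k] VU \<delta> by (simp add: \<rho>_def[symmetric] eV ennreal_mult)
      then have "V0 \<le> \<delta> ^ k * V" using VU \<delta> by (simp add: ennreal_le_iff)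
      then have "ln V0 \<le> ln (\<delta> ^ k * V)" using VU \<delta> by (subst ln_le_cancel_iff) auto
      also have "\<dots> = real k * ln \<delta> + ln V" using VU \<delta> by (simp add: ln_mult ln_realpow)
      finally have "\<tau> * (ln V0 - ln V) \<le> \<tau> * (real k * ln \<delta>)" using \<tau> by (intro mult_left_mono) auto
      moreover have "s * m c r - s * m c \<rho> \<le> real k * (\<bar>s\<bar> * (L * (1 + 2 ^ DIM('a))))"
      proof -
        have "s * m c r - s * m c \<rho> \<le> \<bar>s\<bar> * \<bar>m c r - m c \<rho>\<bar>"
          by (metis abs_ge_self abs_mult right_diff_distrib)
        also have "\<dots> \<le> \<bar>s\<bar> * (real k * (L * (1 + 2 ^ DIM('a))))"
          unfolding \<rho>_def by (intro mult_left_mono mean_steps r) simp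
        finally show ?thesis by (simp add: mult_ac)
      qed
      moreover have "real k * (\<bar>s\<bar> * (L * (1 + 2 ^ DIM('a)))) \<le> real k * (- \<tau> * ln \<delta>)"
        using s unfolding \<tau>_def by (intro mult_left_mono) auto
      ultimately have "- \<tau> * ln V - s * m c \<rho> \<le> - \<tau> * ln V0 - s * m c r"
        by (simp add: algebra_simps)
      then have "exp (- \<tau> * ln V + - s * m c \<rho>) \<le> exp (- \<tau> * ln V0 + - s * m c r)" by simp
      then show ?thesis unfolding exp_add using VU by (simp add: powr_def)
    qed
    have "\<rho> powr (- real DIM('a) * e) * (V powr (\<kappa> / P) * (exp (- s * m c \<rho>) * C1 powr (1 / P') * U powr (1 / P')))
      = C1 powr (1 / P') * exp (- s * m c \<rho>) * V powr (\<kappa> / P) * (\<rho> powr (- real DIM('a) * e) * U powr (1 / P'))"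
      by (simp add: mult_ac)
    also have "\<dots> \<le> C1 powr (1 / P') * exp (- s * m c \<rho>) * V powr (\<kappa> / P) * ((K * \<omega>) powr e * V powr (- (1 / Q)))"
      by (intro mult_left_mono 1) simp
    also have "\<dots> = C1 powr (1 / P') * (K * \<omega>) powr e * (V powr (- \<tau>) * exp (- s * m c \<rho>))"
    proof -
      have "C1 powr (1 / P') * exp (- s * m c \<rho>) * V powr (\<kappa> / P) * ((K * \<omega>) powr e * V powr (- (1 / Q)))
        = C1 powr (1 / P') * (K * \<omega>) powr e * ((V powr (\<kappa> / P) * V powr (- (1 / Q))) * exp (- s * m c \<rho>))"
        by (simp only: mult_ac)
      also have "V powr (\<kappa> / P) * V powr (- (1 / Q)) = V powr (- \<tau>)" by (simp add: powr_add[symmetric] \<tau>_def)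
      finally show ?thesis .
    qed
    also have "\<dots> \<le> C1 powr (1 / P') * (K * \<omega>) powr e * (V0 powr (- \<tau>) * exp (- s * m c r))"
      by (intro mult_left_mono 2) simp
    finally show "\<rho> powr (- real DIM('a) * e) * (V powr (\<kappa> / P) * (exp (- s * m c \<rho>) * C1 powr (1 / P') * U powr (1 / P')))
      \<le> C1 powr (1 / P') * (K * \<omega>) powr e * V0 powr (- \<tau>) * exp (- s * m c r)" by (simp add: mult.assoc)
  qed simp
  finally show ?thesis unfolding \<rho>_def V0_def \<omega>_def \<tau>_def .
qed

end

text \<open>A ball through a point of \<open>ball c r\<close> that leaves the doubled ball has
  radius more than \<open>r / 2\<close>. It therefore lies in a dyadic dilate whose radius is
  between 4 and 8 times its own, which explains the constant.\<close>

lemma frac_maximal_far: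
  fixes G :: "'a::euclidean_space \<Rightarrow> ennreal" and x c :: 'a
  assumes e: "0 < e"
    and G [measurable]: "G \<in> borel_measurable borel"
    and r: "0 < r" and x: "x \<in> ball c r"
    and dyadic: "\<And>k. ennreal ((2 ^ k * r) powr (- real DIM('a) * e)) * (\<integral>\<^sup>+y\<in>ball c (2 ^ k * r). G y \<partial>lborel) \<le> Z"
  shows "frac_maximal e (\<lambda>y. G y * indicator (- ball c (2 * r)) y) x \<le> ennreal (8 powr (real DIM('a) * e)) * Z"
proof (rule frac_maximal_least)
  fix d and \<rho> :: real assume \<rho>: "0 < \<rho>" and xd: "x \<in> ball d \<rho>"
  let ?n = "real DIM('a)"
  show "ennreal (\<rho> powr (- ?n * e)) * (\<integral>\<^sup>+y\<in>ball d \<rho>. (G y * indicator (- ball c (2 * r)) y) \<partial>lborel) \<le> ennreal (8 powr (?n * e)) * Z"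
  proof (cases "ball d \<rho> \<subseteq> ball c (2 * r)")
    case True
    then have "G y * indicator (- ball c (2 * r)) y * indicator (ball d \<rho>) y = 0" for y
      by (auto simp: indicator_def)
    then have "(\<integral>\<^sup>+y\<in>ball d \<rho>. (G y * indicator (- ball c (2 * r)) y) \<partial>lborel) = 0"
      by (simp only: nn_integral_const mult_zero_left)
    then show ?thesis by simp
  next
    case False
    then obtain y where y: "dist d y < \<rho>" "2 * r \<le> dist c y" by (auto simp: subset_eq not_less)
    have xc: "dist c x < r" "dist d x < \<rho>" using x xd by auto
    have "dist c y \<le> dist c x + dist x d + dist d y"
      using dist_triangle[of c y x] dist_triangle[of x y d] by linarith
    then have r2: "r < 2 * \<rho>" using y xc by (simp add: dist_commute)
    obtain k where k: "4 * \<rho> \<le> 2 ^ k * r" "2 ^ k * r \<le> 8 * \<rho>"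
    proof -
      obtain j where "4 * \<rho> / r < 2 ^ j" using real_arch_pow[of 2 "4 * \<rho> / r"] by auto
      then have ex: "\<exists>j. 4 * \<rho> \<le> 2 ^ j * r" using r by (intro exI[of _ j]) (simp add: pos_divide_less_eq)
      define k where "k = (LEAST j. 4 * \<rho> \<le> 2 ^ j * r)"
      have k: "4 * \<rho> \<le> 2 ^ k * r" unfolding k_def using ex by (rule LeastI_ex)
      \<comment> \<open>For \<open>k = 0\<close> one would have \<open>4 * \<rho> \<le> r\<close>,
        against \<open>r < 2 * \<rho>\<close>. Minimality can then be applied to the predecessor of
        \<open>k\<close>.\<close>
      have "k \<noteq> 0" using k r2 r by (intro notI) simp
      then obtain i where i: "k = Suc i" by (cases k) auto
      have "\<not> 4 * \<rho> \<le> 2 ^ i * r" using not_less_Least[of i "\<lambda>j. 4 * \<rho> \<le> 2 ^ j * r"] i unfolding k_def by simp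
      then have "2 * (2 ^ i * r) \<le> 8 * \<rho>" by linarith
      then have "2 ^ k * r \<le> 8 * \<rho>" using i by simp
      with k show ?thesis by (rule that)
    qed
    have sub: "ball d \<rho> \<subseteq> ball c (2 ^ k * r)"
    proof
      fix z assume "z \<in> ball d \<rho>"
      then have "dist d z < \<rho>" by simp
      then have "dist c z < r + 2 * \<rho>" using dist_triangle[of c z x] dist_triangle[of x z d] xc by (simp add: dist_commute)
      then show "z \<in> ball c (2 ^ k * r)" using r2 k by simp
    qed
    have "\<rho> powr (- ?n * e) \<le> ((2 ^ k * r) / 8) powr (- ?n * e)"
      using k \<rho> r e by (intro powr_mono2') auto
    also have "\<dots> = 8 powr (?n * e) * (2 ^ k * r) powr (- ?n * e)"
      using r by (simp add: powr_divide powr_minus divide_simps)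
    finally have "ennreal (\<rho> powr (- ?n * e)) * (\<integral>\<^sup>+y\<in>ball d \<rho>. (G y * indicator (- ball c (2 * r)) y) \<partial>lborel)
       \<le> ennreal (8 powr (?n * e) * (2 ^ k * r) powr (- ?n * e)) * (\<integral>\<^sup>+y\<in>ball c (2 ^ k * r). G y \<partial>lborel)"
      using sub by (intro mult_mono ennreal_leI nn_integral_mono) (auto simp: indicator_def)
    also have "\<dots> = ennreal (8 powr (?n * e)) * (ennreal ((2 ^ k * r) powr (- ?n * e)) * (\<integral>\<^sup>+y\<in>ball c (2 ^ k * r). G y \<partial>lborel))"
      by (simp add: ennreal_mult mult.assoc)
    also have "\<dots> \<le> ennreal (8 powr (?n * e)) * Z" by (intro mult_left_mono dyadic) simp
    finally show ?thesis .
  qed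
qed

context weight_pair_bmo
begin

text \<open>\<open>G\<close> is split at the doubled ball: the near part obeys the global bound for
  the perturbed weights, the far part is bounded by a constant on the ball. The threshold is fixed
  before \<open>s\<close>, so that a single parameter can later serve two functions and both
  signs.\<close>

theorem morrey_conjugate:
  assumes e: "0 < e" "e < 1"
  defines "Q \<equiv> 1 / (a * e)" and "P \<equiv> 1 / (a * e + 1 - e)"
  assumes \<kappa>: "0 < \<kappa>" "\<kappa> < P / Q"
  obtains \<gamma> where "0 < \<gamma>"
    "\<And>s. \<bar>s\<bar> \<le> \<gamma> \<Longrightarrow> \<exists>C\<ge>0. \<forall>G N. G \<in> borel_measurable borel \<longrightarrow>
       (\<forall>c r. 0 < r \<longrightarrow> (\<integral>\<^sup>+x\<in>ball c r. epowr (G x * ennreal (v x powr (a * e))) P \<partial>lborel) \<le> N * epowr (emeasure (wt v) (ball c r)) \<kappa>) \<longrightarrow>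
       (\<forall>c r. 0 < r \<longrightarrow>
         (\<integral>\<^sup>+x\<in>ball c r. epowr (ennreal (exp (s * \<beta> x)) * frac_maximal e (\<lambda>y. ennreal (exp (- s * \<beta> y)) * G y) x) Q \<partial>wt v)
           \<le> ennreal C * epowr N (Q / P) * epowr (emeasure (wt v) (ball c r)) (\<kappa> * Q / P))"
proof -
  define P' where "P' = 1 / (e * (1 - a))"
  have a: "0 < a" "a < 1" using a_pos a_less by auto
  have ae: "0 < a * e" using a e by simp
  have ae': "0 < a * e + 1 - e" using ae e by linarith
  have QP: "0 < Q" "0 < P" "0 < P'" using ae ae' a e by (auto simp: Q_def P_def P'_def)
  define \<tau> where "\<tau> = 1 / Q - \<kappa> / P"
  have \<tau>: "0 < \<tau>" using \<kappa> QP by (simp add: \<tau>_def field_simps)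
  obtain \<gamma>1 C1 where \<gamma>1: "0 < \<gamma>1" "0 < C1" and
    V1: "\<And>s c r. \<bar>s\<bar> \<le> \<gamma>1 \<Longrightarrow> 0 < r \<Longrightarrow>
      (\<integral>\<^sup>+y\<in>ball c r. ennreal (exp (s * (\<beta> y - m c r))) \<partial>wt v) \<le> ennreal C1 * emeasure (wt v) (ball c r)" and
    U1: "\<And>s c r. \<bar>s\<bar> \<le> \<gamma>1 \<Longrightarrow> 0 < r \<Longrightarrow>
      (\<integral>\<^sup>+y\<in>ball c r. ennreal (exp (s * (\<beta> y - m c r))) \<partial>wt u) \<le> ennreal C1 * emeasure (wt u) (ball c r)"
    by (rule exp_osc) blast
  obtain \<gamma>2 K' where \<gamma>2: "0 < \<gamma>2" and pair: "\<And>s. \<bar>s / a\<bar> \<le> \<gamma>2 \<Longrightarrow> \<bar>s / (1 - a)\<bar> \<le> \<gamma>2 \<Longrightarrow>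
      weight_pair (\<lambda>x. exp (s / a * \<beta> x) * v x) (\<lambda>x. exp (- s / (1 - a) * \<beta> x) * u x) a K'"
    by (rule perturb) blast
  obtain \<delta> where \<delta>: "0 < \<delta>" "\<delta> < 1"
    "\<And>c r k. 0 < r \<Longrightarrow> emeasure (wt v) (ball c r) \<le> ennreal (\<delta> ^ k) * emeasure (wt v) (ball c (2 ^ k * r))"
    by (rule reverse_doubling) blast
  \<comment> \<open>The first bound keeps \<open>s * Q\<close> and \<open>s * P'\<close> in the
    range of \<open>exp_osc\<close> and \<open>perturb\<close>; the second lets reverse doubling
    absorb the drift of the means, where \<open>\<tau>\<close> is positive by
    \<open>\<kappa> < P / Q\<close>.\<close>
  define \<gamma> where "\<gamma> = min (min \<gamma>1 \<gamma>2 / (Q + P')) (- \<tau> * ln \<delta> / (L * (1 + 2 ^ DIM('a))))"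
  have Lp: "0 < L * (1 + 2 ^ DIM('a))" using L_pos by (intro mult_pos_pos) (auto intro: add_pos_pos)
  have "0 < \<tau> * - ln \<delta>" using \<tau> \<delta> by (intro mult_pos_pos) (auto simp: ln_less_zero)
  then have "0 < \<gamma>" using \<gamma>1 \<gamma>2 QP unfolding \<gamma>_def min_less_iff_conj
    by (intro conjI divide_pos_pos Lp) auto
  then show ?thesis
  proof (rule that)
    fix s assume s: "\<bar>s\<bar> \<le> \<gamma>"
    have "\<bar>s\<bar> \<le> min \<gamma>1 \<gamma>2 / (Q + P')" using s by (simp add: \<gamma>_def)
    then have "\<bar>s\<bar> * (Q + P') \<le> min \<gamma>1 \<gamma>2" using QP by (simp add: pos_le_divide_eq)
    moreover have "\<bar>s\<bar> * Q \<le> \<bar>s\<bar> * (Q + P')" "\<bar>s\<bar> * P' \<le> \<bar>s\<bar> * (Q + P')" using QP by (intro mult_left_mono; simp)+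
    ultimately have sQ: "\<bar>s\<bar> * Q \<le> \<gamma>1" "\<bar>s\<bar> * P' \<le> \<gamma>1" "\<bar>s\<bar> * Q \<le> \<gamma>2" "\<bar>s\<bar> * P' \<le> \<gamma>2" by auto
    have "\<bar>s\<bar> \<le> - \<tau> * ln \<delta> / (L * (1 + 2 ^ DIM('a)))" using s by (simp add: \<gamma>_def)
    then have sL: "\<bar>s\<bar> * (L * (1 + 2 ^ DIM('a))) \<le> - \<tau> * ln \<delta>"
      unfolding pos_le_divide_eq[OF Lp] .
    \<comment> \<open>The parameter of \<open>perturb\<close> is \<open>s * Q * a\<close>: divided
      by \<open>a\<close> it is \<open>s * Q\<close>, divided by \<open>1 - a\<close> it is
      \<open>s * P'\<close>.\<close>
    have p: "weight_pair (\<lambda>x. exp (s * Q * \<beta> x) * v x) (\<lambda>x. exp (- (s * Q * a) / (1 - a) * \<beta> x) * u x) a K'"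
    proof -
      have "s * Q * a / a = s * Q" using a by simp
      moreover have "s * Q * a / (1 - a) = s * P'" using a e by (simp add: Q_def P'_def)
      ultimately show ?thesis using pair[of "s * Q * a"] sQ QP by (simp add: abs_mult)
    qed
    obtain C2 where C2: "0 \<le> C2" and
      local: "\<And>G :: 'a \<Rightarrow> ennreal. G \<in> borel_measurable borel \<Longrightarrow>
        (\<integral>\<^sup>+x. epowr (ennreal (exp (s * \<beta> x)) * frac_maximal e (\<lambda>y. ennreal (exp (- s * \<beta> y)) * G y) x) Q \<partial>wt v)
        \<le> ennreal C2 * epowr (\<integral>\<^sup>+x. epowr (G x * ennreal (v x powr (a * e))) P \<partial>lborel) (Q / P)"
      by (rule frac_maximal_conjugate[OF e p[unfolded Q_def], folded Q_def P_def]) blast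
    define D where "D = (K * 2 ^ DIM('a)) powr (1 / a)"
    have D: "0 \<le> D" by (simp add: D_def)
    define C3 where "C3 = C1 powr (1 / P') * (K * unit_ball_vol (real DIM('a))) powr e"
    define C4 where "C4 = 8 powr (real DIM('a) * e) * C3"
    have C4: "0 \<le> C4" "0 \<le> C3" by (auto simp: C4_def C3_def)
    define C where "C = 2 powr Q * (C2 * D powr (\<kappa> * Q / P) + C4 powr Q * C1)"
    have C: "0 \<le> C" using C2 \<gamma>1 by (simp add: C_def)
    show "\<exists>C\<ge>0. \<forall>G N. G \<in> borel_measurable borel \<longrightarrow>
       (\<forall>c r. 0 < r \<longrightarrow> (\<integral>\<^sup>+x\<in>ball c r. epowr (G x * ennreal (v x powr (a * e))) P \<partial>lborel) \<le> N * epowr (emeasure (wt v) (ball c r)) \<kappa>) \<longrightarrow>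
       (\<forall>c r. 0 < r \<longrightarrow>
         (\<integral>\<^sup>+x\<in>ball c r. epowr (ennreal (exp (s * \<beta> x)) * frac_maximal e (\<lambda>y. ennreal (exp (- s * \<beta> y)) * G y) x) Q \<partial>wt v)
           \<le> ennreal C * epowr N (Q / P) * epowr (emeasure (wt v) (ball c r)) (\<kappa> * Q / P))"
    proof (intro exI[of _ C] conjI C allI impI)
      fix G :: "'a \<Rightarrow> ennreal" and N and c :: 'a and r
      assume [measurable]: "G \<in> borel_measurable borel" and r: "0 < (r::real)"
        and GN: "\<forall>c r. 0 < r \<longrightarrow> (\<integral>\<^sup>+x\<in>ball c r. epowr (G x * ennreal (v x powr (a * e))) P \<partial>lborel) \<le> N * epowr (emeasure (wt v) (ball c r)) \<kappa>"
      let ?B = "ball c r" and ?B2 = "ball c (2 * r)" and ?E = "\<lambda>y. ennreal (exp (- s * \<beta> y))"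
      have [measurable]: "?B \<in> sets borel" "?B2 \<in> sets borel" by auto
      define V0 where "V0 = measure (wt v) ?B"
      have V0: "emeasure (wt v) ?B = ennreal V0" "0 < V0" using r by (auto simp: V0_def measure_ball measure_ball_pos)
      define G1 where "G1 y = G y * indicator ?B2 y" for y
      define G2 where "G2 y = G y * indicator (- ?B2) y" for y
      have [measurable]: "G1 \<in> borel_measurable borel" "G2 \<in> borel_measurable borel"
        unfolding G1_def G2_def by measurable
      \<comment> \<open>Constant on the ball. Its factor \<open>exp (- s * m c r)\<close> turns the
        outer \<open>exp (s * \<beta> x)\<close> into an exponential of the oscillation around the
        constant of this ball.\<close>
      define Y where "Y = epowr N (1 / P) * ennreal (C4 * V0 powr (- \<tau>) * exp (- s * m c r))"
      have far: "frac_maximal e (\<lambda>y. ?E y * G2 y) x \<le> Y" if x: "x \<in> ?B" for x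
      proof -
        have "frac_maximal e (\<lambda>y. ?E y * G2 y) x = frac_maximal e (\<lambda>y. (?E y * G y) * indicator (- ?B2) y) x"
          by (simp add: G2_def mult.assoc)
        also have "\<dots> \<le> ennreal (8 powr (real DIM('a) * e)) * (epowr N (1 / P) * ennreal (C3 * V0 powr (- \<tau>) * exp (- s * m c r)))"
        proof (rule frac_maximal_far[OF e(1) _ r x])
          fix k
          show "ennreal ((2 ^ k * r) powr (- real DIM('a) * e)) * (\<integral>\<^sup>+y\<in>ball c (2 ^ k * r). (?E y * G y) \<partial>lborel)
            \<le> epowr N (1 / P) * ennreal (C3 * V0 powr (- \<tau>) * exp (- s * m c r))"
            unfolding C3_def V0_def \<tau>_def Q_def P_def P'_def
          proof (rule dyadic_ball_bound[OF e \<kappa>[unfolded Q_def P_def] \<gamma>1(2) _ \<delta>])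
            show "(\<integral>\<^sup>+y\<in>ball c r. ennreal (exp (- s * (1 / (e * (1 - a))) * (\<beta> y - m c r))) \<partial>wt u) \<le> ennreal C1 * emeasure (wt u) (ball c r)"
              if "0 < r" for c r
              using sQ QP that by (intro U1) (auto simp: P'_def[symmetric] abs_mult)
          qed (use sL[unfolded \<tau>_def Q_def P_def] GN[unfolded P_def] r in auto)
        qed measurable
        also have "\<dots> = Y" using C4 by (simp add: Y_def C4_def ennreal_mult mult_ac)
        finally show ?thesis .
      qed
      have "(\<integral>\<^sup>+x\<in>?B. epowr (ennreal (exp (s * \<beta> x)) * frac_maximal e (\<lambda>y. ?E y * G y) x) Q \<partial>wt v)
        \<le> (\<integral>\<^sup>+x. ennreal (2 powr Q) * (epowr (ennreal (exp (s * \<beta> x)) * frac_maximal e (\<lambda>y. ?E y * G1 y) x) Q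
              + epowr (ennreal (exp (s * \<beta> x)) * Y) Q * indicator ?B x) \<partial>wt v)"
      proof (rule nn_integral_mono)
        fix x
        show "epowr (ennreal (exp (s * \<beta> x)) * frac_maximal e (\<lambda>y. ?E y * G y) x) Q * indicator ?B x
          \<le> ennreal (2 powr Q) * (epowr (ennreal (exp (s * \<beta> x)) * frac_maximal e (\<lambda>y. ?E y * G1 y) x) Q
              + epowr (ennreal (exp (s * \<beta> x)) * Y) Q * indicator ?B x)"
        proof (cases "x \<in> ?B")
          case True
          have "(\<lambda>y. ?E y * G y) = (\<lambda>y. ?E y * G1 y + ?E y * G2 y)"
            by (rule ext) (auto simp: G1_def G2_def indicator_def)
          then have "frac_maximal e (\<lambda>y. ?E y * G y) x \<le> frac_maximal e (\<lambda>y. ?E y * G1 y) x + frac_maximal e (\<lambda>y. ?E y * G2 y) x"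
            using frac_maximal_add_le[of "\<lambda>y. ?E y * G1 y" "\<lambda>y. ?E y * G2 y" e x] by simp
          also have "\<dots> \<le> frac_maximal e (\<lambda>y. ?E y * G1 y) x + Y" by (intro add_left_mono far True)
          finally have "epowr (ennreal (exp (s * \<beta> x)) * frac_maximal e (\<lambda>y. ?E y * G y) x) Q
             \<le> epowr (ennreal (exp (s * \<beta> x)) * frac_maximal e (\<lambda>y. ?E y * G1 y) x + ennreal (exp (s * \<beta> x)) * Y) Q"
            unfolding distrib_left[symmetric] using QP by (intro epowr_mono mult_left_mono) auto
          also have "\<dots> \<le> ennreal (2 powr Q) * (epowr (ennreal (exp (s * \<beta> x)) * frac_maximal e (\<lambda>y. ?E y * G1 y) x) Q + epowr (ennreal (exp (s * \<beta> x)) * Y) Q)"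
            by (rule epowr_sum_le[OF QP(1)])
          finally show ?thesis using True by simp
        qed simp
      qed
      also have "\<dots> = ennreal (2 powr Q) * ((\<integral>\<^sup>+x. epowr (ennreal (exp (s * \<beta> x)) * frac_maximal e (\<lambda>y. ?E y * G1 y) x) Q \<partial>wt v)
              + (\<integral>\<^sup>+x\<in>?B. epowr (ennreal (exp (s * \<beta> x)) * Y) Q \<partial>wt v))"
        by (subst nn_integral_cmult, measurable, subst nn_integral_add, measurable)
      also have "\<dots> \<le> ennreal (2 powr Q) * (ennreal (C2 * D powr (\<kappa> * Q / P)) * (epowr N (Q / P) * ennreal (V0 powr (\<kappa> * Q / P)))
          + ennreal (C4 powr Q * C1) * (epowr N (Q / P) * ennreal (V0 powr (\<kappa> * Q / P))))"
      proof (intro mult_left_mono add_mono)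
        have "(\<integral>\<^sup>+x. epowr (ennreal (exp (s * \<beta> x)) * frac_maximal e (\<lambda>y. ?E y * G1 y) x) Q \<partial>wt v)
           \<le> ennreal C2 * epowr (\<integral>\<^sup>+x. epowr (G1 x * ennreal (v x powr (a * e))) P \<partial>lborel) (Q / P)"
          by (rule local) measurable
        also have "\<dots> \<le> ennreal C2 * (epowr N (Q / P) * ennreal ((D * V0) powr (\<kappa> * Q / P)))"
        proof (rule mult_left_mono)
          have "(\<integral>\<^sup>+x. epowr (G1 x * ennreal (v x powr (a * e))) P \<partial>lborel) = (\<integral>\<^sup>+x\<in>?B2. epowr (G x * ennreal (v x powr (a * e))) P \<partial>lborel)"
            using QP by (intro nn_integral_cong) (auto simp: G1_def indicator_def)
          also have "\<dots> \<le> N * epowr (emeasure (wt v) ?B2) \<kappa>"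
            using GN r by simp
          also have "\<dots> \<le> N * epowr (ennreal (D * V0)) \<kappa>"
          proof (intro mult_left_mono epowr_mono)
            show "emeasure (wt v) ?B2 \<le> ennreal (D * V0)"
              using enlarge[OF r, of 2 c] V0 D by (simp add: D_def ennreal_mult)
          qed (use \<kappa> in auto)
          finally have "epowr (\<integral>\<^sup>+x. epowr (G1 x * ennreal (v x powr (a * e))) P \<partial>lborel) (Q / P) \<le> epowr (N * epowr (ennreal (D * V0)) \<kappa>) (Q / P)"
            using QP by (intro epowr_mono) auto
          also have "\<dots> = epowr N (Q / P) * ennreal ((D * V0) powr (\<kappa> * Q / P))"
            using QP D V0 \<kappa> by (simp add: epowr_mult epowr_ennreal powr_powr)
          finally show "epowr (\<integral>\<^sup>+x. epowr (G1 x * ennreal (v x powr (a * e))) P \<partial>lborel) (Q / P)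
            \<le> epowr N (Q / P) * ennreal ((D * V0) powr (\<kappa> * Q / P))" .
        qed simp
        also have "\<dots> = ennreal (C2 * D powr (\<kappa> * Q / P)) * (epowr N (Q / P) * ennreal (V0 powr (\<kappa> * Q / P)))"
          using C2 D V0 by (simp add: powr_mult ennreal_mult mult_ac)
        finally show "(\<integral>\<^sup>+x. epowr (ennreal (exp (s * \<beta> x)) * frac_maximal e (\<lambda>y. ?E y * G1 y) x) Q \<partial>wt v)
           \<le> ennreal (C2 * D powr (\<kappa> * Q / P)) * (epowr N (Q / P) * ennreal (V0 powr (\<kappa> * Q / P)))" .
      next
        have "(\<integral>\<^sup>+x\<in>?B. epowr (ennreal (exp (s * \<beta> x)) * Y) Q \<partial>wt v)
          = (\<integral>\<^sup>+x. (epowr N (Q / P) * ennreal (C4 powr Q * V0 powr (- \<tau> * Q))) * (ennreal (exp ((s * Q) * (\<beta> x - m c r))) * indicator ?B x) \<partial>wt v)"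
        proof (rule nn_integral_cong)
          fix x
          have "epowr (ennreal (exp (s * \<beta> x)) * Y) Q = epowr N (Q / P) * epowr (ennreal (exp (s * \<beta> x) * (C4 * V0 powr (- \<tau>) * exp (- s * m c r)))) Q"
            using QP C4 by (simp add: Y_def epowr_mult epowr_epowr ennreal_mult mult_ac)
          also have "exp (s * \<beta> x) * (C4 * V0 powr (- \<tau>) * exp (- s * m c r)) = C4 * V0 powr (- \<tau>) * exp (s * (\<beta> x - m c r))"
            by (simp add: exp_add[symmetric] algebra_simps exp_diff exp_minus field_simps)
          also have "epowr (ennreal (C4 * V0 powr (- \<tau>) * exp (s * (\<beta> x - m c r)))) Q = ennreal (C4 powr Q * V0 powr (- \<tau> * Q) * exp ((s * Q) * (\<beta> x - m c r)))"
          proof -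
            have "exp (s * (\<beta> x - m c r)) powr Q = exp ((s * Q) * (\<beta> x - m c r))" by (simp add: powr_def mult_ac)
            then show ?thesis using QP C4 by (simp add: epowr_ennreal powr_mult powr_powr)
          qed
          finally show "epowr (ennreal (exp (s * \<beta> x)) * Y) Q * indicator ?B x
            = (epowr N (Q / P) * ennreal (C4 powr Q * V0 powr (- \<tau> * Q))) * (ennreal (exp ((s * Q) * (\<beta> x - m c r))) * indicator ?B x)"
            by (simp add: ennreal_mult mult.assoc)
        qed
        also have "\<dots> = (epowr N (Q / P) * ennreal (C4 powr Q * V0 powr (- \<tau> * Q))) * (\<integral>\<^sup>+x\<in>?B. ennreal (exp ((s * Q) * (\<beta> x - m c r))) \<partial>wt v)"
          by (rule nn_integral_cmult) measurable
        also have "\<dots> \<le> (epowr N (Q / P) * ennreal (C4 powr Q * V0 powr (- \<tau> * Q))) * (ennreal C1 * emeasure (wt v) ?B)"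
          using sQ QP r by (intro mult_left_mono V1) (auto simp: abs_mult)
        also have "\<dots> = ennreal (C4 powr Q * C1) * (epowr N (Q / P) * ennreal (V0 powr (\<kappa> * Q / P)))"
        proof -
          \<comment> \<open>The first power of \<open>V0\<close> comes from the exponential moment,
            which is bounded by a multiple of the measure of the ball.\<close>
          have "- \<tau> * Q + 1 = \<kappa> * Q / P" using QP by (simp add: \<tau>_def field_simps)
          then have "V0 powr (\<kappa> * Q / P) = V0 powr (- \<tau> * Q) * V0"
            using V0 by (metis powr_add powr_one less_imp_le)
          then show ?thesis using V0 \<gamma>1 by (simp add: ennreal_mult mult_ac)
        qed
        finally show "(\<integral>\<^sup>+x\<in>?B. epowr (ennreal (exp (s * \<beta> x)) * Y) Q \<partial>wt v)
           \<le> ennreal (C4 powr Q * C1) * (epowr N (Q / P) * ennreal (V0 powr (\<kappa> * Q / P)))" .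
      qed simp
      also have "\<dots> = ennreal C * epowr N (Q / P) * epowr (emeasure (wt v) ?B) (\<kappa> * Q / P)"
      proof -
        have "ennreal C = ennreal (2 powr Q) * (ennreal (C2 * D powr (\<kappa> * Q / P)) + ennreal (C4 powr Q * C1))"
          using C2 \<gamma>1 unfolding C_def by (subst ennreal_mult) (auto simp: ennreal_plus)
        then show ?thesis
          unfolding distrib_right[symmetric] V0 using QP \<kappa> V0 by (simp add: epowr_ennreal mult.assoc)
      qed
      finally show "(\<integral>\<^sup>+x\<in>?B. epowr (ennreal (exp (s * \<beta> x)) * frac_maximal e (\<lambda>y. ?E y * G y) x) Q \<partial>wt v)
           \<le> ennreal C * epowr N (Q / P) * epowr (emeasure (wt v) ?B) (\<kappa> * Q / P)" .
    qed
  qed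
qed

end

section \<open>Real coordinates on a normed field\<close>

definition poly_at :: "'k::real_field \<Rightarrow> real poly \<Rightarrow> 'k" where
  "poly_at x p = poly (map_poly of_real p) x"

lemma poly_at_pCons [simp]: "poly_at x (pCons a p) = of_real a + x * poly_at x p"
  by (simp add: poly_at_def map_poly_pCons)

lemma poly_at_0 [simp]: "poly_at x 0 = 0"
  by (simp add: poly_at_def)

lemma poly_at_add [simp]: "poly_at x (p + q) = poly_at x p + poly_at x q"
  by (induction p q rule: poly_induct2) (simp_all add: algebra_simps)

lemma poly_at_smult [simp]: "poly_at x (smult c p) = of_real c * poly_at x p"
  by (induction p) (simp_all add: algebra_simps)

lemma poly_at_diff [simp]: "poly_at x (p - q) = poly_at x p - poly_at x q"
  using poly_at_add[of x "p - q" q] by (simp add: algebra_simps)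

lemma poly_at_mult [simp]: "poly_at x (p * q) = poly_at x p * poly_at x q"
  by (induction p) (simp_all add: algebra_simps)

lemma poly_at_1 [simp]: "poly_at x 1 = 1"
  by (simp add: one_pCons)

lemma poly_at_power [simp]: "poly_at x (p ^ n) = poly_at x p ^ n"
  by (induction n) simp_all

lemma poly_at_of_real: "poly_at (of_real a :: 'k::real_field) p = of_real (poly p a)"
  by (induction p) simp_all

text \<open>A complex root exists. If it is not real, the real quadratic with this root and its
  conjugate divides \<open>q\<close>, since a real remainder of degree at most 1 that vanishes at a
  non-real point is 0.\<close>

lemma real_poly_factor:
  fixes q :: "real poly"
  assumes "degree q \<noteq> 0"
  obtains a where "[:- a, 1:] dvd q" | a b where "[:a\<^sup>2 + b\<^sup>2, - 2 * a, 1:] dvd q"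
proof -
  have deg: "degree (map_poly of_real q :: complex poly) = degree q" by (intro degree_map_poly) simp
  have "\<not> (\<exists>a l. a \<noteq> 0 \<and> l = 0 \<and> (map_poly of_real q :: complex poly) = pCons a l)"
    using assms deg by auto
  then obtain z :: complex where "poly (map_poly of_real q) z = 0"
    using fundamental_theorem_of_algebra_alt by blast
  then have z: "poly_at z q = 0" by (simp add: poly_at_def)
  show ?thesis
  proof (cases "Im z = 0")
    case True
    then have "z = of_real (Re z)" by (simp add: complex_eq_iff)
    then have "poly q (Re z) = 0" using z poly_at_of_real[of "Re z" q, where 'k=complex] by simp
    then show ?thesis using that(1) by (simp add: poly_eq_0_iff_dvd)
  next
    case False
    define r where "r = [:(Re z)\<^sup>2 + (Im z)\<^sup>2, - 2 * Re z, 1:]"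
    have "poly_at z r = 0"
      by (simp add: r_def complex_eq_iff power2_eq_square)
    moreover have "q = r * (q div r) + q mod r" by simp
    then have "poly_at z q = poly_at z r * poly_at z (q div r) + poly_at z (q mod r)"
      by (metis poly_at_add poly_at_mult)
    ultimately have 0: "poly_at z (q mod r) = 0" using z by simp
    have "r \<noteq> 0" "degree r = 2" by (auto simp: r_def)
    then have "q mod r = 0 \<or> degree (q mod r) < 2" using degree_mod_less[of r q] by simp
    then have "degree (q mod r) \<le> 1" by auto
    then obtain c d where cd: "q mod r = [:c, d:]"
      by (metis One_nat_def degree_eq_zeroE le_Suc_eq le_zero_eq pCons_0_0 degree_pCons_eq_if pCons_cases nat.inject)
    have "d = 0" "c = 0" using 0 False unfolding cd by (auto simp: complex_eq_iff)
    then have "r dvd q" using cd by (simp add: dvd_eq_mod_eq_0)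
    then show ?thesis unfolding r_def by (rule that(2))
  qed
qed

text \<open>Peels off factors one by one. A quadratic factor has norm at least \<open>m\<close>, a
  linear one at least the square root of \<open>m\<close> (the case \<open>b = 0\<close>), which is
  why the norm is squared and the exponent counts degrees.\<close>

lemma monic_poly_at_norm_ge:
  fixes x :: "'k::real_normed_field"
  assumes m: "0 \<le> m" "\<And>a b. m \<le> norm ((x - of_real a)\<^sup>2 + of_real (b\<^sup>2))"
  shows "lead_coeff q = 1 \<Longrightarrow> m ^ degree q \<le> norm (poly_at x q) ^ 2"
proof (induction "degree q" arbitrary: q rule: less_induct)
  case less
  show ?case
  proof (cases "degree q = 0")
    case True
    then obtain c where "q = [:c:]" by (rule degree_eq_zeroE)
    then show ?thesis using less.prems by simp
  next
    case False
    have q0: "q \<noteq> 0" using less.prems by auto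
    have step: "m ^ degree q \<le> norm (poly_at x q) ^ 2"
      if r: "r dvd q" "lead_coeff r = 1" "degree r \<noteq> 0" "m ^ degree r \<le> norm (poly_at x r) ^ 2" for r
    proof -
      obtain t where t: "q = r * t" using r(1) by (rule dvdE)
      have nz: "r \<noteq> 0" "t \<noteq> 0" using q0 t by auto
      have lt: "lead_coeff t = 1" using less.prems r(2) unfolding t lead_coeff_mult by simp
      have dq: "degree q = degree r + degree t" using nz t by (simp add: degree_mult_eq)
      then have "m ^ degree t \<le> norm (poly_at x t) ^ 2" using r(3) lt by (intro less.hyps) auto
      then have "m ^ degree r * m ^ degree t \<le> norm (poly_at x r) ^ 2 * norm (poly_at x t) ^ 2"
        using r(4) m by (intro mult_mono) auto
      moreover have "m ^ degree q = m ^ degree r * m ^ degree t" by (simp add: dq power_add)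
      moreover have "norm (poly_at x q) ^ 2 = norm (poly_at x r) ^ 2 * norm (poly_at x t) ^ 2"
        by (simp add: t norm_mult power_mult_distrib)
      ultimately show ?thesis by simp
    qed
    from False show ?thesis
    proof (cases rule: real_poly_factor)
      case (1 a)
      have "m \<le> norm (x - of_real a) ^ 2" using m(2)[of a 0] by (simp add: norm_power)
      with 1 show ?thesis by (intro step) (auto simp: algebra_simps)
    next
      case (2 a b)
      have "poly_at x [:a\<^sup>2 + b\<^sup>2, - 2 * a, 1:] = (x - of_real a)\<^sup>2 + of_real (b\<^sup>2)"
        by (simp add: power2_eq_square algebra_simps)
      moreover have "m ^ 2 \<le> norm ((x - of_real a)\<^sup>2 + of_real (b\<^sup>2)) ^ 2"
        using m by (intro power_mono)
      ultimately show ?thesis using 2 by (intro step) (auto simp del: poly_at_pCons simp: numeral_2_eq_2)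
    qed
  qed
qed

text \<open>The elementary proof of the Gelfand--Mazur theorem for a multiplicative norm: a nonzero minimum of
  \<open>|(x - a)\<^sup>2 + b\<^sup>2|\<close>, attained at a point of maximal modulus, contradicts the factorization of
  \<open>p\<^sup>n - (-\<epsilon>)\<^sup>n\<close>, where \<open>p = (X - a)\<^sup>2 + b\<^sup>2\<close>.\<close>

lemma real_quadratic:
  fixes x :: "'k::real_normed_field"
  obtains a b where "(x - of_real a)\<^sup>2 + of_real (b\<^sup>2) = 0"
proof -
  define f where "f z = norm ((x - of_real (fst z))\<^sup>2 + of_real ((snd z)\<^sup>2))" for z :: "real \<times> real"
  have cont: "continuous_on S f" for S unfolding f_def by (intro continuous_intros)
  define N where "N = norm x"
  have N: "0 \<le> N" by (simp add: N_def)
  \<comment> \<open>Large enough that \<open>R * (R - 2 * N) > 2 * N\<^sup>2\<close>, so that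
    \<open>f\<close> exceeds \<open>f 0\<close> from this radius on and a minimum over the ball is a
    global one.\<close>
  define R where "R = 3 * N + 1"
  have big: "f 0 < f z" if "R \<le> norm z" for z
  proof -
    obtain a b where z: "z = (a, b)" by (cases z)
    have nz: "norm z ^ 2 = a\<^sup>2 + b\<^sup>2" by (simp add: z norm_Pair)
    have "\<bar>a\<bar> \<le> norm z" using norm_fst_le[of a b] by (simp add: z)
    have "(x - of_real a)\<^sup>2 + of_real (b\<^sup>2) = of_real (a\<^sup>2 + b\<^sup>2) - (of_real (2 * a) * x - x\<^sup>2)"
      by (simp add: power2_eq_square algebra_simps)
    then have "f z \<ge> norm (of_real (a\<^sup>2 + b\<^sup>2) :: 'k) - norm (of_real (2 * a) * x - x\<^sup>2)"
      unfolding f_def z fst_conv snd_conv by (metis norm_triangle_ineq2)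
    moreover have "norm (of_real (2 * a) * x - x\<^sup>2) \<le> 2 * \<bar>a\<bar> * N + N\<^sup>2"
      using norm_triangle_ineq4[of "of_real (2 * a) * x" "x\<^sup>2"]
      by (simp add: norm_mult norm_power N_def)
    moreover have "2 * \<bar>a\<bar> * N \<le> 2 * norm z * N" using \<open>\<bar>a\<bar> \<le> norm z\<close> N by (intro mult_right_mono) auto
    moreover have "norm (of_real (a\<^sup>2 + b\<^sup>2) :: 'k) = norm z ^ 2" unfolding nz norm_of_real by simp
    ultimately have "f z \<ge> norm z ^ 2 - 2 * norm z * N - N\<^sup>2" by linarith
    moreover have "norm z * (norm z - 2 * N) \<ge> R * (R - 2 * N)"
      using that N by (intro mult_mono) (auto simp: R_def)
    moreover have "R * (R - 2 * N) > 2 * N\<^sup>2"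
      using N by (simp add: R_def power2_eq_square algebra_simps add_pos_nonneg)
    moreover have "f 0 = N\<^sup>2" by (simp add: f_def N_def norm_power)
    ultimately show ?thesis by (simp add: power2_eq_square algebra_simps)
  qed
  have "R > 0" using N by (simp add: R_def)
  then obtain z1 where z1: "\<And>z. z \<in> cball 0 R \<Longrightarrow> f z1 \<le> f z"
    using continuous_attains_inf[OF compact_cball _ cont, of 0 R] by force
  define m where "m = f z1"
  have "m \<le> f 0" using z1[of 0] \<open>R > 0\<close> by (simp add: m_def)
  then have m_le: "m \<le> f z" for z
    using z1[of z] big[of z] by (cases "norm z \<le> R") (auto simp: m_def)
  show ?thesis
  proof (cases "m = 0")
    case True
    then show ?thesis using that[of "fst z1" "snd z1"] by (simp add: m_def f_def)
  next
    case False
    then have m: "0 < m" by (simp add: m_def f_def)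
    define D where "D = f -` {m}"
    have "closed D" unfolding D_def using cont[of UNIV] by (intro closed_vimage) auto
    moreover have "D \<subseteq> cball 0 R"
    proof
      fix z assume "z \<in> D"
      then have "\<not> f 0 < f z" using \<open>m \<le> f 0\<close> by (simp add: D_def)
      then show "z \<in> cball 0 R" using big[of z] by force
    qed
    ultimately have "compact D" by (metis compact_cball compact_Int_closed inf.absorb_iff2)
    moreover have "D \<noteq> {}" by (auto simp: D_def m_def)
    ultimately obtain z0 where z0: "z0 \<in> D" "\<And>z. z \<in> D \<Longrightarrow> norm z \<le> norm z0"
      using continuous_attains_sup[of D norm] continuous_on_norm_id by blast
    obtain a b where ab: "z0 = (a, b)" by (cases z0)
    \<comment> \<open>Adding \<open>\<epsilon>\<close> to \<open>b\<^sup>2\<close> leads to a point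
      of larger modulus, which is not a minimiser because \<open>z0\<close> is a farthest one. That
      \<open>\<epsilon> < m\<close> makes the powers of \<open>\<epsilon> / m\<close> tend to
      0.\<close>
    define \<epsilon> where "\<epsilon> = m / 2"
    define w where "w = (a, sqrt (b\<^sup>2 + \<epsilon>))"
    have sq: "(sqrt (b\<^sup>2 + \<epsilon>))\<^sup>2 = b\<^sup>2 + \<epsilon>" using m by (simp add: \<epsilon>_def)
    have "norm z0 < norm w"
      using m unfolding w_def ab norm_Pair by (intro real_sqrt_less_mono) (simp add: sq \<epsilon>_def)
    then have "f w \<noteq> m" using z0(2)[of w] unfolding D_def by force
    then have fw: "m < f w" using m_le[of w] by simp
    define p where "p = [:a\<^sup>2 + b\<^sup>2, - 2 * a, 1:]"
    define U where "U = poly_at x p"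
    have U: "U = (x - of_real a)\<^sup>2 + of_real (b\<^sup>2)"
      by (simp add: U_def p_def power2_eq_square algebra_simps)
    have nU: "norm U = m" using z0(1) by (simp add: D_def f_def ab U)
    have fw_eq: "f w = norm (U + of_real \<epsilon>)"
      by (simp add: f_def w_def sq U add.assoc)
    have "f w \<le> m * (1 + (1/2) ^ Suc n)" for n
    proof -
      define k where "k = Suc n"
      \<comment> \<open>The cofactor of \<open>p + \<epsilon>\<close>. It is monic of degree
        \<open>2 * n\<close>, hence has norm at least \<open>m ^ n\<close> at \<open>x\<close>,
        while its product with \<open>U + of_real \<epsilon>\<close> has norm at most
        \<open>m ^ k + \<epsilon> ^ k\<close>.\<close>
      define S where "S = (\<Sum>i<k. [:- \<epsilon>:] ^ (k - Suc i) * p ^ i)"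
      have fac: "p ^ k - [:- \<epsilon>:] ^ k = (p - [:- \<epsilon>:]) * S"
        unfolding S_def by (rule power_diff_sumr2)
      have lp: "lead_coeff p = 1" "degree p = 2" "p \<noteq> 0" by (auto simp: p_def)
      have l1: "degree (p - [:- \<epsilon>:]) = 2" "lead_coeff (p - [:- \<epsilon>:]) = 1" by (auto simp: p_def)
      have dpn: "degree (p ^ k) = 2 * k" using lp by (simp add: degree_power_eq)
      have c: "[:- \<epsilon>:] ^ k = [:(- \<epsilon>) ^ k:]" by (induction k) (simp_all add: one_pCons)
      have "degree (p ^ k + - [:(- \<epsilon>) ^ k:]) = 2 * k"
        using dpn by (subst degree_add_eq_left) (auto simp: k_def)
      then have d: "degree (p ^ k - [:- \<epsilon>:] ^ k) = 2 * k" by (simp only: c diff_conv_add_uminus)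
      have "coeff (p ^ k) (2 * k) = 1" using lead_coeff_power[of p k] lp dpn by simp
      then have "lead_coeff (p ^ k - [:- \<epsilon>:] ^ k) = 1"
        unfolding d unfolding c by (simp add: coeff_pCons k_def)
      then have lS: "lead_coeff S = 1" using l1 unfolding fac lead_coeff_mult by simp
      have nz: "S \<noteq> 0" "p - [:- \<epsilon>:] \<noteq> 0" using lS l1 by auto
      have "2 * k = 2 + degree S"
        using d[unfolded fac] degree_mult_eq[OF nz(2) nz(1)] l1(1) by simp
      then have dS: "degree S = 2 * n" by (simp add: k_def)
      have "m ^ degree S \<le> norm (poly_at x S) ^ 2"
        using m m_le lS unfolding f_def by (intro monic_poly_at_norm_ge) (auto simp: less_imp_le dest: spec[where x="(_, _)"])
      then have "(m ^ n) ^ 2 \<le> norm (poly_at x S) ^ 2" by (simp add: dS power_mult power_commutes mult.commute)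
      then have S_ge: "m ^ n \<le> norm (poly_at x S)" by (rule power2_le_imp_le) simp
      have "U ^ k - of_real ((- \<epsilon>) ^ k) = (U + of_real \<epsilon>) * poly_at x S"
        using arg_cong[OF fac, of "poly_at x"] by (simp add: U_def del: power_Suc)
      then have "f w * norm (poly_at x S) = norm (U ^ k - of_real ((- \<epsilon>) ^ k))"
        by (simp add: fw_eq norm_mult)
      also have "\<dots> \<le> norm (U ^ k) + norm (of_real ((- \<epsilon>) ^ k) :: 'k)" by (rule norm_triangle_ineq4)
      also have "\<dots> = m ^ k + \<epsilon> ^ k" using m by (simp add: norm_power norm_mult nU \<epsilon>_def)
      also have "\<dots> = m * (1 + (1/2) ^ Suc n) * m ^ n" by (simp add: \<epsilon>_def k_def power_divide field_simps)
      finally have "f w * norm (poly_at x S) \<le> m * (1 + (1/2) ^ Suc n) * m ^ n" .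
      moreover have "f w * m ^ n \<le> f w * norm (poly_at x S)" using S_ge by (intro mult_left_mono) (auto simp: f_def)
      ultimately have "f w * m ^ n \<le> m * (1 + (1/2) ^ Suc n) * m ^ n" by linarith
      then show ?thesis using m by (simp only: mult_le_cancel_right zero_less_power)
    qed
    moreover have "(\<lambda>n. m * (1 + (1/2) ^ Suc n)) \<longlonglongrightarrow> m * (1 + 0)"
      by (intro tendsto_intros LIMSEQ_Suc LIMSEQ_power_zero) simp
    ultimately have "f w \<le> m" by (intro LIMSEQ_le_const[of _ m "f w"]) auto
    with fw show ?thesis by simp
  qed
qed

text \<open>The field is either the reals, with \<open>j = 0\<close>, or spanned over them by 1 and
  an element with \<open>j\<^sup>2 = -1\<close> obtained from \<open>real_quadratic\<close>. The
  coordinates are recorded as Lipschitz maps because these preserve measurability and bounded mean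
  oscillation.\<close>

lemma real_coordinates:
  obtains A B :: "'k::real_normed_field \<Rightarrow> real" and j :: 'k where
    "\<And>x. x = of_real (A x) + of_real (B x) * j" "norm j \<le> 1"
    "\<And>x y. \<bar>A x - A y\<bar> \<le> 2 * norm (x - y)" "\<And>x y. \<bar>B x - B y\<bar> \<le> 2 * norm (x - y)"
proof (cases "\<forall>x::'k. \<exists>a. x = of_real a")
  case True
  then obtain A :: "'k \<Rightarrow> real" where A: "\<And>x. x = of_real (A x)" by metis
  have "\<bar>A x - A y\<bar> = norm (x - y)" for x y
    using A[of x] A[of y] by (metis norm_of_real of_real_diff)
  then show ?thesis using A by (intro that[of A "\<lambda>_. 0" 0]) auto
next
  case False
  then obtain x0 :: 'k where x0: "\<And>a. x0 \<noteq> of_real a" by blast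
  obtain a b where ab: "(x0 - of_real a)\<^sup>2 + of_real (b\<^sup>2) = 0" by (rule real_quadratic)
  have b: "b \<noteq> 0" using ab x0[of a] by auto
  define j where "j = (x0 - of_real a) / of_real b"
  have "j\<^sup>2 * of_real (b\<^sup>2) = - of_real (b\<^sup>2)"
    using ab b by (simp add: j_def power_divide eq_neg_iff_add_eq_0)
  then have jj: "j\<^sup>2 = -1" using b by (metis mult_cancel_right mult_minus1 of_real_eq_0_iff power_not_zero)
  have "norm j ^ 2 = 1" using jj by (metis norm_minus_cancel norm_one norm_power)
  then have nj: "norm j = 1" by (simp add: power2_eq_1_iff) (use norm_ge_zero[of j] in linarith)
  have ex: "\<exists>c d. y = of_real c + of_real d * j" for y :: 'k
  proof -
    obtain c d where "(y - of_real c)\<^sup>2 + of_real (d\<^sup>2) = 0" by (rule real_quadratic)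
    then have "(y - of_real c)\<^sup>2 = (of_real d * j)\<^sup>2"
      by (simp add: power_mult_distrib jj eq_neg_iff_add_eq_0)
    then have "y - of_real c = of_real d * j \<or> y - of_real c = - (of_real d * j)"
      by (simp only: power2_eq_iff)
    then show ?thesis
    proof
      assume "y - of_real c = of_real d * j"
      then show ?thesis by (intro exI[of _ c] exI[of _ d]) (simp add: algebra_simps)
    next
      assume "y - of_real c = - (of_real d * j)"
      then show ?thesis by (intro exI[of _ c] exI[of _ "- d"]) (simp add: algebra_simps)
    qed
  qed
  \<comment> \<open>Multiplying by the conjugate gives exactly \<open>c\<^sup>2 + d\<^sup>2\<close>,
    and the conjugate has norm at most \<open>\<bar>c\<bar> + \<bar>d\<bar>\<close>.\<close>
  have bound: "\<bar>c\<bar> + \<bar>d\<bar> \<le> 2 * norm (of_real c + of_real d * j)" for c d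
  proof (cases "\<bar>c\<bar> + \<bar>d\<bar> = 0")
    case False
    have "(of_real c + of_real d * j) * (of_real c - of_real d * j) = of_real (c\<^sup>2) - of_real (d\<^sup>2) * j\<^sup>2"
      by (simp add: power2_eq_square algebra_simps)
    then have "(of_real c + of_real d * j) * (of_real c - of_real d * j) = (of_real (c\<^sup>2 + d\<^sup>2) :: 'k)"
      by (simp add: jj)
    then have eq: "norm (of_real c + of_real d * j) * norm (of_real c - of_real d * j) = c\<^sup>2 + d\<^sup>2"
      by (metis abs_of_nonneg norm_mult norm_of_real sum_power2_ge_zero)
    have "norm (of_real c - of_real d * j) \<le> \<bar>c\<bar> + \<bar>d\<bar>"
      using norm_triangle_ineq4[of "of_real c :: 'k" "of_real d * j"] by (simp add: norm_mult nj)
    then have "c\<^sup>2 + d\<^sup>2 \<le> norm (of_real c + of_real d * j) * (\<bar>c\<bar> + \<bar>d\<bar>)"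
      unfolding eq[symmetric] by (intro mult_left_mono) auto
    moreover have "(\<bar>c\<bar> + \<bar>d\<bar>) * (\<bar>c\<bar> + \<bar>d\<bar>) \<le> 2 * (c\<^sup>2 + d\<^sup>2)"
      using zero_le_power2[of "\<bar>c\<bar> - \<bar>d\<bar>"] by (simp add: power2_eq_square algebra_simps)
    moreover have "y \<le> 2 * n * z" if "x \<le> n * z" "y \<le> 2 * x" for x y z n :: real
      using that by (simp add: mult.assoc)
    ultimately have "(\<bar>c\<bar> + \<bar>d\<bar>) * (\<bar>c\<bar> + \<bar>d\<bar>) \<le> 2 * norm (of_real c + of_real d * j) * (\<bar>c\<bar> + \<bar>d\<bar>)"
      by blast
    then show ?thesis using False by (subst (asm) mult_le_cancel_right) auto
  next
    case True
    then have "c = 0" "d = 0" by auto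
    then show ?thesis by simp
  qed
  obtain A B where AB: "\<And>y::'k. y = of_real (A y) + of_real (B y) * j" using ex by metis
  have "\<bar>A x - A y\<bar> + \<bar>B x - B y\<bar> \<le> 2 * norm (x - y)" for x y
  proof -
    have "x - y = of_real (A x - A y) + of_real (B x - B y) * j"
      using AB[of x] AB[of y] by (simp add: algebra_simps)
    then show ?thesis using bound[of "A x - A y" "B x - B y"] by simp
  qed
  then have "\<bar>A x - A y\<bar> \<le> 2 * norm (x - y)" "\<bar>B x - B y\<bar> \<le> 2 * norm (x - y)" for x y
    by (smt (verit))+
  then show ?thesis using AB nj by (intro that[of A B j]) auto
qed

section \<open>Homogeneous kernels\<close>

lemma nn_integral_cone_ball:
  fixes F :: "'a::euclidean_space \<Rightarrow> ennreal"
  assumes [measurable]: "F \<in> borel_measurable borel" and hom: "\<And>l z. 0 < l \<Longrightarrow> F (l *\<^sub>R z) = F z" and r: "0 < r"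
  shows "(\<integral>\<^sup>+z\<in>ball 0 r. F z \<partial>lborel) = ennreal (r ^ DIM('a)) * (\<integral>\<^sup>+z\<in>ball 0 1. F z \<partial>lborel)"
proof -
  have [measurable]: "ball (0::'a) r \<in> sets borel" "ball (0::'a) 1 \<in> sets borel" by auto
  have "(\<integral>\<^sup>+z\<in>ball 0 r. F z \<partial>lborel) = (\<integral>\<^sup>+z. F z * indicator (ball 0 r) z \<partial>density (distr lborel borel (\<lambda>x::'a. 0 + r *\<^sub>R x)) (\<lambda>_. ennreal (\<bar>r\<bar> ^ DIM('a))))"
    using lborel_affine[of r "0::'a"] r by simp
  also have "\<dots> = (\<integral>\<^sup>+z. ennreal (r ^ DIM('a)) * (F z * indicator (ball 0 r) z) \<partial>distr lborel borel (\<lambda>x::'a. 0 + r *\<^sub>R x))"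
    using r by (subst nn_integral_density) auto
  also have "\<dots> = (\<integral>\<^sup>+x. ennreal (r ^ DIM('a)) * (F (r *\<^sub>R x) * indicator (ball 0 r) (r *\<^sub>R x)) \<partial>lborel)"
    by (subst nn_integral_distr) auto
  also have "\<dots> = (\<integral>\<^sup>+x. ennreal (r ^ DIM('a)) * (F x * indicator (ball 0 1) x) \<partial>lborel)"
    using r by (intro nn_integral_cong) (auto simp: hom indicator_def)
  also have "\<dots> = ennreal (r ^ DIM('a)) * (\<integral>\<^sup>+z\<in>ball 0 1. F z \<partial>lborel)"
    by (rule nn_integral_cmult) measurable
  finally show ?thesis .
qed

lemma lborel_reflect: "lborel = distr lborel borel (\<lambda>y::'a::euclidean_space. x - y)"
  using lborel_affine[of "-1" x] by (simp add: density_1)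

lemma AE_reflect:
  fixes x :: "'a::euclidean_space"
  assumes "AE z in lborel. P z" shows "AE y in lborel. P (x - y)"
proof (rule AE_distrD[where f="\<lambda>y. x - y" and M'=borel])
  show "(\<lambda>y. x - y) \<in> lborel \<rightarrow>\<^sub>M borel" by measurable
  show "AE z in distr lborel borel (\<lambda>y. x - y). P z"
    using assms by (subst lborel_reflect[symmetric])
qed

lemma nn_integral_reflect:
  fixes x :: "'a::euclidean_space"
  assumes [measurable]: "F \<in> borel_measurable borel"
  shows "(\<integral>\<^sup>+y. F (x - y) \<partial>lborel) = (\<integral>\<^sup>+z. F z \<partial>lborel)"
  by (subst (2) lborel_reflect[of x], subst nn_integral_distr) auto

text \<open>The condition depends on the direction only, so a dilation carries it from the unit ball
  to any larger ball; countably many radii exhaust the space.\<close>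

lemma AE_cone:
  assumes ae: "AE z in lborel. z \<in> ball 0 1 - {0::'a::euclidean_space} \<longrightarrow> P (sgn z)"
  shows "AE z in lborel. (z::'a) \<noteq> 0 \<longrightarrow> P (sgn z)"
proof -
  have "AE z in lborel. z \<in> ball 0 (real (Suc k)) - {0::'a} \<longrightarrow> P (sgn z)" for k
  proof -
    define c where "c = 1 / real (Suc k)"
    have c: "0 < c" by (simp add: c_def)
    have "AE z in density (distr lborel borel (\<lambda>x::'a. 0 + c *\<^sub>R x)) (\<lambda>_. ennreal (\<bar>c\<bar> ^ DIM('a))). z \<in> ball 0 1 - {0} \<longrightarrow> P (sgn z)"
      by (subst lborel_affine[of c "0::'a", symmetric]) (use c ae in auto)
    then have "AE z in distr lborel borel (\<lambda>x::'a. 0 + c *\<^sub>R x). z \<in> ball 0 1 - {0} \<longrightarrow> P (sgn z)"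
      using c by (subst (asm) AE_density) auto
    then have "AE x in lborel. 0 + c *\<^sub>R (x::'a) \<in> ball 0 1 - {0} \<longrightarrow> P (sgn (0 + c *\<^sub>R x))"
      by (intro AE_distrD[where f="\<lambda>x. 0 + c *\<^sub>R x" and P="\<lambda>z. z \<in> ball 0 1 - {0} \<longrightarrow> P (sgn z)" and M'=borel]) auto
    then show ?thesis
      by eventually_elim (use c in \<open>auto simp: c_def sgn_scaleR field_simps\<close>)
  qed
  then have "AE z in lborel. \<forall>k. z \<in> ball 0 (real (Suc k)) - {0::'a} \<longrightarrow> P (sgn z)"
    unfolding AE_all_countable by blast
  then show ?thesis
  proof eventually_elim
    case (elim z)
    obtain k where "norm z < real k" using reals_Archimedean2 by blast
    then have "norm z < real (Suc k)" by simp
    then show ?case using elim[rule_format, of k] by simp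
  qed
qed

lemma punctured_ball_measure:
  "emeasure lborel (ball 0 1 - {0::'a::euclidean_space}) \<noteq> 0" "emeasure lborel (ball 0 1 - {0::'a::euclidean_space}) < top"
proof -
  have "emeasure lborel (ball 0 1 - {0::'a}) = emeasure lborel (ball (0::'a) 1)"
    by (intro emeasure_Diff_null_set) (auto simp: null_sets_def)
  then show "emeasure lborel (ball 0 1 - {0::'a}) \<noteq> 0" "emeasure lborel (ball 0 1 - {0::'a}) < top"
    using emeasure_lborel_ball_pos[of 1 "0::'a"] emeasure_lborel_ball_finite[of "0::'a" 1] by auto
qed

lemma divide_less_top_imp: "x / y < top \<Longrightarrow> y < top \<Longrightarrow> x < (top::ennreal)"
  by (cases "x = top") (auto simp: ennreal_top_divide less_top[symmetric])

lemma sgn_measurable_sphere: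
  "sgn \<in> measurable (uniform_measure (restrict_space lborel (ball 0 1 - {0})) (ball 0 1 - {0}))
     (restrict_space borel (sphere (0::'a::euclidean_space) 1))"
proof -
  have "sgn \<in> measurable (restrict_space lborel (ball 0 1 - {0::'a})) (restrict_space borel (sphere (0::'a) 1))"
    by (intro measurable_restrict_space3) (auto simp: norm_sgn)
  then show ?thesis by (simp cong: measurable_cong_sets)
qed

text \<open>Null sets of the sphere span Lebesgue null cones, because the sphere measure is the
  image under \<open>sgn\<close> of normalised Lebesgue measure on the punctured ball,
  completed.\<close>

lemma AE_sphere_measure:
  assumes "AE x in (sphere_measure :: 'a::euclidean_space measure). P x"
  shows "AE z in lborel. (z::'a) \<noteq> 0 \<longrightarrow> P (sgn z)"
proof (rule AE_cone)
  let ?A = "ball 0 1 - {0::'a}"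
  have "AE z in uniform_measure (restrict_space lborel ?A) ?A. P (sgn z)"
    using assms unfolding sphere_measure_def AE_completion_iff by (rule AE_distrD[OF sgn_measurable_sphere])
  then have "AE z in restrict_space lborel ?A. z \<in> ?A \<longrightarrow> P (sgn z)"
    using punctured_ball_measure[where 'a='a] by (subst (asm) AE_uniform_measure) (auto simp: emeasure_restrict_space)
  then show "AE z in lborel. z \<in> ?A \<longrightarrow> P (sgn z)"
    by (subst (asm) AE_restrict_space_iff) auto
qed

lemma nn_integral_sphere_measure:
  assumes [measurable]: "g \<in> borel_measurable (restrict_space borel (sphere (0::'a::euclidean_space) 1))"
  shows "(\<integral>\<^sup>+x. g x \<partial>sphere_measure) = (\<integral>\<^sup>+z\<in>ball 0 1 - {0::'a}. g (sgn z) \<partial>lborel) / emeasure lborel (ball 0 1 - {0::'a})"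
proof -
  let ?A = "ball 0 1 - {0::'a}"
  have [measurable]: "(\<lambda>z. g (sgn z)) \<in> borel_measurable (restrict_space lborel ?A)"
    using measurable_compose[OF sgn_measurable_sphere assms] by (simp cong: measurable_cong_sets)
  have "(\<integral>\<^sup>+x. g x \<partial>sphere_measure) = (\<integral>\<^sup>+z. g (sgn z) \<partial>uniform_measure (restrict_space lborel ?A) ?A)"
    unfolding sphere_measure_def nn_integral_completion by (rule nn_integral_distr[OF sgn_measurable_sphere]) simp
  also have "\<dots> = (\<integral>\<^sup>+z. g (sgn z) * indicator ?A z \<partial>restrict_space lborel ?A) / emeasure (restrict_space lborel ?A) ?A"
    by (rule nn_integral_uniform_measure) (auto simp: sets_restrict_space)
  also have "\<dots> = (\<integral>\<^sup>+z\<in>?A. g (sgn z) \<partial>lborel) / emeasure lborel ?A"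
    by (subst nn_integral_restrict_space) (auto simp: emeasure_restrict_space mult.assoc indicator_inter_arith[symmetric])
  finally show ?thesis .
qed

text \<open>Replaces the norm of the kernel by a Borel function that is nonnegative and homogeneous
  without exceptional points. In terms of it, the condition on the sphere becomes an essential bound
  or integrability over the unit ball.\<close>

lemma Lp_sphere_kernel:
  fixes \<Omega> :: "'a::euclidean_space \<Rightarrow> 'k::real_normed_field"
  assumes \<Omega>: "\<Omega> \<in> Lp_sphere s" and hom: "homogeneous_degree_zero \<Omega>" and s: "1 < s"
  obtains \<Omega>' :: "'a \<Rightarrow> real" where "\<Omega>' \<in> borel_measurable borel" "\<And>z. 0 \<le> \<Omega>' z"
    "\<And>l z. 0 < l \<Longrightarrow> \<Omega>' (l *\<^sub>R z) = \<Omega>' z" "AE z in lborel. norm (\<Omega> z) = \<Omega>' z"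
    "s = \<infinity> \<Longrightarrow> \<exists>K\<ge>0. AE z in lborel. \<Omega>' z \<le> K"
    "s \<noteq> \<infinity> \<Longrightarrow> (\<integral>\<^sup>+z\<in>ball 0 1. ennreal (\<Omega>' z powr real_of_ereal s) \<partial>lborel) < top"
proof -
  let ?S = "restrict_space borel (sphere (0::'a) 1)"
  let ?D = "distr (uniform_measure (restrict_space lborel (ball 0 1 - {0})) (ball 0 1 - {0})) ?S sgn"
  have "\<Omega> \<in> borel_measurable sphere_measure" using \<Omega> by (simp add: Lp_sphere_def)
  then have "(\<lambda>x. norm (\<Omega> x)) \<in> borel_measurable (completion ?D)"
    unfolding sphere_measure_def by measurable
  then obtain g where g: "g \<in> borel_measurable ?D" and gAE: "AE x in ?D. norm (\<Omega> x) = g x"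
    using completion_ex_borel_measurable_real by blast
  have gS [measurable]: "g \<in> borel_measurable ?S" using g by simp
  have gAE': "AE x in sphere_measure. norm (\<Omega> x) = g x"
    unfolding sphere_measure_def by (rule AE_completion) fact
  \<comment> \<open>Extension by 0 off the sphere gives a Borel function on the whole space. As
    \<open>sgn 0 = 0\<close> is not on the sphere, the kernel gets the value 0 at the
    origin.\<close>
  define g0 where "g0 x = indicator (sphere 0 1) x *\<^sub>R g x" for x
  have [measurable]: "g0 \<in> borel_measurable borel"
    using gS unfolding g0_def by (subst (asm) borel_measurable_restrict_space_iff) auto
  \<comment> \<open>\<open>g\<close> agrees with a norm only almost everywhere; the absolute value
    makes the kernel nonnegative at every point.\<close>
  define \<Omega>' where "\<Omega>' z = \<bar>g0 (sgn z)\<bar>" for z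
  have [measurable]: "\<Omega>' \<in> borel_measurable borel" unfolding \<Omega>'_def by measurable
  have g0_eq: "g0 (sgn z) = g (sgn z)" if "z \<noteq> 0" for z using that by (simp add: g0_def norm_sgn)
  have \<Omega>_sgn: "\<Omega> (sgn z) = \<Omega> z" if "z \<noteq> 0" for z
  proof -
    have "\<Omega> ((1 / norm z) *\<^sub>R z) = \<Omega> z" using hom that unfolding homogeneous_degree_zero_def by simp
    then show ?thesis by (simp add: sgn_div_norm inverse_eq_divide)
  qed
  have AE0: "AE z in lborel. (z::'a) \<noteq> 0" by (rule AE_lborel_singleton)
  have ae: "AE z in lborel. norm (\<Omega> z) = \<Omega>' z"
    using AE_sphere_measure[OF gAE'] AE0
  proof eventually_elim
    case (elim z)
    then have "norm (\<Omega> z) = g (sgn z)" using \<Omega>_sgn by simp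
    then show ?case using elim g0_eq[of z] by (simp add: \<Omega>'_def) (metis abs_of_nonneg norm_ge_zero)
  qed
  show ?thesis
  proof (rule that[of \<Omega>'])
    show "\<Omega>' (l *\<^sub>R z) = \<Omega>' z" if "0 < l" for l z using that by (simp add: \<Omega>'_def sgn_scaleR)
    show "\<exists>K\<ge>0. AE z in lborel. \<Omega>' z \<le> K" if "s = \<infinity>"
    proof -
      define E where "E = esssup sphere_measure (\<lambda>x. ereal (norm (\<Omega> x)))"
      have "E < \<infinity>" using \<Omega> that by (simp add: Lp_sphere_def E_def)
      then obtain K where K: "0 \<le> K" "E \<le> ereal K"
      proof (cases E)
        case (real r)
        then have "0 \<le> max 0 r" "E \<le> ereal (max 0 r)" by auto
        then show ?thesis by (rule that)
      next
        case MInf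
        then show ?thesis using that[of 0] by simp
      qed simp
      have "AE x in sphere_measure. ereal (norm (\<Omega> x)) \<le> E" unfolding E_def by (rule esssup_AE)
      then have "AE x in sphere_measure. norm (\<Omega> x) \<le> K"
        by eventually_elim (use K(2) in \<open>metis ereal_less_eq(3) order_trans\<close>)
      from AE_sphere_measure[OF this] ae AE0 have "AE z in lborel. \<Omega>' z \<le> K"
        by eventually_elim (use \<Omega>_sgn in force)
      then show ?thesis using K by blast
    qed
    show "(\<integral>\<^sup>+z\<in>ball 0 1. ennreal (\<Omega>' z powr real_of_ereal s) \<partial>lborel) < top" if "s \<noteq> \<infinity>"
    proof -
      let ?\<sigma> = "real_of_ereal s" and ?A = "ball 0 1 - {0::'a}"
      have "(\<integral>\<^sup>+x. ennreal (g x powr ?\<sigma>) \<partial>sphere_measure) = (\<integral>\<^sup>+x. ennreal (norm (\<Omega> x) powr ?\<sigma>) \<partial>sphere_measure)"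
        by (rule nn_integral_cong_AE) (use gAE' in eventually_elim, simp)
      also have "\<dots> < top" using \<Omega> that by (simp add: Lp_sphere_def)
      finally have "(\<integral>\<^sup>+z\<in>?A. ennreal (g (sgn z) powr ?\<sigma>) \<partial>lborel) / emeasure lborel ?A < top"
        by (subst (asm) nn_integral_sphere_measure) auto
      then have "(\<integral>\<^sup>+z\<in>?A. ennreal (g (sgn z) powr ?\<sigma>) \<partial>lborel) < top"
        using punctured_ball_measure(2)[where 'a='a] divide_less_top_imp by blast
      also have "(\<integral>\<^sup>+z\<in>?A. ennreal (g (sgn z) powr ?\<sigma>) \<partial>lborel) = (\<integral>\<^sup>+z\<in>ball 0 1. ennreal (\<Omega>' z powr ?\<sigma>) \<partial>lborel)"
      proof (rule nn_integral_cong_AE)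
        show "AE z in lborel. ennreal (g (sgn z) powr ?\<sigma>) * indicator ?A z = ennreal (\<Omega>' z powr ?\<sigma>) * indicator (ball 0 1) z"
          using AE_sphere_measure[OF gAE'] AE0
        proof eventually_elim
          case (elim z)
          then have "g (sgn z) = \<Omega>' z" using g0_eq[of z] by (simp add: \<Omega>'_def) (metis abs_of_nonneg norm_ge_zero)
          then show ?case using elim by (auto simp: indicator_def)
        qed
      qed
      finally show ?thesis .
    qed
  qed (use ae in \<open>auto simp: \<Omega>'_def\<close>)
qed

text \<open>Hoelder's inequality on a ball. The power of \<open>r\<close> is the growth of the
  kernel's norm over a ball of radius \<open>r\<close>, since \<open>1 - 1 / t\<close> is
  \<open>1 / s\<close>, read as 0 for a bounded kernel. The size of the kernel enters later
  estimates only through this property.\<close>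

definition kernel_bound :: "('a::euclidean_space \<Rightarrow> real) \<Rightarrow> real \<Rightarrow> real \<Rightarrow> bool" where
  "kernel_bound \<Omega>' M t \<longleftrightarrow> (\<forall>(h :: 'a \<Rightarrow> ennreal) x r. h \<in> borel_measurable borel \<longrightarrow> 0 < r \<longrightarrow>
      (\<integral>\<^sup>+y\<in>cball x r. ennreal (\<Omega>' (x - y)) * h y \<partial>lborel)
        \<le> ennreal (M * r powr (real DIM('a) * (1 - 1 / t))) * epowr (\<integral>\<^sup>+y\<in>cball x r. epowr (h y) t \<partial>lborel) (1 / t))"

lemma kernel_Hoelder:
  fixes \<Omega> :: "'a::euclidean_space \<Rightarrow> 'k::real_normed_field"
  assumes \<Omega>: "\<Omega> \<in> Lp_sphere s" and hom: "homogeneous_degree_zero \<Omega>" and s: "1 < s"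
  defines "t \<equiv> conj_exponent s"
  obtains \<Omega>' :: "'a \<Rightarrow> real" and M where "\<Omega>' \<in> borel_measurable borel" "\<And>z. 0 \<le> \<Omega>' z"
    "AE z in lborel. norm (\<Omega> z) = \<Omega>' z" "0 \<le> M"
    "kernel_bound \<Omega>' M t"
proof -
  obtain \<Omega>' :: "'a \<Rightarrow> real" where \<Omega>'m [measurable]: "\<Omega>' \<in> borel_measurable borel" and \<Omega>'0: "\<And>z. 0 \<le> \<Omega>' z"
    and \<Omega>'hom: "\<And>l z. 0 < l \<Longrightarrow> \<Omega>' (l *\<^sub>R z) = \<Omega>' z" and ae: "AE z in lborel. norm (\<Omega> z) = \<Omega>' z"
    and inf: "s = \<infinity> \<Longrightarrow> \<exists>K\<ge>0. AE z in lborel. \<Omega>' z \<le> K"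
    and fin: "s \<noteq> \<infinity> \<Longrightarrow> (\<integral>\<^sup>+z\<in>ball 0 1. ennreal (\<Omega>' z powr real_of_ereal s) \<partial>lborel) < top"
    by (rule Lp_sphere_kernel[OF \<Omega> hom s]) blast
  have "\<exists>M\<ge>0. kernel_bound \<Omega>' M t"
  proof (cases "s = \<infinity>")
    case True
    then have t: "t = 1" by (simp add: t_def conj_exponent_def)
    obtain K where K: "0 \<le> K" "AE z in lborel. \<Omega>' z \<le> K" using inf[OF True] by blast
    show ?thesis
      unfolding kernel_bound_def
    proof (intro exI[of _ K] conjI K(1) allI impI)
      fix h :: "'a \<Rightarrow> ennreal" and x :: 'a and r :: real
      assume [measurable]: "h \<in> borel_measurable borel" and r: "0 < r"
      have [measurable]: "cball x r \<in> sets borel" by simp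
      have "(\<integral>\<^sup>+y\<in>cball x r. ennreal (\<Omega>' (x - y)) * h y \<partial>lborel) \<le> (\<integral>\<^sup>+y. ennreal K * (h y * indicator (cball x r) y) \<partial>lborel)"
      proof (rule nn_integral_mono_AE)
        show "AE y in lborel. ennreal (\<Omega>' (x - y)) * h y * indicator (cball x r) y \<le> ennreal K * (h y * indicator (cball x r) y)"
          using AE_reflect[OF K(2), of x]
          by eventually_elim (auto simp: mult.assoc intro!: mult_right_mono ennreal_leI)
      qed
      also have "\<dots> = ennreal K * (\<integral>\<^sup>+y\<in>cball x r. h y \<partial>lborel)"
        by (rule nn_integral_cmult) measurable
      finally show "(\<integral>\<^sup>+y\<in>cball x r. ennreal (\<Omega>' (x - y)) * h y \<partial>lborel)
        \<le> ennreal (K * r powr (real DIM('a) * (1 - 1 / t))) * epowr (\<integral>\<^sup>+y\<in>cball x r. epowr (h y) t \<partial>lborel) (1 / t)"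
        using r by (simp add: t)
    qed
  next
    case False
    define \<sigma> where "\<sigma> = real_of_ereal s"
    have s\<sigma>: "s = ereal \<sigma>" using False s by (cases s) (auto simp: \<sigma>_def)
    then have \<sigma>: "1 < \<sigma>" using s by simp
    have t: "t = \<sigma> / (\<sigma> - 1)" using s\<sigma> by (simp add: t_def conj_exponent_def)
    have t0: "0 < t" "1 / t = 1 - 1 / \<sigma>" using \<sigma> by (auto simp: t field_simps)
    obtain I where I: "0 \<le> I" "(\<integral>\<^sup>+z\<in>ball 0 1. ennreal (\<Omega>' z powr \<sigma>) \<partial>lborel) = ennreal I"
      using fin[OF False] unfolding \<sigma>_def[symmetric] by (cases "\<integral>\<^sup>+z\<in>ball 0 1. ennreal (\<Omega>' z powr \<sigma>) \<partial>lborel") auto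
    \<comment> \<open>The factor \<open>2 ^ n\<close> comes from enclosing the closed ball of radius
      \<open>r\<close> in the open ball of radius \<open>2 * r\<close>, to which the dilation
      formula applies.\<close>
    define M where "M = (2 ^ DIM('a) * I) powr (1 / \<sigma>)"
    show ?thesis
      unfolding kernel_bound_def
    proof (intro exI[of _ M] conjI allI impI)
      show "0 \<le> M" by (simp add: M_def)
      fix h :: "'a \<Rightarrow> ennreal" and x :: 'a and r :: real
      assume [measurable]: "h \<in> borel_measurable borel" and r: "0 < r"
      have [measurable]: "cball x r \<in> sets borel" "cball (0::'a) r \<in> sets borel" by auto
      have "(\<integral>\<^sup>+y\<in>cball x r. ennreal (\<Omega>' (x - y)) * h y \<partial>lborel)
        = (\<integral>\<^sup>+y. epowr (ennreal (\<Omega>' (x - y) powr \<sigma>) * indicator (cball x r) y) (1 / \<sigma>)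
              * epowr (epowr (h y) t * indicator (cball x r) y) (1 - 1 / \<sigma>) \<partial>lborel)"
      proof (rule nn_integral_cong)
        fix y
        have "0 < 1 / \<sigma>" "0 < 1 - 1 / \<sigma>" using \<sigma> by auto
        moreover have "epowr (epowr (h y) t) (1 - 1 / \<sigma>) = h y"
          using epowr_inverse_cancel[OF t0(1), of "h y"] unfolding t0(2) .
        moreover have "epowr (ennreal (\<Omega>' (x - y) powr \<sigma>)) (1 / \<sigma>) = ennreal (\<Omega>' (x - y))"
          using \<sigma> \<Omega>'0 by (simp add: epowr_ennreal powr_powr)
        ultimately show "ennreal (\<Omega>' (x - y)) * h y * indicator (cball x r) y
          = epowr (ennreal (\<Omega>' (x - y) powr \<sigma>) * indicator (cball x r) y) (1 / \<sigma>)
              * epowr (epowr (h y) t * indicator (cball x r) y) (1 - 1 / \<sigma>)"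
          by (cases "y \<in> cball x r") simp_all
      qed
      also have "\<dots> \<le> epowr (\<integral>\<^sup>+y\<in>cball x r. ennreal (\<Omega>' (x - y) powr \<sigma>) \<partial>lborel) (1 / \<sigma>)
         * epowr (\<integral>\<^sup>+y\<in>cball x r. epowr (h y) t \<partial>lborel) (1 - 1 / \<sigma>)"
        using \<sigma> by (intro Hoelder_nn_integral) (simp, simp, measurable)
      also have "epowr (\<integral>\<^sup>+y\<in>cball x r. ennreal (\<Omega>' (x - y) powr \<sigma>) \<partial>lborel) (1 / \<sigma>) \<le> ennreal (M * r powr (real DIM('a) * (1 - 1 / t)))"
      proof -
        have "(\<integral>\<^sup>+y\<in>cball x r. ennreal (\<Omega>' (x - y) powr \<sigma>) \<partial>lborel)
           = (\<integral>\<^sup>+y. ennreal (\<Omega>' (x - y) powr \<sigma>) * indicator (cball 0 r) (x - y) \<partial>lborel)"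
          by (intro nn_integral_cong) (auto simp: indicator_def dist_norm norm_minus_commute)
        also have "\<dots> = (\<integral>\<^sup>+z\<in>cball 0 r. ennreal (\<Omega>' z powr \<sigma>) \<partial>lborel)"
          by (rule nn_integral_reflect) measurable
        also have "\<dots> \<le> (\<integral>\<^sup>+z\<in>ball 0 (2 * r). ennreal (\<Omega>' z powr \<sigma>) \<partial>lborel)"
          using r by (intro nn_integral_mono) (auto simp: indicator_def)
        also have "\<dots> = ennreal ((2 * r) ^ DIM('a)) * ennreal I"
          unfolding I(2)[symmetric] using r \<Omega>'hom by (intro nn_integral_cone_ball) auto
        also have "\<dots> = ennreal (2 ^ DIM('a) * I * r powr DIM('a))"
          using r I by (simp add: ennreal_mult[symmetric] power_mult_distrib powr_realpow mult_ac)
        finally have "epowr (\<integral>\<^sup>+y\<in>cball x r. ennreal (\<Omega>' (x - y) powr \<sigma>) \<partial>lborel) (1 / \<sigma>) \<le> epowr (ennreal (2 ^ DIM('a) * I * r powr DIM('a))) (1 / \<sigma>)"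
          using \<sigma> by (intro epowr_mono) auto
        also have "\<dots> = ennreal (M * r powr (real DIM('a) * (1 - 1 / t)))"
          using \<sigma> I r t0(2) by (simp add: epowr_ennreal M_def powr_mult powr_powr)
        finally show ?thesis .
      qed
      finally show "(\<integral>\<^sup>+y\<in>cball x r. ennreal (\<Omega>' (x - y)) * h y \<partial>lborel)
        \<le> ennreal (M * r powr (real DIM('a) * (1 - 1 / t))) * epowr (\<integral>\<^sup>+y\<in>cball x r. epowr (h y) t \<partial>lborel) (1 / t)"
        unfolding t0(2) by (simp add: mult_right_mono)
    qed
  qed
  then show ?thesis using that[OF \<Omega>'m \<Omega>'0 ae] by blast
qed

section \<open>The commutator\<close>

lemma borel_measurable_lebesgue_AE:
  fixes f g :: "'a::euclidean_space \<Rightarrow> 'b::topological_space"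
  assumes [measurable]: "g \<in> borel_measurable borel" and ae: "AE x in lborel. f x = g x"
  shows "f \<in> borel_measurable lebesgue"
proof (rule measurableI)
  fix S :: "'b set" assume S: "S \<in> sets borel"
  have "g -` S \<inter> space borel \<in> sets borel" using assms(1) S by (rule measurable_sets)
  then have m: "g -` S \<in> sets lebesgue" by (auto intro: sets_completionI_sets)
  have "AE x in lebesgue. x \<in> g -` S \<longleftrightarrow> x \<in> f -` S"
    unfolding AE_completion_iff using ae by eventually_elim simp
  then have "f -` S \<in> sets lebesgue"
    using m by (rule completion.in_sets_AE) simp
  then show "f -` S \<inter> space lebesgue \<in> sets lebesgue" by simp
qed simp

text \<open>Approximate \<open>r\<close> by rationals from the right: the integral does not decrease
  and the prefactor is continuous. A supremum over countably many radii is what measurability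
  requires.\<close>

lemma SUP_radius_rational:
  fixes I :: "real \<Rightarrow> ennreal"
  assumes mono: "\<And>r s. 0 < r \<Longrightarrow> r \<le> s \<Longrightarrow> I r \<le> I s"
  shows "(SUP r\<in>{0<..}. ennreal (1 / r powr d) * I r) = (SUP r\<in>{0<..} \<inter> \<rat>. ennreal (1 / r powr d) * I r)"
proof (rule antisym)
  show "(SUP r\<in>{0<..} \<inter> \<rat>. ennreal (1 / r powr d) * I r) \<le> (SUP r\<in>{0<..}. ennreal (1 / r powr d) * I r)"
    by (rule SUP_subset_mono) auto
  show "(SUP r\<in>{0<..}. ennreal (1 / r powr d) * I r) \<le> (SUP r\<in>{0<..} \<inter> \<rat>. ennreal (1 / r powr d) * I r)"
  proof (rule SUP_least)
    fix r :: real assume "r \<in> {0<..}"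
    then have r: "0 < r" by simp
    have "\<exists>x. r < x \<and> x < r + 1 / real (Suc k) \<and> x \<in> \<rat>" for k
      using Rats_dense_in_real[of r "r + 1 / real (Suc k)"] by auto
    then obtain \<rho> where \<rho>: "\<And>k. r < \<rho> k" "\<And>k. \<rho> k < r + 1 / real (Suc k)" "\<And>k. \<rho> k \<in> \<rat>" by metis
    have "(\<lambda>k. r + 1 / real (Suc k)) \<longlonglongrightarrow> r + 0"
      by (intro tendsto_add tendsto_const LIMSEQ_Suc lim_1_over_n)
    then have "\<rho> \<longlonglongrightarrow> r"
      using \<rho> by (intro tendsto_sandwich[OF _ _ tendsto_const, of r \<rho> sequentially "\<lambda>k. r + 1 / real (Suc k)"]) (auto intro!: always_eventually less_imp_le)
    then have "(\<lambda>k. 1 / \<rho> k powr d) \<longlonglongrightarrow> 1 / r powr d"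
      using r by (intro tendsto_divide tendsto_const tendsto_powr) auto
    then have "(\<lambda>k. ennreal (1 / \<rho> k powr d) * I r) \<longlonglongrightarrow> ennreal (1 / r powr d) * I r"
      using r by (intro tendsto_mult_ennreal tendsto_ennrealI tendsto_const) auto
    moreover have "ennreal (1 / \<rho> k powr d) * I r \<le> (SUP r\<in>{0<..} \<inter> \<rat>. ennreal (1 / r powr d) * I r)" for k
    proof -
      have "ennreal (1 / \<rho> k powr d) * I r \<le> ennreal (1 / \<rho> k powr d) * I (\<rho> k)"
        using r \<rho>(1)[of k] by (intro mult_left_mono mono) auto
      also have "\<dots> \<le> (SUP r\<in>{0<..} \<inter> \<rat>. ennreal (1 / r powr d) * I r)"
        using r \<rho>(1)[of k] \<rho>(3) by (intro SUP_upper) (auto intro: less_trans)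
      finally show ?thesis .
    qed
    ultimately show "ennreal (1 / r powr d) * I r \<le> (SUP r\<in>{0<..} \<inter> \<rat>. ennreal (1 / r powr d) * I r)"
      by (blast intro: LIMSEQ_le_const2)
  qed
qed

text \<open>One null set of points \<open>x\<close> serves all radii: it only excludes points where
  \<open>b\<close> differs from its coordinate form. For the remaining \<open>x\<close>, the
  exceptional set of \<open>y\<close> may depend on \<open>x\<close>.\<close>

lemma commutator_maximal_eq:
  fixes b f \<Omega> :: "'a::euclidean_space \<Rightarrow> 'k::{real_normed_field, banach, second_countable_topology}"
  assumes b: "AE x in lborel. b x = of_real (b1 x) + of_real (b2 x) * j"
    and f: "AE x in lborel. norm (f x) = f' x" and \<Omega>: "AE x in lborel. norm (\<Omega> x) = \<Omega>' x"
  shows "AE x in lborel. \<forall>r. (\<integral>\<^sup>+y\<in>cball x r. ennreal (norm (b x - b y) * norm (\<Omega> (x - y) * f y)) \<partial>lebesgue)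
    = (\<integral>\<^sup>+y\<in>cball x r. ennreal (norm (of_real (b1 x - b1 y) + of_real (b2 x - b2 y) * j) * (\<Omega>' (x - y) * f' y)) \<partial>lborel)"
  using b
proof eventually_elim
  case (elim x)
  show ?case
  proof
    fix r
    show "(\<integral>\<^sup>+y\<in>cball x r. ennreal (norm (b x - b y) * norm (\<Omega> (x - y) * f y)) \<partial>lebesgue)
      = (\<integral>\<^sup>+y\<in>cball x r. ennreal (norm (of_real (b1 x - b1 y) + of_real (b2 x - b2 y) * j) * (\<Omega>' (x - y) * f' y)) \<partial>lborel)"
      unfolding nn_integral_completion
    proof (rule nn_integral_cong_AE)
      show "AE y in lborel. ennreal (norm (b x - b y) * norm (\<Omega> (x - y) * f y)) * indicator (cball x r) y
        = ennreal (norm (of_real (b1 x - b1 y) + of_real (b2 x - b2 y) * j) * (\<Omega>' (x - y) * f' y)) * indicator (cball x r) y"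
        using b f AE_reflect[OF \<Omega>, of x]
      proof eventually_elim
        case (elim y)
        have "b x - b y = of_real (b1 x - b1 y) + of_real (b2 x - b2 y) * j"
          unfolding \<open>b x = _\<close> elim(1) by (simp add: algebra_simps)
        then show ?case by (simp only: norm_mult elim(2,3))
      qed
    qed
  qed
qed

lemma commutator_maximal_measurable:
  fixes b f \<Omega> :: "'a::euclidean_space \<Rightarrow> 'k::{real_normed_field, banach, second_countable_topology}"
  assumes b: "AE x in lborel. b x = of_real (b1 x) + of_real (b2 x) * j"
    and f: "AE x in lborel. norm (f x) = f' x" and \<Omega>: "AE x in lborel. norm (\<Omega> x) = \<Omega>' x"
    and [measurable]: "b1 \<in> borel_measurable borel" "b2 \<in> borel_measurable borel"
      "f' \<in> borel_measurable borel" "\<Omega>' \<in> borel_measurable borel"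
  shows "commutator_maximal b \<Omega> \<alpha> f \<in> borel_measurable lebesgue"
proof (rule borel_measurable_lebesgue_AE)
  let ?d = "real DIM('a) - \<alpha>"
  define J where "J r x = (\<integral>\<^sup>+y\<in>cball x r. ennreal (norm (of_real (b1 x - b1 y) + of_real (b2 x - b2 y) * j) * (\<Omega>' (x - y) * f' y)) \<partial>lborel)" for r and x :: 'a
  have [measurable]: "J r \<in> borel_measurable borel" for r
  proof -
    have "J r = (\<lambda>x. \<integral>\<^sup>+y. ennreal (norm (of_real (b1 x - b1 y) + of_real (b2 x - b2 y) * j) * (\<Omega>' (x - y) * f' y)) * (if dist x y \<le> r then 1 else 0) \<partial>lborel)"
      unfolding J_def by (intro ext nn_integral_cong) (auto simp: indicator_def)
    also have "\<dots> \<in> borel_measurable borel" by measurable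
    finally show ?thesis .
  qed
  show "(\<lambda>x. SUP r\<in>{0<..} \<inter> \<rat>. ennreal (1 / r powr ?d) * J r x) \<in> borel_measurable borel"
    by (intro borel_measurable_SUP) (auto simp: countable_rat)
  show "AE x in lborel. commutator_maximal b \<Omega> \<alpha> f x = (SUP r\<in>{0<..} \<inter> \<rat>. ennreal (1 / r powr ?d) * J r x)"
    using commutator_maximal_eq[OF b f \<Omega>]
  proof eventually_elim
    case (elim x)
    have "commutator_maximal b \<Omega> \<alpha> f x = (SUP r\<in>{0<..}. ennreal (1 / r powr ?d) * J r x)"
      unfolding commutator_maximal_def J_def using elim by simp
    also have "\<dots> = (SUP r\<in>{0<..} \<inter> \<rat>. ennreal (1 / r powr ?d) * J r x)"
    proof (rule SUP_radius_rational)
      fix r s :: real assume "r \<le> s"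
      then show "J r x \<le> J s x" unfolding J_def by (intro nn_integral_mono) (auto simp: indicator_def)
    qed
    finally show ?case .
  qed
qed

section \<open>Pointwise domination by conjugated fractional maximal functions\<close>

lemma powr_le_exp_sum:
  fixes z1 z2 :: real
  assumes "0 < \<gamma>" "0 < t"
  shows "(\<bar>z1\<bar> + \<bar>z2\<bar>) powr t \<le> (2 * t / \<gamma>) powr t * (exp (\<gamma> * z1) + exp (- \<gamma> * z1) + exp (\<gamma> * z2) + exp (- \<gamma> * z2))"
proof -
  define S where "S = \<bar>z1\<bar> + \<bar>z2\<bar>"
  have S: "0 \<le> S" by (simp add: S_def)
  \<comment> \<open>The scale \<open>2 * t\<close> is chosen so that the power \<open>t\<close>
    leaves \<open>exp (\<gamma> * S / 2)\<close>; half of the sum is at most the larger of the two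
    absolute values.\<close>
  have "\<gamma> * S / (2 * t) \<le> exp (\<gamma> * S / (2 * t))" using exp_ge_add_one_self[of "\<gamma> * S / (2 * t)"] by linarith
  then have "(2 * t / \<gamma>) * (\<gamma> * S / (2 * t)) \<le> (2 * t / \<gamma>) * exp (\<gamma> * S / (2 * t))"
    using assms by (intro mult_left_mono) auto
  then have "S \<le> (2 * t / \<gamma>) * exp (\<gamma> * S / (2 * t))" using assms by simp
  then have "S powr t \<le> ((2 * t / \<gamma>) * exp (\<gamma> * S / (2 * t))) powr t" using S assms by (intro powr_mono2) auto
  also have "\<dots> = (2 * t / \<gamma>) powr t * exp (\<gamma> * S / (2 * t)) powr t"
    by (rule powr_mult)
  also have "exp (\<gamma> * S / (2 * t)) powr t = exp (\<gamma> * (S / 2))"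
    using assms by (simp add: powr_def)
  also have "exp (\<gamma> * (S / 2)) \<le> exp (\<gamma> * max \<bar>z1\<bar> \<bar>z2\<bar>)"
    using assms by (auto simp: S_def)
  also have "\<dots> \<le> exp (\<gamma> * z1) + exp (- \<gamma> * z1) + exp (\<gamma> * z2) + exp (- \<gamma> * z2)"
    by (auto simp: max_def abs_if add_nonneg_nonneg)
  finally show ?thesis unfolding S_def by (simp add: mult_left_mono)
qed

definition conj_frac :: "real \<Rightarrow> real \<Rightarrow> ('a::euclidean_space \<Rightarrow> real) \<Rightarrow> ('a \<Rightarrow> ennreal) \<Rightarrow> 'a \<Rightarrow> ennreal" where
  "conj_frac e s \<beta> G x = ennreal (exp (s * \<beta> x)) * frac_maximal e (\<lambda>y. ennreal (exp (- s * \<beta> y)) * G y) x"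

lemma conj_frac_measurable [measurable]:
  assumes [measurable]: "\<beta> \<in> borel_measurable borel" shows "conj_frac e s \<beta> G \<in> borel_measurable borel"
  unfolding conj_frac_def by (intro borel_measurable_times_ennreal frac_maximal_measurable) measurable

lemma conj_frac_bound:
  fixes x :: "'a::euclidean_space"
  assumes [measurable]: "\<beta> \<in> borel_measurable borel" "G \<in> borel_measurable borel" and r: "0 < r"
  shows "(\<integral>\<^sup>+y\<in>cball x r. ennreal (exp (s * (\<beta> x - \<beta> y))) * G y \<partial>lborel)
    \<le> ennreal ((2 * r) powr (real DIM('a) * e)) * conj_frac e s \<beta> G x"
proof -
  let ?n = "real DIM('a)"
  have [measurable]: "ball x (2 * r) \<in> sets borel" by simp
  have "ennreal (exp (s * (\<beta> x - \<beta> y))) = ennreal (exp (s * \<beta> x)) * ennreal (exp (- s * \<beta> y))" for y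
    by (simp add: ennreal_mult[symmetric] exp_add[symmetric] algebra_simps)
  then have "(\<integral>\<^sup>+y\<in>cball x r. ennreal (exp (s * (\<beta> x - \<beta> y))) * G y \<partial>lborel)
     \<le> (\<integral>\<^sup>+y. ennreal (exp (s * \<beta> x)) * (ennreal (exp (- s * \<beta> y)) * G y * indicator (ball x (2 * r)) y) \<partial>lborel)"
    using r by (intro nn_integral_mono) (auto simp: indicator_def mult.assoc)
  also have "\<dots> = ennreal (exp (s * \<beta> x)) * (\<integral>\<^sup>+y\<in>ball x (2 * r). ennreal (exp (- s * \<beta> y)) * G y \<partial>lborel)"
    by (rule nn_integral_cmult) measurable
  also have "\<dots> = ennreal ((2 * r) powr (?n * e)) * (ennreal (exp (s * \<beta> x)) * (ennreal ((2 * r) powr (- ?n * e)) * (\<integral>\<^sup>+y\<in>ball x (2 * r). ennreal (exp (- s * \<beta> y)) * G y \<partial>lborel)))"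
  proof -
    have "ennreal ((2 * r) powr (?n * e)) * ennreal ((2 * r) powr (- ?n * e)) = 1"
      using r by (simp add: ennreal_mult[symmetric] powr_add[symmetric])
    then show ?thesis by (simp add: mult.assoc[symmetric] mult.commute[of _ "ennreal (exp _)"])
       (simp add: mult.assoc)
  qed
  also have "\<dots> \<le> ennreal ((2 * r) powr (?n * e)) * conj_frac e s \<beta> G x"
    unfolding conj_frac_def using r by (intro mult_left_mono frac_maximal_upper) auto
  finally show ?thesis .
qed

lemma ennreal_mult_assoc: "0 \<le> x \<Longrightarrow> 0 \<le> y \<Longrightarrow> ennreal x * (ennreal y * z) = ennreal (x * y) * z"
  by (simp add: ennreal_mult mult.assoc)

text \<open>Hoelder's inequality against the kernel, then the exponential majorant under the
  integral. The constant is independent of \<open>r\<close> because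
  \<open>n * (1 - 1 / t) + n * e / t = n - \<alpha>\<close>, which is what dictates the order
  \<open>\<alpha> * t\<close> of the fractional operator.\<close>

lemma commutator_pointwise:
  fixes \<Omega>' :: "'a::euclidean_space \<Rightarrow> real" and x :: 'a
  assumes kernel: "kernel_bound \<Omega>' M t"
    and M: "0 \<le> M" and [measurable]: "b1 \<in> borel_measurable borel" "b2 \<in> borel_measurable borel" "f' \<in> borel_measurable borel"
    and f': "\<And>y. 0 \<le> f' y" and \<gamma>: "0 < \<gamma>" and t: "0 < t" and r: "0 < r"
    and e: "real DIM('a) * e = real DIM('a) - \<alpha> * t"
  defines "G \<equiv> \<lambda>y. ennreal (f' y powr t)"
  shows "ennreal (1 / r powr (real DIM('a) - \<alpha>)) *
      (\<integral>\<^sup>+y\<in>cball x r. ennreal (\<Omega>' (x - y)) * ennreal ((\<bar>b1 x - b1 y\<bar> + \<bar>b2 x - b2 y\<bar>) * f' y) \<partial>lborel)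
    \<le> ennreal (M * ((2 * t / \<gamma>) powr t * 2 powr (real DIM('a) * e)) powr (1 / t)) *
       epowr (conj_frac e \<gamma> b1 G x + conj_frac e (- \<gamma>) b1 G x + conj_frac e \<gamma> b2 G x + conj_frac e (- \<gamma>) b2 G x) (1 / t)"
    (is "_ \<le> _ * epowr ?T (1 / t)")
proof -
  let ?n = "real DIM('a)" and ?h = "\<lambda>y. ennreal ((\<bar>b1 x - b1 y\<bar> + \<bar>b2 x - b2 y\<bar>) * f' y)"
  define c where "c = (2 * t / \<gamma>) powr t"
  have [measurable]: "G \<in> borel_measurable borel" unfolding G_def by measurable
  have [measurable]: "cball x r \<in> sets borel" by simp
  let ?E = "\<lambda>s \<beta> y. ennreal (exp (s * (\<beta> x - \<beta> y))) * G y * indicator (cball x r) y"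
  have "epowr (?h y) t * indicator (cball x r) y \<le> ennreal c * (?E \<gamma> b1 y + ?E (- \<gamma>) b1 y + ?E \<gamma> b2 y + ?E (- \<gamma>) b2 y)" for y
  proof -
    have "epowr (?h y) t = ennreal ((\<bar>b1 x - b1 y\<bar> + \<bar>b2 x - b2 y\<bar>) powr t * f' y powr t)"
      using f' t by (simp add: epowr_ennreal powr_mult)
    also have "\<dots> \<le> ennreal (c * (exp (\<gamma> * (b1 x - b1 y)) + exp (- \<gamma> * (b1 x - b1 y)) + exp (\<gamma> * (b2 x - b2 y)) + exp (- \<gamma> * (b2 x - b2 y))) * f' y powr t)"
      unfolding c_def by (intro ennreal_leI mult_right_mono powr_le_exp_sum \<gamma> t) simp
    also have "\<dots> = ennreal c * (ennreal (exp (\<gamma> * (b1 x - b1 y))) + ennreal (exp (- \<gamma> * (b1 x - b1 y))) + ennreal (exp (\<gamma> * (b2 x - b2 y))) + ennreal (exp (- \<gamma> * (b2 x - b2 y)))) * G y"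
      unfolding G_def by (simp add: ennreal_mult c_def ennreal_plus add_nonneg_nonneg)
    finally show ?thesis by (auto simp: indicator_def distrib_left distrib_right mult.assoc)
  qed
  then have "(\<integral>\<^sup>+y\<in>cball x r. epowr (?h y) t \<partial>lborel) \<le> (\<integral>\<^sup>+y. ennreal c * (?E \<gamma> b1 y + ?E (- \<gamma>) b1 y + ?E \<gamma> b2 y + ?E (- \<gamma>) b2 y) \<partial>lborel)"
    by (rule nn_integral_mono)
  also have "\<dots> = ennreal c * (\<integral>\<^sup>+y. (?E \<gamma> b1 y + ?E (- \<gamma>) b1 y + ?E \<gamma> b2 y + ?E (- \<gamma>) b2 y) \<partial>lborel)"
    by (rule nn_integral_cmult) measurable
  also have "(\<integral>\<^sup>+y. (?E \<gamma> b1 y + ?E (- \<gamma>) b1 y + ?E \<gamma> b2 y + ?E (- \<gamma>) b2 y) \<partial>lborel)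
     = (\<integral>\<^sup>+y. ?E \<gamma> b1 y \<partial>lborel) + (\<integral>\<^sup>+y. ?E (- \<gamma>) b1 y \<partial>lborel) + (\<integral>\<^sup>+y. ?E \<gamma> b2 y \<partial>lborel) + (\<integral>\<^sup>+y. ?E (- \<gamma>) b2 y \<partial>lborel)"
    by (subst nn_integral_add, measurable, subst nn_integral_add, measurable, subst nn_integral_add, measurable)
  also have "\<dots> \<le> ennreal ((2 * r) powr (?n * e)) * conj_frac e \<gamma> b1 G x + ennreal ((2 * r) powr (?n * e)) * conj_frac e (- \<gamma>) b1 G x
     + ennreal ((2 * r) powr (?n * e)) * conj_frac e \<gamma> b2 G x + ennreal ((2 * r) powr (?n * e)) * conj_frac e (- \<gamma>) b2 G x"
    using r by (intro add_mono conj_frac_bound) auto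
  also have "\<dots> = ennreal ((2 * r) powr (?n * e)) * ?T" by (simp only: distrib_left)
  finally have I: "(\<integral>\<^sup>+y\<in>cball x r. epowr (?h y) t \<partial>lborel) \<le> ennreal (c * (2 * r) powr (?n * e)) * ?T"
    by (simp add: mult_left_mono ennreal_mult mult.assoc c_def)
  have "(\<integral>\<^sup>+y\<in>cball x r. ennreal (\<Omega>' (x - y)) * ?h y \<partial>lborel)
     \<le> ennreal (M * r powr (?n * (1 - 1 / t))) * epowr (\<integral>\<^sup>+y\<in>cball x r. epowr (?h y) t \<partial>lborel) (1 / t)"
    by (rule kernel[unfolded kernel_bound_def, rule_format, OF _ r]) measurable
  also have "\<dots> \<le> ennreal (M * r powr (?n * (1 - 1 / t))) * epowr (ennreal (c * (2 * r) powr (?n * e)) * ?T) (1 / t)"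
    using t by (intro mult_left_mono epowr_mono I) auto
  also have "\<dots> = ennreal (M * r powr (?n * (1 - 1 / t)) * (c * (2 * r) powr (?n * e)) powr (1 / t)) * epowr ?T (1 / t)"
  proof -
    have "epowr (ennreal (c * (2 * r) powr (?n * e)) * ?T) (1 / t) = ennreal ((c * (2 * r) powr (?n * e)) powr (1 / t)) * epowr ?T (1 / t)"
      using t by (subst epowr_mult) (auto simp: epowr_ennreal c_def)
    then show ?thesis using M by (simp only:) (intro ennreal_mult_assoc; simp)
  qed
  finally have "ennreal (1 / r powr (?n - \<alpha>)) * (\<integral>\<^sup>+y\<in>cball x r. ennreal (\<Omega>' (x - y)) * ?h y \<partial>lborel)
     \<le> ennreal (1 / r powr (?n - \<alpha>)) * (ennreal (M * r powr (?n * (1 - 1 / t)) * (c * (2 * r) powr (?n * e)) powr (1 / t)) * epowr ?T (1 / t))"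
    by (rule mult_left_mono) simp
  also have "\<dots> = ennreal (1 / r powr (?n - \<alpha>) * (M * r powr (?n * (1 - 1 / t)) * (c * (2 * r) powr (?n * e)) powr (1 / t))) * epowr ?T (1 / t)"
    using M by (intro ennreal_mult_assoc) auto
  also have "1 / r powr (?n - \<alpha>) * (M * r powr (?n * (1 - 1 / t)) * (c * (2 * r) powr (?n * e)) powr (1 / t)) = M * (c * 2 powr (?n * e)) powr (1 / t)"
  proof -
    have "(c * (2 * r) powr (?n * e)) powr (1 / t) = (c * 2 powr (?n * e)) powr (1 / t) * r powr (?n * e / t)"
      using r by (simp add: powr_mult powr_powr c_def mult.assoc)
    moreover have "1 / r powr (?n - \<alpha>) * (r powr (?n * (1 - 1 / t)) * r powr (?n * e / t)) = 1"
    proof -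
      have "r powr (?n * (1 - 1 / t)) * r powr (?n * e / t) = r powr (?n - \<alpha>)"
      proof -
        have "(?n - \<alpha> * t) / t = ?n / t - \<alpha>" using t by (simp add: diff_divide_distrib)
        then have "?n * (1 - 1 / t) + (?n - \<alpha> * t) / t = ?n - \<alpha>" by (simp add: algebra_simps)
        then show ?thesis unfolding powr_add[symmetric] e by simp
      qed
      then show ?thesis using r by simp
    qed
    ultimately show ?thesis by (simp add: mult_ac) 
  qed
  finally show ?thesis unfolding c_def .
qed

section \<open>From the hypotheses to weight pairs and oscillation witnesses\<close>

lemma loc_integrable_measurable:
  fixes f :: "'a::euclidean_space \<Rightarrow> 'b::{banach, second_countable_topology}"
  assumes "loc_integrable f"
  shows "f \<in> borel_measurable lebesgue"
proof (rule borel_measurable_LIMSEQ_metric)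
  fix i :: nat
  have "set_integrable lebesgue (cball 0 (real i)) f" using assms by (simp add: loc_integrable_def)
  then show "(\<lambda>x. indicator (cball 0 (real i)) x *\<^sub>R f x) \<in> borel_measurable lebesgue"
    by (simp add: set_integrable_def borel_measurable_integrable)
next
  fix x :: 'a
  obtain k where k: "norm x \<le> real k" using real_arch_simple by blast
  have "indicator (cball 0 (real i)) x *\<^sub>R f x = f x" if "k \<le> i" for i
    using k that by (simp add: indicator_def)
  then show "(\<lambda>i. indicator (cball 0 (real i)) x *\<^sub>R f x) \<longlonglongrightarrow> f x"
    by (intro tendsto_eventually eventually_sequentiallyI[of k])
qed

lemma ball_in_balls: "0 < r \<Longrightarrow> ball c r \<in> balls"
  by (auto simp: balls_def)

lemma ballsE:
  assumes "B \<in> balls" obtains c r where "B = ball c r" "0 < r"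
  using assms by (auto simp: balls_def)

text \<open>If the weight vanishes on a set of positive measure, the second average in the \<open>A(P,Q)\<close> condition is
  infinite on large balls, so that the first is \<open>0\<close>.\<close>

lemma A_class_AE_zero_or_pos:
  fixes w :: "'a::euclidean_space \<Rightarrow> real"
  assumes A: "(\<lambda>x. w x powr t) \<in> A_class P Q" and w0: "\<And>x. 0 \<le> w x" and P: "1 < P" and Q: "0 < Q" and t: "0 < t"
    and [measurable]: "w' \<in> borel_measurable borel" and ae: "AE x in lborel. w x = w' x"
    and Z: "\<not> (AE x in lborel. w' x > 0)"
  shows "AE x in lborel. w x = 0"
proof -
  define P' where "P' = P / (P - 1)"
  have P': "0 < P'" using P by (simp add: P'_def)
  have conj: "conj_exponent (ereal P) = P'" by (simp add: conj_exponent_def P'_def)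
  obtain C where C: "\<And>B. B \<in> balls \<Longrightarrow>
     epowr ((\<integral>\<^sup>+x\<in>B. epowr (ennreal (w x powr t)) Q \<partial>lebesgue) / emeasure lebesgue B) (1 / Q) *
     epowr ((\<integral>\<^sup>+x\<in>B. epowr (ennreal (w x powr t)) (- P') \<partial>lebesgue) / emeasure lebesgue B) (1 / P') \<le> ennreal C"
    using A unfolding A_class_def conj by blast
  define Z where "Z = {x. w' x \<le> 0}"
  have [measurable]: "Z \<in> sets borel" unfolding Z_def by measurable
  have "emeasure lborel Z \<noteq> 0"
  proof
    assume "emeasure lborel Z = 0"
    then have "AE x in lborel. x \<notin> Z" by (intro AE_not_in) auto
    then show False using Z by (simp add: Z_def not_le)
  qed
  moreover have "emeasure lborel Z = (SUP k. emeasure lborel (Z \<inter> ball 0 (real k)))"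
  proof -
    have "(\<Union>k. Z \<inter> ball 0 (real k)) = Z" using reals_Archimedean2 by auto
    moreover have "incseq (\<lambda>k. Z \<inter> ball 0 (real k))" unfolding incseq_def by (auto intro: less_le_trans)
    ultimately show ?thesis by (subst SUP_emeasure_incseq) auto
  qed
  ultimately obtain N where N: "emeasure lborel (Z \<inter> ball 0 (real N)) \<noteq> 0"
    by (metis (no_types, lifting) SUP_bot_conv(2) bot_ennreal)
  \<comment> \<open>Each of these balls contains the part of \<open>Z\<close> of positive measure
    found above, and together they exhaust the space.\<close>
  have "AE x in lborel. x \<in> ball 0 (real (N + Suc k)) \<longrightarrow> w x = 0" for k
  proof -
    let ?B = "ball (0::'a) (real (N + Suc k))"
    have sub: "ball (0::'a) (real N) \<subseteq> ?B" by (intro subset_ball) simp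
    have m: "emeasure lebesgue ?B = emeasure lborel ?B" by simp
    have mB: "emeasure lborel ?B < top" using emeasure_lborel_ball_finite[of "0::'a" "real (N + Suc k)"] by simp
    have "(\<integral>\<^sup>+x. top * indicator (Z \<inter> ball 0 (real N)) x \<partial>lborel) \<le> (\<integral>\<^sup>+x\<in>?B. epowr (ennreal (w x powr t)) (- P') \<partial>lborel)"
    proof (rule nn_integral_mono_AE)
      show "AE x in lborel. top * indicator (Z \<inter> ball 0 (real N)) x \<le> epowr (ennreal (w x powr t)) (- P') * indicator ?B x"
        using ae
      proof eventually_elim
        case (elim x)
        show ?case
        proof (cases "x \<in> Z \<inter> ball 0 (real N)")
          case True
          then have "w x = 0" using elim w0[of x] by (simp add: Z_def)
          then show ?thesis using True sub P' by (auto simp: epowr_def)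
        qed simp
      qed
    qed
    moreover have "(\<integral>\<^sup>+x. top * indicator (Z \<inter> ball 0 (real N)) x \<partial>lborel) = top"
      by (subst nn_integral_cmult_indicator) (use N in \<open>simp_all add: ennreal_top_mult\<close>)
    ultimately have Y: "(\<integral>\<^sup>+x\<in>?B. epowr (ennreal (w x powr t)) (- P') \<partial>lborel) = top" by (simp add: top_unique)
    have X: "(\<integral>\<^sup>+x\<in>?B. epowr (ennreal (w x powr t)) Q \<partial>lborel) = 0"
    proof (rule ccontr)
      assume n0: "(\<integral>\<^sup>+x\<in>?B. epowr (ennreal (w x powr t)) Q \<partial>lborel) \<noteq> 0"
      have "(\<integral>\<^sup>+x\<in>?B. epowr (ennreal (w x powr t)) Q \<partial>lborel) / emeasure lborel ?B \<noteq> 0"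
        using n0 mB by (simp add: ennreal_divide_eq_0_iff less_top)
      then have "epowr ((\<integral>\<^sup>+x\<in>?B. epowr (ennreal (w x powr t)) Q \<partial>lborel) / emeasure lborel ?B) (1 / Q) \<noteq> 0" using Q by simp
      moreover have "epowr ((\<integral>\<^sup>+x\<in>?B. epowr (ennreal (w x powr t)) (- P') \<partial>lborel) / emeasure lborel ?B) (1 / P') = top"
        using P' mB unfolding Y by (simp add: ennreal_top_divide less_top)
      ultimately have "epowr ((\<integral>\<^sup>+x\<in>?B. epowr (ennreal (w x powr t)) Q \<partial>lborel) / emeasure lborel ?B) (1 / Q) *
         epowr ((\<integral>\<^sup>+x\<in>?B. epowr (ennreal (w x powr t)) (- P') \<partial>lborel) / emeasure lborel ?B) (1 / P') = top"
        by (simp add: ennreal_mult_top)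
      with C[of ?B] show False unfolding nn_integral_completion m by (simp add: ball_in_balls top_unique)
    qed
    have "(\<integral>\<^sup>+x\<in>?B. epowr (ennreal (w' x powr t)) Q \<partial>lborel) = (\<integral>\<^sup>+x\<in>?B. epowr (ennreal (w x powr t)) Q \<partial>lborel)"
      by (rule nn_integral_cong_AE) (use ae in eventually_elim, simp)
    then have "AE x in lborel. epowr (ennreal (w' x powr t)) Q * indicator ?B x = 0"
      unfolding X
    proof (subst (asm) nn_integral_0_iff_AE)
      have "(\<lambda>x. epowr (ennreal (w' x powr t)) Q) \<in> borel_measurable lborel" by measurable
      then show "(\<lambda>x. epowr (ennreal (w' x powr t)) Q * indicator ?B x) \<in> borel_measurable lborel"
        by (rule borel_measurable_times_ennreal) (rule borel_measurable_indicator, simp only: sets_lborel borel_open open_ball)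
    qed auto
    then show ?thesis using ae
      by eventually_elim (use Q t in \<open>auto simp: indicator_def split: if_splits\<close>)
  qed
  then have "AE x in lborel. \<forall>k. x \<in> ball 0 (real (N + Suc k)) \<longrightarrow> w x = 0" unfolding AE_all_countable by blast
  then show ?thesis
  proof eventually_elim
    case (elim x)
    obtain k where "norm x < real k" using reals_Archimedean2 by blast
    then show ?case using elim[rule_format, of k] by simp
  qed
qed

text \<open>Raising the class condition to the power \<open>1 / e\<close> turns the exponents
  \<open>1 / Q\<close> and \<open>1 / P'\<close> into \<open>a\<close> and \<open>1 - a\<close>,
  which add up to 1. Clearing both averages then leaves a single factor, the Lebesgue measure of the
  ball.\<close>

lemma A_class_weight_pair:
  fixes w :: "'a::euclidean_space \<Rightarrow> real"
  assumes A: "(\<lambda>x. w x powr t) \<in> A_class P Q" and w: "weight w" and P: "1 < P" and Q: "0 < Q" and t: "0 < t"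
    and nz: "\<not> (AE x in lborel. w x = 0)"
  defines "P' \<equiv> P / (P - 1)"
  defines "e \<equiv> 1 / Q + 1 / P'"
  obtains w' K where "w' \<in> borel_measurable borel" "\<And>x. 0 < w' x" "AE x in lborel. w x = w' x"
    "weight_pair (\<lambda>x. w' x powr (t * Q)) (\<lambda>x. w' x powr (- t * P')) (1 / (Q * e)) K"
proof -
  have w_nonneg: "0 \<le> w x" for x using w by (simp add: weight_def)
  have "w \<in> borel_measurable lebesgue" using w by (intro loc_integrable_measurable) (simp add: weight_def)
  then obtain w0 where [measurable]: "w0 \<in> borel_measurable borel" and w0: "AE x in lborel. w x = w0 x"
    using completion_ex_borel_measurable_real[of w lborel] by auto
  have pos: "AE x in lborel. w0 x > 0"
    using A_class_AE_zero_or_pos[OF A w_nonneg P Q t _ w0] nz by auto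
  \<comment> \<open>A Borel representative that is positive at every point, as weight pairs demand;
    the value 1 is taken only on a null set.\<close>
  define w' where "w' x = (if w0 x > 0 then w0 x else 1)" for x
  have [measurable]: "w' \<in> borel_measurable borel" unfolding w'_def by measurable
  have w'pos: "0 < w' x" for x by (simp add: w'_def)
  have w'ne: "w' x \<noteq> 0" for x using w'pos[of x] by simp
  have ae: "AE x in lborel. w x = w' x" using w0 pos by eventually_elim (simp add: w'_def)
  have P': "0 < P'" using P by (simp add: P'_def)
  have conj: "conj_exponent (ereal P) = P'" by (simp add: conj_exponent_def P'_def)
  have e: "0 < e" using Q P' by (simp add: e_def add_pos_pos)
  define a where "a = 1 / (Q * e)"
  have a: "0 < a" using Q e by (simp add: a_def)
  have a1: "1 - a = 1 / (P' * e)"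
  proof -
    have "1 / (Q * e) + 1 / (P' * e) = (1 / Q + 1 / P') / e" by (simp add: add_divide_distrib)
    also have "\<dots> = 1" using e by (simp add: e_def[symmetric])
    finally show ?thesis by (simp add: a_def)
  qed
  have a': "0 < 1 - a" using P' e unfolding a1 by simp
  obtain C where C: "0 < C" "\<And>B. B \<in> balls \<Longrightarrow>
     epowr ((\<integral>\<^sup>+x\<in>B. epowr (ennreal (w x powr t)) Q \<partial>lebesgue) / emeasure lebesgue B) (1 / Q) *
     epowr ((\<integral>\<^sup>+x\<in>B. epowr (ennreal (w x powr t)) (- P') \<partial>lebesgue) / emeasure lebesgue B) (1 / P') \<le> ennreal C"
    using A unfolding A_class_def conj by blast
  let ?v = "\<lambda>x. w' x powr (t * Q)" and ?u = "\<lambda>x. w' x powr (- t * P')"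
  have "weight_pair ?v ?u a (C powr (1 / e))"
  proof
    show "(w' x powr (t * Q)) powr a * (w' x powr (- t * P')) powr (1 - a) = 1" for x
    proof -
      have "Q * a = 1 / e" "P' * (1 - a) = 1 / e" unfolding a1 using Q P' by (auto simp: a_def)
      then have "t * Q * a + - t * P' * (1 - a) = 0" by (simp add: mult.assoc)
      then show ?thesis using w'ne[of x] by (simp only: powr_powr powr_add[symmetric]) simp
    qed
    fix c :: 'a and r :: real assume r: "0 < r"
    let ?B = "ball c r"
    have [measurable]: "?B \<in> sets borel" by simp
    obtain l where l: "emeasure lborel ?B = ennreal l" "0 < l"
      using emeasure_lborel_ball_pos[OF r, of c] emeasure_lborel_ball_finite[of c r] by (cases "emeasure lborel ?B") auto
    have V: "(\<integral>\<^sup>+x\<in>?B. epowr (ennreal (w x powr t)) Q \<partial>lebesgue) = emeasure (wt ?v) ?B"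
      unfolding nn_integral_completion
    proof (subst emeasure_wt)
      show "(\<integral>\<^sup>+x\<in>?B. epowr (ennreal (w x powr t)) Q \<partial>lborel) = (\<integral>\<^sup>+x\<in>?B. ennreal (w' x powr (t * Q)) \<partial>lborel)"
        by (rule nn_integral_cong_AE) (use ae in eventually_elim, use Q in \<open>simp add: epowr_ennreal powr_powr\<close>)
    qed auto
    have U: "(\<integral>\<^sup>+x\<in>?B. epowr (ennreal (w x powr t)) (- P') \<partial>lebesgue) = emeasure (wt ?u) ?B"
      unfolding nn_integral_completion
    proof (subst emeasure_wt)
      show "(\<integral>\<^sup>+x\<in>?B. epowr (ennreal (w x powr t)) (- P') \<partial>lborel) = (\<integral>\<^sup>+x\<in>?B. ennreal (w' x powr (- t * P')) \<partial>lborel)"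
      proof (rule nn_integral_cong_AE, use ae in eventually_elim)
        fix x assume "w x = w' x"
        then show "epowr (ennreal (w x powr t)) (- P') * indicator ?B x = ennreal (w' x powr (- t * P')) * indicator ?B x"
          using w'pos[of x] by (simp add: epowr_def powr_powr)
      qed
    qed auto
    let ?V = "emeasure (wt ?v) ?B" and ?U = "emeasure (wt ?u) ?B"
    have "epowr (?V / ennreal l) (1 / Q) * epowr (?U / ennreal l) (1 / P') \<le> ennreal C"
      using C(2)[OF ball_in_balls[OF r, of c]] unfolding V U by (simp add: l)
    then have "epowr (epowr (?V / ennreal l) (1 / Q) * epowr (?U / ennreal l) (1 / P')) (1 / e) \<le> epowr (ennreal C) (1 / e)"
      using e by (intro epowr_mono) auto
    moreover have "1 / Q * (1 / e) = a" "1 / P' * (1 / e) = 1 - a" unfolding a1 by (auto simp: a_def)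
    ultimately have *: "epowr (?V / ennreal l) a * epowr (?U / ennreal l) (1 - a) \<le> ennreal (C powr (1 / e))"
      using e Q P' C(1) by (simp add: epowr_mult epowr_epowr epowr_ennreal)
    have cancel: "x / ennreal l * ennreal l = x" for x
      using l by (simp add: ennreal_divide_times ennreal_times_divide[symmetric] ennreal_divide_self)
    have "epowr ?V a * epowr ?U (1 - a) = epowr (?V / ennreal l * ennreal l) a * epowr (?U / ennreal l * ennreal l) (1 - a)"
      unfolding cancel ..
    also have "\<dots> = epowr (?V / ennreal l) a * epowr (?U / ennreal l) (1 - a) * (epowr (ennreal l) a * epowr (ennreal l) (1 - a))"
      unfolding epowr_mult[OF a] epowr_mult[OF a'] by (simp only: mult_ac)
    also have "epowr (ennreal l) a * epowr (ennreal l) (1 - a) = ennreal l"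
      using epowr_add[OF a a', of "ennreal l"] by simp
    also have "epowr (?V / ennreal l) a * epowr (?U / ennreal l) (1 - a) * ennreal l \<le> ennreal (C powr (1 / e)) * ennreal l"
      by (intro mult_right_mono *) simp
    finally show "epowr ?V a * epowr ?U (1 - a) \<le> ennreal (C powr (1 / e)) * emeasure lborel ?B" unfolding l .
  qed (use w'ne a a' C in auto)
  then show ?thesis using w'pos ae unfolding a_def by (intro that[of w']) auto
qed

text \<open>A Lipschitz map need not commute with averages, so the constant attached to a ball is
  the image of the average of \<open>b\<close>. This is why a witness carries constants of its
  own.\<close>

lemma BMO_component:
  fixes b :: "'a::euclidean_space \<Rightarrow> 'k::{real_normed_field, banach, second_countable_topology}"
  assumes b: "b \<in> BMO" and lip: "\<And>x y. \<bar>A x - A y\<bar> \<le> 2 * norm (x - y)"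
  obtains \<beta> m L where "bmo \<beta> m L" "AE x in lborel. A (b x) = \<beta> x"
proof -
  have bm: "b \<in> borel_measurable lebesgue" using b by (intro loc_integrable_measurable) (simp add: BMO_def)
  have "continuous_on UNIV A"
  proof (rule continuous_onI)
    fix x :: 'k and \<epsilon> :: real assume "0 < \<epsilon>"
    then show "\<exists>d>0. \<forall>x'\<in>UNIV. dist x' x < d \<longrightarrow> dist (A x') (A x) \<le> \<epsilon>"
      using lip by (intro exI[of _ "\<epsilon> / 2"]) (auto simp: dist_norm intro: order_trans[OF lip])
  qed
  then have "(\<lambda>x. A (b x)) \<in> borel_measurable lebesgue"
    using bm by (rule borel_measurable_continuous_on)
  then obtain \<beta> where [measurable]: "\<beta> \<in> borel_measurable borel" and ae: "AE x in lborel. A (b x) = \<beta> x"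
    using completion_ex_borel_measurable_real[of _ lborel] by force
  obtain L0 where L0: "0 \<le> L0" "BMO_norm b = ennreal L0"
    using b by (cases "BMO_norm b") (auto simp: BMO_def)
  define m where "m c r = A (ball_average b (ball c r))" for c r
  \<comment> \<open>The factor 2 is the Lipschitz constant; the summand 1 keeps the bound positive
    when the norm is 0.\<close>
  have "bmo \<beta> m (2 * L0 + 1)"
  proof
    fix c :: 'a and r :: real assume r: "0 < r"
    let ?B = "ball c r" and ?d = "ball_average b (ball c r)"
    have mB: "emeasure lebesgue ?B = emeasure lborel ?B" by simp
    have "(\<integral>\<^sup>+x\<in>?B. ennreal (norm (b x - ?d)) \<partial>lebesgue) / emeasure lebesgue ?B \<le> ennreal L0"
      unfolding L0(2)[symmetric] BMO_norm_def using ball_in_balls[OF r, of c] by (rule SUP_upper)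
    then have "(\<integral>\<^sup>+x\<in>?B. ennreal (norm (b x - ?d)) \<partial>lborel) / emeasure lborel ?B \<le> ennreal L0"
      unfolding nn_integral_completion mB .
    then have le: "(\<integral>\<^sup>+x\<in>?B. ennreal (norm (b x - ?d)) \<partial>lborel) \<le> ennreal L0 * emeasure lborel ?B"
    proof -
      assume *: "(\<integral>\<^sup>+x\<in>?B. ennreal (norm (b x - ?d)) \<partial>lborel) / emeasure lborel ?B \<le> ennreal L0"
      obtain l where l: "emeasure lborel ?B = ennreal l" "0 < l"
        using emeasure_lborel_ball_pos[OF r, of c] emeasure_lborel_ball_finite[of c r] by (cases "emeasure lborel ?B") auto
      have cancel: "x / ennreal l * ennreal l = x" for x
        using l by (simp add: ennreal_divide_times ennreal_times_divide[symmetric] ennreal_divide_self)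
      show ?thesis using mult_right_mono[OF *, of "ennreal l"] unfolding l cancel by simp
    qed
    have "(\<integral>\<^sup>+y\<in>?B. ennreal \<bar>\<beta> y - m c r\<bar> \<partial>lborel) \<le> (\<integral>\<^sup>+y. 2 * (ennreal (norm (b y - ?d)) * indicator ?B y) \<partial>lborel)"
    proof (rule nn_integral_mono_AE)
      show "AE y in lborel. ennreal \<bar>\<beta> y - m c r\<bar> * indicator ?B y \<le> 2 * (ennreal (norm (b y - ?d)) * indicator ?B y)"
        using ae
      proof eventually_elim
        case (elim y)
        have "ennreal \<bar>\<beta> y - m c r\<bar> \<le> ennreal (2 * norm (b y - ?d))"
          using lip[of "b y" ?d] elim by (intro ennreal_leI) (simp add: m_def)
        then show ?case by (simp add: indicator_def ennreal_mult)
      qed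
    qed
    also have "\<dots> = 2 * (\<integral>\<^sup>+y\<in>?B. ennreal (norm (b y - ?d)) \<partial>lborel)"
    proof -
      have [measurable]: "?B \<in> sets lebesgue" by simp
      have "(\<lambda>y. ennreal (norm (b y - ?d)) * indicator ?B y) \<in> borel_measurable lebesgue" using bm by measurable
      then have "(\<integral>\<^sup>+y. 2 * (ennreal (norm (b y - ?d)) * indicator ?B y) \<partial>lebesgue) = 2 * (\<integral>\<^sup>+y\<in>?B. ennreal (norm (b y - ?d)) \<partial>lebesgue)"
        by (rule nn_integral_cmult)
      then show ?thesis unfolding nn_integral_completion .
    qed
    also have "\<dots> \<le> 2 * (ennreal L0 * emeasure lborel ?B)" by (intro mult_left_mono le) simp
    also have "\<dots> \<le> ennreal (2 * L0 + 1) * emeasure lborel ?B"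
    proof -
      have "2 * ennreal L0 = ennreal (2 * L0)" using L0 by (simp add: ennreal_mult)
      then have "2 * ennreal L0 \<le> ennreal (2 * L0 + 1)" using L0 by (simp add: ennreal_leI)
      then show ?thesis unfolding mult.assoc[symmetric] by (rule mult_right_mono) simp
    qed
    finally show "(\<integral>\<^sup>+y\<in>?B. ennreal \<bar>\<beta> y - m c r\<bar> \<partial>lborel) \<le> ennreal (2 * L0 + 1) * emeasure lborel ?B" .
  qed (use L0 in auto)
  then show ?thesis using ae by (rule that)
qed

section \<open>Assembling the estimate on balls\<close>

lemma epowr_sum4_le:
  assumes p: "0 < p"
  shows "epowr (x + y + z + u) p \<le> ennreal (4 powr p) * (epowr x p + epowr y p + epowr z p + epowr u p)"
proof -
  have "epowr (x + y + z + u) p \<le> ennreal (2 powr p) * (epowr (x + y) p + epowr (z + u) p)"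
    using epowr_sum_le[OF p, of "x + y" "z + u"] by (simp add: add.assoc)
  also have "\<dots> \<le> ennreal (2 powr p) * (ennreal (2 powr p) * (epowr x p + epowr y p) + ennreal (2 powr p) * (epowr z p + epowr u p))"
    by (intro mult_left_mono add_mono epowr_sum_le p) simp
  also have "\<dots> = ennreal (2 powr p * 2 powr p) * (epowr x p + epowr y p + epowr z p + epowr u p)"
    by (simp add: ennreal_mult mult.assoc distrib_left[symmetric] add.assoc)
  also have "2 powr p * 2 powr p = 4 powr p" by (simp add: powr_mult[symmetric])
  finally show ?thesis .
qed

text \<open>Four conjugated operators, two coordinates with two signs each, share one parameter
  \<open>\<gamma>\<close>. The power \<open>t * Q\<close> undoes the root of order \<open>t\<close>
  in the pointwise bound, so that each of them is needed only at the exponent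
  \<open>Q\<close>.\<close>

lemma commutator_ball_estimate:
  fixes \<Omega>' :: "'a::euclidean_space \<Rightarrow> real"
  assumes kernel: "kernel_bound \<Omega>' M t"
    and M: "0 \<le> M"
    and pair: "weight_pair v u a K" and b1: "bmo b1 m1 L1" and b2: "bmo b2 m2 L2"
    and t: "0 < t" and e: "0 < e" "e < 1" "real DIM('a) * e = real DIM('a) - \<alpha> * t"
  defines "Q \<equiv> 1 / (a * e)" and "P \<equiv> 1 / (a * e + 1 - e)"
  assumes \<kappa>: "0 < \<kappa>" "\<kappa> < P / Q"
  obtains C where "0 \<le> C" "\<And>f' N c r. f' \<in> borel_measurable borel \<Longrightarrow> (\<And>y. 0 \<le> f' y) \<Longrightarrow>
    (\<And>c r. 0 < r \<Longrightarrow> (\<integral>\<^sup>+x\<in>ball c r. epowr (ennreal (f' x powr t) * ennreal (v x powr (a * e))) P \<partial>lborel) \<le> N * epowr (emeasure (wt v) (ball c r)) \<kappa>) \<Longrightarrow>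
    0 < r \<Longrightarrow> (\<integral>\<^sup>+x\<in>ball c r. epowr (SUP \<rho>\<in>{0<..}. ennreal (1 / \<rho> powr (real DIM('a) - \<alpha>)) *
        (\<integral>\<^sup>+y\<in>cball x \<rho>. ennreal (\<Omega>' (x - y)) * ennreal ((\<bar>b1 x - b1 y\<bar> + \<bar>b2 x - b2 y\<bar>) * f' y) \<partial>lborel)) (t * Q) \<partial>wt v)
      \<le> ennreal C * epowr N (Q / P) * epowr (emeasure (wt v) (ball c r)) (\<kappa> * Q / P)"
proof -
  interpret weight_pair v u a K by (rule pair)
  interpret B1: bmo b1 m1 L1 by (rule b1)
  interpret B2: bmo b2 m2 L2 by (rule b2)
  interpret W1: weight_pair_bmo v u a K b1 m1 L1 ..
  interpret W2: weight_pair_bmo v u a K b2 m2 L2 ..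
  have QP: "0 < Q" using a_pos e by (simp add: Q_def)
  define morrey where "morrey s \<beta> C \<longleftrightarrow> (\<forall>G N. G \<in> borel_measurable borel \<longrightarrow>
       (\<forall>c r. 0 < r \<longrightarrow> (\<integral>\<^sup>+x\<in>ball c r. epowr (G x * ennreal (v x powr (a * e))) P \<partial>lborel) \<le> N * epowr (emeasure (wt v) (ball c r)) \<kappa>) \<longrightarrow>
       (\<forall>c r. 0 < r \<longrightarrow>
         (\<integral>\<^sup>+x\<in>ball c r. epowr (conj_frac e s \<beta> G x) Q \<partial>wt v)
           \<le> ennreal C * epowr N (Q / P) * epowr (emeasure (wt v) (ball c r)) (\<kappa> * Q / P)))" for s \<beta> C
  obtain \<gamma>1 where \<gamma>1: "0 < \<gamma>1" "\<And>s. \<bar>s\<bar> \<le> \<gamma>1 \<Longrightarrow> \<exists>C\<ge>0. morrey s b1 C"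
    unfolding morrey_def conj_frac_def Q_def P_def
    by (rule W1.morrey_conjugate[OF e(1,2) \<kappa>[unfolded Q_def P_def]]) blast
  obtain \<gamma>2 where \<gamma>2: "0 < \<gamma>2" "\<And>s. \<bar>s\<bar> \<le> \<gamma>2 \<Longrightarrow> \<exists>C\<ge>0. morrey s b2 C"
    unfolding morrey_def conj_frac_def Q_def P_def
    by (rule W2.morrey_conjugate[OF e(1,2) \<kappa>[unfolded Q_def P_def]]) blast
  define \<gamma> where "\<gamma> = min \<gamma>1 \<gamma>2"
  have \<gamma>: "0 < \<gamma>" "\<bar>\<gamma>\<bar> \<le> \<gamma>1" "\<bar>- \<gamma>\<bar> \<le> \<gamma>1" "\<bar>\<gamma>\<bar> \<le> \<gamma>2" "\<bar>- \<gamma>\<bar> \<le> \<gamma>2" using \<gamma>1 \<gamma>2 by (auto simp: \<gamma>_def)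
  obtain C1 C2 C3 C4 where C: "0 \<le> C1" "morrey \<gamma> b1 C1" "0 \<le> C2" "morrey (- \<gamma>) b1 C2"
    "0 \<le> C3" "morrey \<gamma> b2 C3" "0 \<le> C4" "morrey (- \<gamma>) b2 C4"
    using \<gamma>1(2)[OF \<gamma>(2)] \<gamma>1(2)[OF \<gamma>(3)] \<gamma>2(2)[OF \<gamma>(4)] \<gamma>2(2)[OF \<gamma>(5)] by blast
  define M' where "M' = M * ((2 * t / \<gamma>) powr t * 2 powr (real DIM('a) * e)) powr (1 / t)"
  have M': "0 \<le> M'" using M by (simp add: M'_def)
  define D where "D = M' powr (t * Q) * 4 powr Q"
  have D: "0 \<le> D" by (simp add: D_def)
  show ?thesis
  proof (rule that[of "D * (C1 + C2 + C3 + C4)"])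
    show "0 \<le> D * (C1 + C2 + C3 + C4)" using C D by simp
    fix f' :: "'a \<Rightarrow> real" and N and c :: 'a and r :: real
    assume [measurable]: "f' \<in> borel_measurable borel" and f': "\<And>y. 0 \<le> f' y" and r: "0 < r"
      and GN: "\<And>c r. 0 < r \<Longrightarrow> (\<integral>\<^sup>+x\<in>ball c r. epowr (ennreal (f' x powr t) * ennreal (v x powr (a * e))) P \<partial>lborel) \<le> N * epowr (emeasure (wt v) (ball c r)) \<kappa>"
    define G where "G y = ennreal (f' y powr t)" for y
    have [measurable]: "G \<in> borel_measurable borel" unfolding G_def by measurable
    let ?B = "ball c r"
    have [measurable]: "?B \<in> sets borel" by simp
    let ?T1 = "conj_frac e \<gamma> b1 G" and ?T2 = "conj_frac e (- \<gamma>) b1 G" and ?T3 = "conj_frac e \<gamma> b2 G" and ?T4 = "conj_frac e (- \<gamma>) b2 G"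
    let ?X = "epowr N (Q / P) * epowr (emeasure (wt v) ?B) (\<kappa> * Q / P)"
    let ?S = "\<lambda>x. SUP \<rho>\<in>{0<..}. ennreal (1 / \<rho> powr (real DIM('a) - \<alpha>)) *
        (\<integral>\<^sup>+y\<in>cball x \<rho>. ennreal (\<Omega>' (x - y)) * ennreal ((\<bar>b1 x - b1 y\<bar> + \<bar>b2 x - b2 y\<bar>) * f' y) \<partial>lborel)"
    have T: "(\<integral>\<^sup>+x\<in>?B. epowr (conj_frac e s \<beta> G x) Q \<partial>wt v) \<le> ennreal C * ?X" if "morrey s \<beta> C" for s \<beta> C
      using that GN r \<open>G \<in> _\<close> unfolding morrey_def G_def mult.assoc by blast
    have S: "?S x \<le> ennreal M' * epowr (?T1 x + ?T2 x + ?T3 x + ?T4 x) (1 / t)" for x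
    proof (rule SUP_least)
      fix \<rho> :: real assume "\<rho> \<in> {0<..}"
      then show "ennreal (1 / \<rho> powr (real DIM('a) - \<alpha>)) *
        (\<integral>\<^sup>+y\<in>cball x \<rho>. ennreal (\<Omega>' (x - y)) * ennreal ((\<bar>b1 x - b1 y\<bar> + \<bar>b2 x - b2 y\<bar>) * f' y) \<partial>lborel)
        \<le> ennreal M' * epowr (?T1 x + ?T2 x + ?T3 x + ?T4 x) (1 / t)"
        unfolding M'_def G_def using f' \<gamma>(1) t e(3) by (intro commutator_pointwise[OF kernel M]) auto
    qed
    have "epowr (?S x) (t * Q) \<le> ennreal D * (epowr (?T1 x) Q + epowr (?T2 x) Q + epowr (?T3 x) Q + epowr (?T4 x) Q)" for x
    proof -
      have "epowr (?S x) (t * Q) \<le> epowr (ennreal M' * epowr (?T1 x + ?T2 x + ?T3 x + ?T4 x) (1 / t)) (t * Q)"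
        using t QP by (intro epowr_mono S) auto
      also have "\<dots> = ennreal (M' powr (t * Q)) * epowr (?T1 x + ?T2 x + ?T3 x + ?T4 x) Q"
        using t QP M' by (simp add: epowr_mult epowr_epowr epowr_ennreal)
      also have "\<dots> \<le> ennreal (M' powr (t * Q)) * (ennreal (4 powr Q) * (epowr (?T1 x) Q + epowr (?T2 x) Q + epowr (?T3 x) Q + epowr (?T4 x) Q))"
        by (intro mult_left_mono epowr_sum4_le QP) simp
      also have "\<dots> = ennreal D * (epowr (?T1 x) Q + epowr (?T2 x) Q + epowr (?T3 x) Q + epowr (?T4 x) Q)"
        unfolding D_def by (intro ennreal_mult_assoc) auto
      finally show ?thesis .
    qed
    then have "(\<integral>\<^sup>+x\<in>?B. epowr (?S x) (t * Q) \<partial>wt v)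
      \<le> (\<integral>\<^sup>+x. ennreal D * (epowr (?T1 x) Q * indicator ?B x + epowr (?T2 x) Q * indicator ?B x + epowr (?T3 x) Q * indicator ?B x + epowr (?T4 x) Q * indicator ?B x) \<partial>wt v)"
      by (intro nn_integral_mono) (auto simp: indicator_def)
    also have "\<dots> = ennreal D * ((\<integral>\<^sup>+x\<in>?B. epowr (?T1 x) Q \<partial>wt v) + (\<integral>\<^sup>+x\<in>?B. epowr (?T2 x) Q \<partial>wt v) + (\<integral>\<^sup>+x\<in>?B. epowr (?T3 x) Q \<partial>wt v) + (\<integral>\<^sup>+x\<in>?B. epowr (?T4 x) Q \<partial>wt v))"
      by (subst nn_integral_cmult, measurable, subst nn_integral_add, measurable, subst nn_integral_add, measurable, subst nn_integral_add, measurable)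
    also have "\<dots> \<le> ennreal D * (ennreal C1 * ?X + ennreal C2 * ?X + ennreal C3 * ?X + ennreal C4 * ?X)"
      by (intro mult_left_mono add_mono T C) simp
    also have "\<dots> = ennreal (D * (C1 + C2 + C3 + C4)) * ?X"
      using C D by (simp add: ennreal_mult ennreal_plus add_nonneg_nonneg distrib_right mult.assoc del: ennreal_plus) (simp add: distrib_right mult.assoc)
    finally show "(\<integral>\<^sup>+x\<in>?B. epowr (?S x) (t * Q) \<partial>wt v)
      \<le> ennreal (D * (C1 + C2 + C3 + C4)) * epowr N (Q / P) * epowr (emeasure (wt v) ?B) (\<kappa> * Q / P)"
      by (simp add: mult.assoc)
  qed
qed

lemma nn_integral_weight_zero:
  fixes w :: "'a::euclidean_space \<Rightarrow> real"
  assumes "AE x in lborel. w x = 0" "q \<noteq> 0"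
  shows "(\<integral>\<^sup>+x\<in>A. F x * ennreal (w x powr q) \<partial>lebesgue) = 0"
proof -
  have "(\<integral>\<^sup>+x\<in>A. F x * ennreal (w x powr q) \<partial>lborel) = nn_integral (lborel :: 'a measure) (\<lambda>_. 0)"
    by (rule nn_integral_cong_AE) (use assms(1) in eventually_elim, use assms(2) in simp)
  then show ?thesis unfolding nn_integral_completion by simp
qed

lemma ennreal_div_cancel:
  assumes "0 < x"
  shows "1 / ennreal x * (y * ennreal x) = y"
proof -
  have "1 / ennreal x * ennreal x = 1" using assms by (simp add: divide_ennreal_def inverse_ennreal ennreal_mult[symmetric])
  then show ?thesis by (metis (no_types, lifting) mult.assoc mult.commute mult.right_neutral)
qed

lemma ennreal_div_le_imp:
  assumes "0 < x" "1 / ennreal x * y \<le> z"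
  shows "y \<le> z * ennreal x"
proof -
  have "1 / ennreal x * y * ennreal x = y" using ennreal_div_cancel[OF assms(1), of y] by (simp add: mult.assoc)
  then show ?thesis using mult_right_mono[OF assms(2), of "ennreal x"] by simp
qed

theorem corollary5p1:
  fixes \<Omega> b :: "'a::euclidean_space \<Rightarrow> 'k::{real_normed_field, banach, second_countable_topology}"
    and w :: "'a \<Rightarrow> real"
    and s :: ereal
    and \<alpha> p q \<kappa> :: real
  assumes "DIM('a) \<ge> 2"
    and "1 < s"
    and "\<Omega> \<in> Lp_sphere s"
    and "homogeneous_degree_zero \<Omega>"
    and "b \<in> BMO"
    and "0 < \<alpha>" and "\<alpha> < real DIM('a)"
    and "1 \<le> conj_exponent s" and "conj_exponent s < p" and "p < real DIM('a) / \<alpha>"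
    and "1 / q = 1 / p - \<alpha> / real DIM('a)"
    and "0 < \<kappa>" and "\<kappa> < p / q"
    and "weight w"
    and "(\<lambda>x. w x powr conj_exponent s) \<in> A_class (p / conj_exponent s) (q / conj_exponent s)"
  shows "\<exists>C>0. \<forall>f :: 'a \<Rightarrow> 'k.
    f \<in> morrey_space p \<kappa> (\<lambda>x. w x powr p) (\<lambda>x. w x powr q) \<longrightarrow>
      commutator_maximal b \<Omega> \<alpha> f
        \<in> emorrey_space q (\<kappa> * q / p) (\<lambda>x. w x powr q) (\<lambda>x. w x powr q) \<and>
      emorrey_norm q (\<kappa> * q / p) (\<lambda>x. w x powr q) (\<lambda>x. w x powr q) (commutator_maximal b \<Omega> \<alpha> f)
        \<le> ennreal C * morrey_norm p \<kappa> (\<lambda>x. w x powr p) (\<lambda>x. w x powr q) f"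
proof -
  let ?n = "real DIM('a)"
  define t where "t = conj_exponent s"
  define P Q where "P = p / t" and "Q = q / t"
  define P' where "P' = P / (P - 1)"
  define e where "e = 1 / Q + 1 / P'"
  define a where "a = 1 / (Q * e)"
  have t: "1 \<le> t" "0 < t" "t < p" using assms(8,9) by (auto simp: t_def)
  have p: "0 < p" using t by simp
  have ap: "\<alpha> * p < ?n" using assms(6,10) by (simp add: pos_less_divide_eq mult.commute)
  have "0 < 1 / q"
  proof -
    have "\<alpha> / ?n < 1 / p" using ap p by (simp add: field_simps)
    then show ?thesis using assms(11) by simp
  qed
  then have q: "0 < q" by simp
  have PQ: "1 < P" "0 < P" "0 < Q" using t q by (auto simp: P_def Q_def)
  have P': "0 < P'" "1 / P' = 1 - 1 / P" using PQ by (auto simp: P'_def field_simps)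
  \<comment> \<open>The same number from two sides: the exponent sum of the weight class and the
    order of the fractional operator.\<close>
  have e_eq: "e = 1 - \<alpha> * t / ?n"
  proof -
    have "1 / Q - 1 / P = t * (1 / q - 1 / p)" by (simp add: P_def Q_def algebra_simps)
    also have "\<dots> = - (\<alpha> * t / ?n)" unfolding assms(11) by (simp add: algebra_simps)
    finally show ?thesis unfolding e_def P' by simp
  qed
  have n_e: "?n * e = ?n - \<alpha> * t" unfolding e_eq by (simp add: right_diff_distrib)
  have e: "0 < e" "e < 1"
  proof -
    show "0 < e" using PQ P' by (simp add: e_def add_pos_pos)
    show "e < 1" unfolding e_eq using assms(6) t by simp
  qed
  have ae: "a * e = 1 / Q" using e PQ by (simp add: a_def)
  have Q_eq: "1 / (a * e) = Q" unfolding ae by simp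
  have "a * e + 1 - e = 1 / P" unfolding ae by (simp add: e_def P')
  then have P_eq: "1 / (a * e + 1 - e) = P" by simp
  have \<kappa>: "0 < \<kappa>" "\<kappa> < P / Q" using assms(12,13) t by (auto simp: P_def Q_def)
  have tQ: "t * Q = q" and tP: "t * P = p" and QP: "Q / P = q / p"
    using t by (auto simp: P_def Q_def)

  obtain A B :: "'k \<Rightarrow> real" and j :: 'k where coord: "\<And>x. x = of_real (A x) + of_real (B x) * j" and j: "norm j \<le> 1"
    and lip: "\<And>x y. \<bar>A x - A y\<bar> \<le> 2 * norm (x - y)" "\<And>x y. \<bar>B x - B y\<bar> \<le> 2 * norm (x - y)"
    by (rule real_coordinates) blast
  obtain b1 m1 L1 where b1: "bmo b1 m1 L1" "AE x in lborel. A (b x) = b1 x"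
    by (rule BMO_component[OF assms(5) lip(1)])
  obtain b2 m2 L2 where b2: "bmo b2 m2 L2" "AE x in lborel. B (b x) = b2 x"
    by (rule BMO_component[OF assms(5) lip(2)])
  have [measurable]: "b1 \<in> borel_measurable borel" "b2 \<in> borel_measurable borel"
    using b1(1) b2(1) by (auto simp: bmo_def)
  have b_ae: "AE x in lborel. b x = of_real (b1 x) + of_real (b2 x) * j"
    using b1(2) b2(2) by eventually_elim (use coord in metis)
  obtain \<Omega>' :: "'a \<Rightarrow> real" and M where [measurable]: "\<Omega>' \<in> borel_measurable borel" and \<Omega>'0: "\<And>z. 0 \<le> \<Omega>' z"
    and \<Omega>_ae: "AE z in lborel. norm (\<Omega> z) = \<Omega>' z" and M: "0 \<le> M"
    and kernel: "kernel_bound \<Omega>' M t"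
    unfolding t_def by (rule kernel_Hoelder[OF assms(3,4,2)]) blast
  have f_rep: "\<exists>f'. f' \<in> borel_measurable borel \<and> (\<forall>x. 0 \<le> f' x) \<and> (AE x in lborel. norm (f x) = f' x)"
    if f: "f \<in> borel_measurable lebesgue" for f :: "'a \<Rightarrow> 'k"
  proof -
    have "(\<lambda>x. norm (f x)) \<in> borel_measurable lebesgue" using f by measurable
    then obtain g where [measurable]: "g \<in> borel_measurable borel" and g: "AE x in lborel. norm (f x) = g x"
      using completion_ex_borel_measurable_real[of _ lborel] by force
    have "AE x in lborel. norm (f x) = \<bar>g x\<bar>" using g by eventually_elim (metis abs_norm_cancel)
    then show ?thesis by (intro exI[of _ "\<lambda>x. \<bar>g x\<bar>"]) auto
  qed
  have meas: "commutator_maximal b \<Omega> \<alpha> f \<in> borel_measurable lebesgue" if f: "f \<in> borel_measurable lebesgue" for f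
  proof -
    obtain f' where "f' \<in> borel_measurable borel" "AE x in lborel. norm (f x) = f' x" using f_rep[OF f] by blast
    then show ?thesis by (intro commutator_maximal_measurable[OF b_ae _ \<Omega>_ae]) auto
  qed

  show ?thesis
  proof (cases "AE x in lborel. w x = 0")
    case True
    note 0 = nn_integral_weight_zero[OF True, of q]
    \<comment> \<open>Every integral in the supremum vanishes, and
      \<open>\<infinity> * 0 = 0\<close> takes care of the reciprocal of the measure of the
      ball.\<close>
    have "emorrey_norm q (\<kappa> * q / p) (\<lambda>x. w x powr q) (\<lambda>x. w x powr q) F \<le> 0" for F
      unfolding emorrey_norm_def by (rule SUP_least) (use q 0 in simp)
    then show ?thesis
      using meas q 0 by (intro exI[of _ 1]) (auto simp: morrey_space_def emorrey_space_def)
  next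
    case False
    obtain w' K where [measurable]: "w' \<in> borel_measurable borel" and w': "\<And>x. 0 < w' x" and w_ae: "AE x in lborel. w x = w' x"
      and pair': "weight_pair (\<lambda>x. w' x powr (t * Q)) (\<lambda>x. w' x powr (- t * P')) (1 / (Q * e)) K"
      unfolding e_def P'_def
      by (rule A_class_weight_pair[OF assms(15)[folded t_def, folded P_def Q_def] assms(14) PQ(1,3) t(2) False]) blast
    define v where "v x = w' x powr q" for x
    define u where "u x = w' x powr (- t * P')" for x
    have pair: "weight_pair v u a K" using pair' unfolding v_def[abs_def] u_def[abs_def] a_def tQ .
    interpret weight_pair v u a K by (rule pair)
    \<comment> \<open>Hence the integrand required by \<open>est\<close> is the one of the given
      Morrey norm: with \<open>t * P = p\<close> it equals \<open>f'\<close> to the power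
      \<open>p\<close> times \<open>w'\<close> to the power \<open>p\<close>.\<close>
    have v_ae: "v x powr (a * e) = w' x powr t" for x
      using w'[of x] q t unfolding v_def ae by (simp add: powr_powr Q_def)
    obtain C where C: "0 \<le> C" and est: "\<And>f' N c r. f' \<in> borel_measurable borel \<Longrightarrow> (\<And>y. 0 \<le> f' y) \<Longrightarrow>
      (\<And>c r. 0 < r \<Longrightarrow> (\<integral>\<^sup>+x\<in>ball c r. epowr (ennreal (f' x powr t) * ennreal (v x powr (a * e))) P \<partial>lborel) \<le> N * epowr (emeasure (wt v) (ball c r)) \<kappa>) \<Longrightarrow>
      0 < r \<Longrightarrow> (\<integral>\<^sup>+x\<in>ball c r. epowr (SUP \<rho>\<in>{0<..}. ennreal (1 / \<rho> powr (?n - \<alpha>)) *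
        (\<integral>\<^sup>+y\<in>cball x \<rho>. ennreal (\<Omega>' (x - y)) * ennreal ((\<bar>b1 x - b1 y\<bar> + \<bar>b2 x - b2 y\<bar>) * f' y) \<partial>lborel)) (t * Q) \<partial>wt v)
      \<le> ennreal C * epowr N (Q / P) * epowr (emeasure (wt v) (ball c r)) (\<kappa> * Q / P)"
      by (rule commutator_ball_estimate[OF kernel M pair b1(1) b2(1) t(2) e n_e, unfolded Q_eq P_eq, OF \<kappa>]) blast
    have wm: "weight_measure (\<lambda>x. w x powr q) (ball c r) = emeasure (wt v) (ball c r)" for c r
      unfolding weight_measure_def nn_integral_completion
      by (subst emeasure_wt, simp, simp, rule nn_integral_cong_AE) (use w_ae in eventually_elim, simp add: v_def)
    define m where "m c r = measure (wt v) (ball c r)" for c r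
    have em: "emeasure (wt v) (ball c r) = ennreal (m c r)" for c r
      using ball_finite[of c r] by (simp add: m_def emeasure_eq_ennreal_measure)
    have m_pos: "0 < m c r" if "0 < r" for c r using ball_pos[OF that, of c] unfolding em by simp
    show ?thesis
    proof (intro exI[of _ "C powr (1 / q) + 1"] conjI allI impI)
      show "0 < C powr (1 / q) + 1" by (simp add: add_nonneg_pos)
      fix f :: "'a \<Rightarrow> 'k"
      assume f: "f \<in> morrey_space p \<kappa> (\<lambda>x. w x powr p) (\<lambda>x. w x powr q)"
      define nf where "nf = morrey_norm p \<kappa> (\<lambda>x. w x powr p) (\<lambda>x. w x powr q) f"
      define F where "F = commutator_maximal b \<Omega> \<alpha> f"
      have fm: "f \<in> borel_measurable lebesgue" and nf: "nf < top"
        using f by (auto simp: morrey_space_def emorrey_space_def nf_def morrey_norm_def)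
      have Fm: "F \<in> borel_measurable lebesgue" unfolding F_def by (rule meas[OF fm])
      obtain f' where [measurable]: "f' \<in> borel_measurable borel" and f'0: "\<And>x. 0 \<le> f' x" and f_ae: "AE x in lborel. norm (f x) = f' x"
        using f_rep[OF fm] by blast
      \<comment> \<open>The Morrey norm is a supremum of \<open>p\<close>-th roots; its
        \<open>p\<close>-th power is the constant in the inequality on balls that \<open>est\<close>
        expects.\<close>
      define N where "N = epowr nf p"
      have N: "N < top" using nf p by (simp add: N_def)
      have GN: "(\<integral>\<^sup>+x\<in>ball c r. epowr (ennreal (f' x powr t) * ennreal (v x powr (a * e))) P \<partial>lborel) \<le> N * epowr (emeasure (wt v) (ball c r)) \<kappa>"
        if r: "0 < r" for c r
      proof -
        have "(\<integral>\<^sup>+x\<in>ball c r. epowr (ennreal (f' x powr t) * ennreal (v x powr (a * e))) P \<partial>lborel)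
          = (\<integral>\<^sup>+x\<in>ball c r. epowr (ennreal (norm (f x))) p * ennreal (w x powr p) \<partial>lebesgue)" (is "?L = ?I")
          unfolding nn_integral_completion
        proof (rule nn_integral_cong_AE, use w_ae f_ae in eventually_elim)
          fix x assume *: "w x = w' x" "norm (f x) = f' x"
          show "epowr (ennreal (f' x powr t) * ennreal (v x powr (a * e))) P * indicator (ball c r) x
             = epowr (ennreal (norm (f x))) p * ennreal (w x powr p) * indicator (ball c r) x"
            using PQ p f'0[of x] w'[of x] unfolding v_ae * by (simp add: epowr_mult epowr_ennreal powr_powr tP)
        qed
        moreover have "epowr (1 / epowr (weight_measure (\<lambda>x. w x powr q) (ball c r)) \<kappa> * ?I) (1 / p) \<le> nf"
          unfolding nf_def morrey_norm_def emorrey_norm_def using ball_in_balls[OF r] by (rule SUP_upper)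
        then have "1 / epowr (ennreal (m c r)) \<kappa> * ?I \<le> N"
          unfolding wm em N_def using p by (subst (asm) epowr_le_swap) auto
        then have "?I \<le> N * epowr (ennreal (m c r)) \<kappa>"
          using \<kappa> m_pos[OF r, of c] by (simp add: epowr_ennreal ennreal_div_le_imp)
        ultimately show ?thesis unfolding em by simp
      qed
      define S where "S x = (SUP \<rho>\<in>{0<..}. ennreal (1 / \<rho> powr (?n - \<alpha>)) *
        (\<integral>\<^sup>+y\<in>cball x \<rho>. ennreal (\<Omega>' (x - y)) * ennreal ((\<bar>b1 x - b1 y\<bar> + \<bar>b2 x - b2 y\<bar>) * f' y) \<partial>lborel))" for x
      have F_le: "AE x in lborel. F x \<le> S x"
        using commutator_maximal_eq[OF b_ae f_ae \<Omega>_ae]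
      proof eventually_elim
        case (elim x)
        show ?case
          unfolding F_def commutator_maximal_def S_def elim[rule_format]
        proof (rule SUP_mono', rule mult_left_mono, rule nn_integral_mono)
          fix \<rho> y
          have "norm (of_real (b1 x - b1 y) + of_real (b2 x - b2 y) * j :: 'k) \<le> \<bar>b1 x - b1 y\<bar> + \<bar>b2 x - b2 y\<bar> * norm j"
            using norm_triangle_ineq[of "of_real (b1 x - b1 y) :: 'k" "of_real (b2 x - b2 y) * j"]
            by (simp only: norm_mult norm_of_real)
          also have "\<dots> \<le> \<bar>b1 x - b1 y\<bar> + \<bar>b2 x - b2 y\<bar> * 1"
            using j by (intro add_left_mono mult_left_mono) auto
          finally have "norm (of_real (b1 x - b1 y) + of_real (b2 x - b2 y) * j :: 'k) * (\<Omega>' (x - y) * f' y)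
             \<le> (\<bar>b1 x - b1 y\<bar> + \<bar>b2 x - b2 y\<bar>) * (\<Omega>' (x - y) * f' y)"
            using \<Omega>'0 f'0 by (intro mult_right_mono) auto
          also have "\<dots> = \<Omega>' (x - y) * ((\<bar>b1 x - b1 y\<bar> + \<bar>b2 x - b2 y\<bar>) * f' y)" by (simp add: mult_ac)
          finally show "ennreal (norm (of_real (b1 x - b1 y) + of_real (b2 x - b2 y) * j :: 'k) * (\<Omega>' (x - y) * f' y)) * indicator (cball x \<rho>) y
            \<le> ennreal (\<Omega>' (x - y)) * ennreal ((\<bar>b1 x - b1 y\<bar> + \<bar>b2 x - b2 y\<bar>) * f' y) * indicator (cball x \<rho>) y"
            using \<Omega>'0 f'0 by (intro mult_right_mono) (auto simp: ennreal_mult[symmetric] intro!: ennreal_leI)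
        qed simp
      qed
      \<comment> \<open>The measure \<open>wt v\<close> lives on the Borel sets whereas
        \<open>F\<close> is only Lebesgue measurable, so a Borel function takes its place under the
        integral.\<close>
      obtain F' where [measurable]: "F' \<in> borel_measurable borel" and F': "AE x in lborel. F x = F' x"
        using completion_ex_borel_measurable[OF Fm] by auto
      have bound: "(\<integral>\<^sup>+x\<in>ball c r. epowr (F x) q * ennreal (w x powr q) \<partial>lebesgue) \<le> ennreal C * epowr N (q / p) * epowr (ennreal (m c r)) (\<kappa> * q / p)"
        if r: "0 < r" for c r
      proof -
        have [measurable]: "ball c r \<in> sets borel" by simp
        have "(\<integral>\<^sup>+x\<in>ball c r. epowr (F x) q * ennreal (w x powr q) \<partial>lebesgue) = (\<integral>\<^sup>+x. ennreal (v x) * (epowr (F' x) q * indicator (ball c r) x) \<partial>lborel)"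
          unfolding nn_integral_completion
          by (rule nn_integral_cong_AE) (use w_ae F' in eventually_elim, simp add: v_def mult_ac)
        also have "\<dots> = (\<integral>\<^sup>+x\<in>ball c r. epowr (F' x) q \<partial>wt v)"
          by (rule nn_integral_wt[symmetric]) measurable
        also have "\<dots> \<le> (\<integral>\<^sup>+x\<in>ball c r. epowr (S x) (t * Q) \<partial>wt v)"
        proof (rule nn_integral_mono_AE)
          have "AE x in lborel. F' x \<le> S x" using F' F_le by eventually_elim simp
          then have "AE x in wt v. F' x \<le> S x" unfolding wt_def by (subst AE_density) auto
          then show "AE x in wt v. epowr (F' x) q * indicator (ball c r) x \<le> epowr (S x) (t * Q) * indicator (ball c r) x"
            unfolding tQ by eventually_elim (use q in \<open>auto intro!: mult_right_mono epowr_mono\<close>)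
        qed
        also have "\<dots> \<le> ennreal C * epowr N (Q / P) * epowr (emeasure (wt v) (ball c r)) (\<kappa> * Q / P)"
          unfolding S_def by (rule est[OF _ f'0 GN r]) auto
        also have "\<kappa> * Q / P = \<kappa> * q / p" using QP by (simp add: times_divide_eq_right[symmetric] del: times_divide_eq_right)
        finally show ?thesis unfolding em QP .
      qed
      have norm_le: "emorrey_norm q (\<kappa> * q / p) (\<lambda>x. w x powr q) (\<lambda>x. w x powr q) F \<le> ennreal (C powr (1 / q) + 1) * nf"
        unfolding emorrey_norm_def
      proof (rule SUP_least)
        fix B :: "'a set" assume "B \<in> balls"
        then obtain c r where B: "B = ball c r" and r: "0 < r" by (rule ballsE)
        have kq: "0 < \<kappa> * q / p" using \<kappa> q p by simp
        have "1 / epowr (weight_measure (\<lambda>x. w x powr q) B) (\<kappa> * q / p) * (\<integral>\<^sup>+x\<in>B. epowr (F x) q * ennreal (w x powr q) \<partial>lebesgue)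
          \<le> 1 / epowr (ennreal (m c r)) (\<kappa> * q / p) * (ennreal C * epowr N (q / p) * epowr (ennreal (m c r)) (\<kappa> * q / p))"
          unfolding B wm em by (intro mult_left_mono bound r) simp
        also have "\<dots> = ennreal C * epowr N (q / p)"
          using m_pos[OF r, of c] kq by (simp only: epowr_ennreal less_imp_le) (rule ennreal_div_cancel, simp)
        finally have "epowr (1 / epowr (weight_measure (\<lambda>x. w x powr q) B) (\<kappa> * q / p) * (\<integral>\<^sup>+x\<in>B. epowr (F x) q * ennreal (w x powr q) \<partial>lebesgue)) (1 / q)
          \<le> epowr (ennreal C * epowr N (q / p)) (1 / q)"
          using q by (intro epowr_mono) auto
        also have "\<dots> = ennreal (C powr (1 / q)) * nf"
          using q p C by (simp add: N_def epowr_mult epowr_epowr epowr_ennreal)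
        also have "\<dots> \<le> ennreal (C powr (1 / q) + 1) * nf"
          by (intro mult_right_mono ennreal_leI) auto
        finally show "epowr (1 / epowr (weight_measure (\<lambda>x. w x powr q) B) (\<kappa> * q / p) * (\<integral>\<^sup>+x\<in>B. epowr (F x) q * ennreal (w x powr q) \<partial>lebesgue)) (1 / q)
          \<le> ennreal (C powr (1 / q) + 1) * nf" .
      qed
      then show "emorrey_norm q (\<kappa> * q / p) (\<lambda>x. w x powr q) (\<lambda>x. w x powr q) (commutator_maximal b \<Omega> \<alpha> f)
        \<le> ennreal (C powr (1 / q) + 1) * morrey_norm p \<kappa> (\<lambda>x. w x powr p) (\<lambda>x. w x powr q) f"
        unfolding F_def nf_def .
      have "(\<integral>\<^sup>+x\<in>Z. epowr (F x) q * ennreal (w x powr q) \<partial>lebesgue) < top" if Z: "compact Z" for Z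
      proof -
        obtain R where R: "0 < R" "Z \<subseteq> ball 0 R"
          using bounded_subset_ballD[OF compact_imp_bounded[OF Z], of 0] by blast
        have "(\<integral>\<^sup>+x\<in>Z. epowr (F x) q * ennreal (w x powr q) \<partial>lebesgue) \<le> (\<integral>\<^sup>+x\<in>ball 0 R. epowr (F x) q * ennreal (w x powr q) \<partial>lebesgue)"
          using R(2) by (intro nn_integral_mono) (auto simp: indicator_def)
        also have "\<dots> \<le> ennreal C * epowr N (q / p) * epowr (ennreal (m 0 R)) (\<kappa> * q / p)"
          by (rule bound[OF R(1)])
        also have "\<dots> < top"
          using N q p \<kappa> by (intro ennreal_mult_less_top[THEN iffD2]) (auto simp: ennreal_mult_less_top)
        finally show ?thesis .
      qed
      moreover have "emorrey_norm q (\<kappa> * q / p) (\<lambda>x. w x powr q) (\<lambda>x. w x powr q) F < top"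
        using norm_le by (rule order_le_less_trans) (use nf in \<open>simp add: ennreal_mult_less_top\<close>)
      ultimately show "commutator_maximal b \<Omega> \<alpha> f \<in> emorrey_space q (\<kappa> * q / p) (\<lambda>x. w x powr q) (\<lambda>x. w x powr q)"
        using Fm unfolding emorrey_space_def F_def by simp
    qed
  qed
qed

end
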